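(* Suppose $G$ is a connected graph with a cycle. Then $G$ is a graph of two parallel paths if and only if $G$ is outer-planar with non-empty core $R$ such that all of the following hold: 1. the boundary of the unbounded face of $G[R]$ is a Hamiltonian cycle of $G[R]$ (the outer-cycle); 2. every induced cycle of $G$ has at most $2$ interior edges; 3. if $G[R]$ is not a cycle, then exactly two induced cycles have exactly one interior edge; and 4. either $G$ is an $\alpha$-graph, or $G-R$ is the disjoint union of paths $P^1,\dots,P^k$ with $0\le k\le 4$ such that for each $i$ there is exactly one edge $x_iy_i$ of $G$ between $P^i$ and $R$, where $x_i$ is a leaf (end vertex) of $P^i$ and $y_i\in R$, the $y_i$ are distinct, and: (i) if $G[R]$ is not a cycle, then each $y_i$ is contained in an induced cycle of $G$ with exactly one interior edge, and, with $C^1,C^2$ denoting the two induced cycles with exactly one interior edge, there is an assignment $\phi:\{y_i\}_{i=1}^k\to\{C^1,C^2\}$ such that $|\phi^{-1}(C^j)|\le 2$ for $j=1,2$, $y_i\in\phi(y_i)$ for all $i$, and, for $i\neq j$, $\phi(y_i)=\phi(y_j)$ only if $y_i$ and $y_j$ are consecutive on the outer-cycle of $G[R]$; (ii) if $G[R]$ is a cycle and $k\ge 3$, then $G[\{y_i\}_{i=1}^k]$ is (isomorphic to) one of $K_2\cup K_1$, $2K_2$, $P_3$, $P_4$, $C_3$, $C_4$.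
   Context: Graphs are finite, simple and undirected. A graph $G$ on $n$ vertices is a graph of two parallel paths if there exist two vertex-disjoint induced paths $v_1\dots v_k$ and $u_1\dots u_\ell$ in $G$ with $k+\ell=n$ such that whenever $v_iu_j\in E(G)$, $v_xu_y$ is not an edge when $x>i,\ y<j$ or $x<i,\ y>j$; by convention this includes the case that $G$ is a path $P_n$. For an outer-planar graph $G$ with a fixed outer-planar embedding, the core $R$ of $G$ is the set of vertices incident with some bounded face; equivalently, the set of vertices lying on an induced cycle of $G$. If $G[R]$ has a Hamiltonian cycle $C$ whose edges are the boundary of the unbounded face, $C$ is called the outer-cycle of $G$ (and of $G[R]$), and the edges of $G[R]$ not in $C$ are called interior edges. A path consisting of a single vertex has that vertex as its leaf. An $\alpha$-graph is a graph of two parallel paths whose core is $R=\{c_0,\dots,c_{r-1}\}$, $r\ge3$, with outer-cycle $c_0c_1\cdots c_{r-1}c_0$, all of whose interior edges are of the form $c_0c_i$ with $i\ne 0,1,r-1$, and such that $G-R$ is the disjoint union of paths $P^1,P^2,P^3,P^4$ with $p_1,p_2\ge1$ and $p_3,p_4\ge 0$ vertices respectively, where each non-empty $P^i$ is joined to $R$ by exactly one edge, from a leaf of $P^i$ to $y_i$, with $y_1=y_2=c_0$, $y_3=c_{r-1}$, $y_4=c_1$. *)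

theory Defs
  imports "HOL-Analysis.Analysis"
begin

section \<open>Finite simple graphs\<close>

text \<open>A graph is given by its vertex set \<open>V\<close> and its set \<open>E\<close> of edges, an edge being the
  two-element set of its ends.\<close>

definition simple_graph :: "'a set \<Rightarrow> 'a set set \<Rightarrow> bool" where
  "simple_graph V E \<longleftrightarrow> finite V \<and> (\<forall>e\<in>E. e \<subseteq> V \<and> card e = 2)"

definition connected_graph :: "'a set \<Rightarrow> 'a set set \<Rightarrow> bool" where
  "connected_graph V E \<longleftrightarrow> V \<noteq> {} \<and> (\<forall>u\<in>V. \<forall>v\<in>V. (u, v) \<in> {(x, y). {x, y} \<in> E}\<^sup>*)"

text \<open>The induced subgraph \<open>G[S]\<close> has vertex set \<open>S\<close> and edge set \<open>induced_edges E S\<close>.\<close>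

definition induced_edges :: "'a set set \<Rightarrow> 'a set \<Rightarrow> 'a set set" where
  "induced_edges E S = {e \<in> E. e \<subseteq> S}"

definition path_edges :: "'a list \<Rightarrow> 'a set set" where
  "path_edges xs = {{xs ! i, xs ! Suc i} | i. Suc i < length xs}"

definition cycle_edges :: "'a list \<Rightarrow> 'a set set" where
  "cycle_edges xs = {{xs ! i, xs ! (Suc i mod length xs)} | i. i < length xs}"

definition is_path_graph :: "'a set \<Rightarrow> 'a set set \<Rightarrow> 'a list \<Rightarrow> bool" where
  "is_path_graph V E xs \<longleftrightarrow> xs \<noteq> [] \<and> distinct xs \<and> set xs = V \<and> E = path_edges xs"

definition cycle_in :: "'a set \<Rightarrow> 'a set set \<Rightarrow> 'a list \<Rightarrow> bool" where
  "cycle_in V E xs \<longleftrightarrow> 3 \<le> length xs \<and> distinct xs \<and> set xs \<subseteq> V \<and> cycle_edges xs \<subseteq> E"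

definition hamiltonian_cycle :: "'a set \<Rightarrow> 'a set set \<Rightarrow> 'a list \<Rightarrow> bool" where
  "hamiltonian_cycle V E xs \<longleftrightarrow> cycle_in V E xs \<and> set xs = V"

definition is_cycle_graph :: "'a set \<Rightarrow> 'a set set \<Rightarrow> bool" where
  "is_cycle_graph V E \<longleftrightarrow> (\<exists>xs. hamiltonian_cycle V E xs \<and> E = cycle_edges xs)"

definition induced_path :: "'a set \<Rightarrow> 'a set set \<Rightarrow> 'a list \<Rightarrow> bool" where
  "induced_path V E xs \<longleftrightarrow> set xs \<subseteq> V \<and> is_path_graph (set xs) (induced_edges E (set xs)) xs"

text \<open>An induced cycle is determined by its vertex set \<open>S\<close> and has edge set
  \<open>induced_edges E S\<close>; this makes counting induced cycles meaningful.\<close>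

definition induced_cycle :: "'a set \<Rightarrow> 'a set set \<Rightarrow> 'a set \<Rightarrow> bool" where
  "induced_cycle V E S \<longleftrightarrow> S \<subseteq> V \<and> is_cycle_graph S (induced_edges E S)"

definition graph_iso :: "'a set \<times> 'a set set \<Rightarrow> 'b set \<times> 'b set set \<Rightarrow> bool" where
  "graph_iso G H \<longleftrightarrow> (\<exists>f. bij_betw f (fst G) (fst H) \<and> snd H = (\<lambda>e. f ` e) ` snd G)"

definition graph_K2_K1 :: "nat set \<times> nat set set" where
  "graph_K2_K1 = ({0, 1, 2}, {{0, 1}})"

definition graph_2K2 :: "nat set \<times> nat set set" where
  "graph_2K2 = ({0, 1, 2, 3}, {{0, 1}, {2, 3}})"

definition graph_P :: "nat \<Rightarrow> nat set \<times> nat set set" where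
  "graph_P n = ({0..<n}, path_edges [0..<n])"

definition graph_C :: "nat \<Rightarrow> nat set \<times> nat set set" where
  "graph_C n = ({0..<n}, cycle_edges [0..<n])"

section \<open>Graphs of two parallel paths\<close>

definition two_parallel_paths :: "'a set \<Rightarrow> 'a set set \<Rightarrow> bool" where
  "two_parallel_paths V E \<longleftrightarrow>
     (\<exists>vs us. induced_path V E vs \<and> induced_path V E us \<and> set vs \<inter> set us = {} \<and>
        length vs + length us = card V \<and>
        (\<forall>i<length vs. \<forall>j<length us. {vs ! i, us ! j} \<in> E \<longrightarrow>
           (\<forall>x<length vs. \<forall>y<length us. x > i \<and> y < j \<or> x < i \<and> y > j \<longrightarrow>
              {vs ! x, us ! y} \<notin> E))) \<or>
     (\<exists>vs. is_path_graph V E vs)"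

section \<open>Outer-planar embeddings\<close>

text \<open>An embedding in the plane consists of a point \<open>pos v\<close> for each vertex \<open>v\<close> and an arc
  \<open>crv e\<close> for each edge \<open>e\<close>.\<close>

definition planar_embedding ::
    "'a set \<Rightarrow> 'a set set \<Rightarrow> ('a \<Rightarrow> complex) \<Rightarrow> ('a set \<Rightarrow> real \<Rightarrow> complex) \<Rightarrow> bool" where
  "planar_embedding V E pos crv \<longleftrightarrow>
     inj_on pos V \<and>
     (\<forall>e\<in>E. arc (crv e) \<and> {pathstart (crv e), pathfinish (crv e)} = pos ` e \<and>
            path_image (crv e) \<inter> pos ` V = pos ` e) \<and>
     (\<forall>e\<in>E. \<forall>f\<in>E. e \<noteq> f \<longrightarrow> path_image (crv e) \<inter> path_image (crv f) = pos ` (e \<inter> f))"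

definition drawing ::
    "'a set \<Rightarrow> 'a set set \<Rightarrow> ('a \<Rightarrow> complex) \<Rightarrow> ('a set \<Rightarrow> real \<Rightarrow> complex) \<Rightarrow> complex set" where
  "drawing V E pos crv = pos ` V \<union> (\<Union>e\<in>E. path_image (crv e))"

definition faces ::
    "'a set \<Rightarrow> 'a set set \<Rightarrow> ('a \<Rightarrow> complex) \<Rightarrow> ('a set \<Rightarrow> real \<Rightarrow> complex) \<Rightarrow> complex set set" where
  "faces V E pos crv = components (- drawing V E pos crv)"

text \<open>The drawing of a finite graph is compact, so its complement in the plane has exactly one
  unbounded component, and that component is \<^const>\<open>outside\<close> of the drawing.\<close>

definition unbounded_face ::
    "'a set \<Rightarrow> 'a set set \<Rightarrow> ('a \<Rightarrow> complex) \<Rightarrow> ('a set \<Rightarrow> real \<Rightarrow> complex) \<Rightarrow> complex set" where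
  "unbounded_face V E pos crv = outside (drawing V E pos crv)"

definition outerplanar_embedding ::
    "'a set \<Rightarrow> 'a set set \<Rightarrow> ('a \<Rightarrow> complex) \<Rightarrow> ('a set \<Rightarrow> real \<Rightarrow> complex) \<Rightarrow> bool" where
  "outerplanar_embedding V E pos crv \<longleftrightarrow>
     planar_embedding V E pos crv \<and> (\<forall>v\<in>V. pos v \<in> frontier (unbounded_face V E pos crv))"

definition outerplanar :: "'a set \<Rightarrow> 'a set set \<Rightarrow> bool" where
  "outerplanar V E \<longleftrightarrow> (\<exists>pos crv. outerplanar_embedding V E pos crv)"

definition core ::
    "'a set \<Rightarrow> 'a set set \<Rightarrow> ('a \<Rightarrow> complex) \<Rightarrow> ('a set \<Rightarrow> real \<Rightarrow> complex) \<Rightarrow> 'a set" where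
  "core V E pos crv =
     {v \<in> V. \<exists>F\<in>faces V E pos crv. bounded F \<and> pos v \<in> frontier F}"

text \<open>\<open>G[R]\<close> is embedded by restricting the embedding of \<open>G\<close>; in the following, \<open>cs\<close> lists the
  vertices of the outer-cycle in cyclic order.\<close>

definition outer_cycle ::
    "'a set \<Rightarrow> 'a set set \<Rightarrow> ('a \<Rightarrow> complex) \<Rightarrow> ('a set \<Rightarrow> real \<Rightarrow> complex) \<Rightarrow> 'a list \<Rightarrow> bool" where
  "outer_cycle V E pos crv cs \<longleftrightarrow>
     (let R = core V E pos crv in
        hamiltonian_cycle R (induced_edges E R) cs \<and>
        frontier (unbounded_face R (induced_edges E R) pos crv) =
          (\<Union>e\<in>cycle_edges cs. path_image (crv e)))"

definition interior_edges :: "'a set set \<Rightarrow> 'a list \<Rightarrow> 'a set set" where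
  "interior_edges E cs = induced_edges E (set cs) - cycle_edges cs"

definition num_interior :: "'a set set \<Rightarrow> 'a list \<Rightarrow> 'a set \<Rightarrow> nat" where
  "num_interior E cs S = card (interior_edges E cs \<inter> induced_edges E S)"

definition end_cycles :: "'a set \<Rightarrow> 'a set set \<Rightarrow> 'a list \<Rightarrow> 'a set set" where
  "end_cycles V E cs = {S. induced_cycle V E S \<and> num_interior E cs S = 1}"

section \<open>Pendant paths and alpha-graphs\<close>

text \<open>Here the paths may be empty, as needed for \<open>\<alpha>\<close>-graphs; the paths are indexed from 0.\<close>

definition disjoint_union_of_paths ::
    "'a set \<Rightarrow> 'a set set \<Rightarrow> nat \<Rightarrow> (nat \<Rightarrow> 'a list) \<Rightarrow> bool" where
  "disjoint_union_of_paths W F k P \<longleftrightarrow>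
     (\<forall>i<k. distinct (P i)) \<and>
     (\<forall>i<k. \<forall>j<k. i \<noteq> j \<longrightarrow> set (P i) \<inter> set (P j) = {}) \<and>
     W = (\<Union>i<k. set (P i)) \<and> F = (\<Union>i<k. path_edges (P i))"

definition joined_at :: "'a set set \<Rightarrow> 'a set \<Rightarrow> 'a list \<Rightarrow> 'a \<Rightarrow> bool" where
  "joined_at E R p y \<longleftrightarrow>
     y \<in> R \<and> (\<exists>x\<in>{hd p, last p}. {e \<in> E. e \<inter> set p \<noteq> {} \<and> e \<inter> R \<noteq> {}} = {{x, y}})"

definition alpha_graph ::
    "'a set \<Rightarrow> 'a set set \<Rightarrow> ('a \<Rightarrow> complex) \<Rightarrow> ('a set \<Rightarrow> real \<Rightarrow> complex) \<Rightarrow> bool" where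
  "alpha_graph V E pos crv \<longleftrightarrow>
     two_parallel_paths V E \<and>
     (\<exists>c P. let R = core V E pos crv; r = length c in
        outer_cycle V E pos crv c \<and>
        (\<forall>e\<in>interior_edges E c. \<exists>i<r. i \<notin> {0, 1, r - 1} \<and> e = {c ! 0, c ! i}) \<and>
        disjoint_union_of_paths (V - R) (induced_edges E (V - R)) 4 P \<and>
        P 0 \<noteq> [] \<and> P 1 \<noteq> [] \<and>
        joined_at E R (P 0) (c ! 0) \<and>
        joined_at E R (P 1) (c ! 0) \<and>
        (P 2 \<noteq> [] \<longrightarrow> joined_at E R (P 2) (c ! (r - 1))) \<and>
        (P 3 \<noteq> [] \<longrightarrow> joined_at E R (P 3) (c ! 1)))"

end

theory Submission
  imports Defs "HOL-Complex_Analysis.Winding_Numbers"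
begin

text \<open>In an outer-planar drawing no vertex lies inside a cycle. Together with the theta-curve theorem
  this shows that the chords of a cycle run inside it and do not cross, that the inside of an
  induced cycle is a face, and that the frontier of the unbounded face of \<open>G[R]\<close> is its Hamiltonian
  cycle.

  Two parallel paths can be drawn on two parallel lines, so such a graph is outer-planar. The edges
  between the paths are linearly ordered, two consecutive ones span an induced cycle, and all induced
  cycles arise in this way; the core is the part between the first and the last of these edges, and the
  four ends of the paths are the pendant paths.

  Conversely, choose for both end cycles an outer-cycle edge that carries the pendant paths assigned to
  it. Any chord of the outer-cycle has an end cycle on either side. As there are only two end cycles,
  each chord separates the two chosen edges, and removing these edges splits the outer-cycle into two
  induced paths, which the pendant paths prolong.\<close>

section \<open>Edges of paths and cycles given as lists\<close>

text \<open>The embedding in the theorem is an arbitrary outer-planar one. The straight-line drawing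
  only shows that one exists; the core has to be found for every embedding, which is why faces and
  separation are treated for curves and not for segments. That all of the block is in the core needs
  the insides of induced cycles to be faces; that nothing else is needs every bounded face to stay
  within the outer-cycle.

  Both alternatives of condition 4 come from one dichotomy. The four ends of the paths hang at the
  ends of the first and the last edge between them. If these edges share a vertex and both ends of
  the path through it are nonempty, two pendant paths have the same \<open>y_i\<close>, and the
  graph is an \<alpha>-graph. Otherwise the \<open>y_i\<close> are distinct and are grouped by these
  two edges, which lie on the two end cycles if there are chords and give the edges of the six small
  graphs if there are none.

  In the converse the two removed edges must cover all \<open>y_i\<close>: if there are chords,
  \<open>\<phi>\<close> yields them, otherwise the list of six graphs does.\<close>

lemma path_edges_Nil [simp]: "path_edges [] = {}"
  and path_edges_single [simp]: "path_edges [x] = {}"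
  by (auto simp: path_edges_def)

lemma path_edges_Cons2 [simp]: "path_edges (x # y # zs) = insert {x, y} (path_edges (y # zs))"
proof -
  have "{i. Suc i < length (x # y # zs)} = insert 0 (Suc ` {i. Suc i < length (y # zs)})"
    by (auto simp: less_Suc_eq_0_disj)
  then show ?thesis
    by (simp add: path_edges_def setcompr_eq_image image_image)
qed

lemma path_edges_append:
  "xs \<noteq> [] \<Longrightarrow> ys \<noteq> [] \<Longrightarrow>
    path_edges (xs @ ys) = path_edges xs \<union> path_edges ys \<union> {{last xs, hd ys}}"
proof (induction xs)
  case (Cons x xs)
  show ?case
  proof (cases xs)
    case Nil
    with Cons.prems show ?thesis by (cases ys) auto
  next
    case (Cons x' xs')
    with Cons.IH Cons.prems show ?thesis by auto
  qed
qed simp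

lemma path_edges_rev [simp]: "path_edges (rev xs) = path_edges xs"
proof (induction xs)
  case (Cons x xs)
  show ?case
  proof (cases xs)
    case (Cons y ys)
    have "path_edges (rev xs @ [x]) = path_edges (rev xs) \<union> {{y, x}}"
      using path_edges_append[of "rev xs" "[x]"] Cons by simp
    with Cons.IH Cons show ?thesis by (simp add: insert_commute)
  qed simp
qed simp

lemma path_edges_subset: "e \<in> path_edges xs \<Longrightarrow> e \<subseteq> set xs"
  by (auto simp: path_edges_def)

lemma path_edges_split:
  assumes "e \<in> path_edges xs"
  obtains ys zs where "xs = ys @ zs" "ys \<noteq> []" "zs \<noteq> []" "e = {last ys, hd zs}"
proof -
  from assms obtain i where i: "Suc i < length xs" "e = {xs ! i, xs ! Suc i}"
    by (auto simp: path_edges_def)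
  show thesis
  proof
    show "xs = take (Suc i) xs @ drop (Suc i) xs" by simp
    show "take (Suc i) xs \<noteq> []" "drop (Suc i) xs \<noteq> []" using i by auto
    show "e = {last (take (Suc i) xs), hd (drop (Suc i) xs)}"
      using i by (simp add: hd_drop_conv_nth take_Suc_conv_app_nth)
  qed
qed

lemma path_edges_nth_iff:
  assumes "distinct xs" "i < j" "j < length xs"
  shows "{xs ! i, xs ! j} \<in> path_edges xs \<longleftrightarrow> j = Suc i"
proof
  assume "{xs ! i, xs ! j} \<in> path_edges xs"
  then obtain k where "Suc k < length xs" "{xs ! i, xs ! j} = {xs ! k, xs ! Suc k}"
    by (auto simp: path_edges_def)
  then show "j = Suc i"
    using assms by (auto simp: doubleton_eq_iff nth_eq_iff_index_eq)
qed (use assms in \<open>auto simp: path_edges_def\<close>)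

lemma path_edges_map_upt: "path_edges (map h [i..<x]) = {{h k, h (Suc k)} | k. i \<le> k \<and> Suc k < x}"
proof -
  have "path_edges (map h [i..<x]) = (\<lambda>k. {h (i + k), h (Suc (i + k))}) ` {k. Suc (i + k) < x}"
    unfolding path_edges_def setcompr_eq_image by (intro image_cong) auto
  also have "\<dots> = (\<lambda>k. {h k, h (Suc k)}) ` ((+) i ` {k. Suc (i + k) < x})"
    by (simp add: image_image)
  also have "(+) i ` {k. Suc (i + k) < x} = {k. i \<le> k \<and> Suc k < x}"
    by (auto simp: image_def) presburger
  finally show ?thesis by auto
qed

section \<open>Edge sets of cyclic lists\<close>

lemma cycle_edges_conv: "xs \<noteq> [] \<Longrightarrow> cycle_edges xs = insert {last xs, hd xs} (path_edges xs)"
proof -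
  assume ne: "xs \<noteq> []"
  have "cycle_edges xs =
      (\<lambda>i. {xs ! i, xs ! (Suc i mod length xs)}) ` insert (length xs - 1) {i. Suc i < length xs}"
  proof -
    have "{i. i < length xs} = insert (length xs - 1) {i. Suc i < length xs}"
      using ne by auto
    then show ?thesis by (simp only: cycle_edges_def setcompr_eq_image)
  qed
  also have "\<dots> = insert {last xs, hd xs} (path_edges xs)"
    using ne by (auto simp: path_edges_def last_conv_nth hd_conv_nth)
  finally show ?thesis .
qed

lemma cycle_edges_append:
  "xs \<noteq> [] \<Longrightarrow> ys \<noteq> [] \<Longrightarrow> cycle_edges (xs @ ys) =
    path_edges xs \<union> path_edges ys \<union> {{last xs, hd ys}, {last ys, hd xs}}"
  by (auto simp: cycle_edges_conv path_edges_append)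

lemma cycle_edges_append_commute: "cycle_edges (xs @ ys) = cycle_edges (ys @ xs)"
  by (cases "xs = [] \<or> ys = []") (auto simp: cycle_edges_append)

lemma cycle_edges_rotate [simp]: "cycle_edges (rotate n xs) = cycle_edges xs"
  by (metis append_take_drop_id cycle_edges_append_commute rotate_drop_take)

lemma cycle_edges_subset: "e \<in> cycle_edges xs \<Longrightarrow> e \<subseteq> set xs"
  by (cases "xs = []") (auto simp: cycle_edges_conv cycle_edges_def dest: path_edges_subset)

lemma Union_path_edges: "2 \<le> length ws \<Longrightarrow> \<Union>(path_edges ws) = set ws"
proof (induction ws)
  case (Cons x ws)
  then show ?case by (cases ws; cases "tl ws") (auto simp: Suc_le_eq)
qed simp

lemma Union_cycle_edges: "2 \<le> length ws \<Longrightarrow> \<Union>(cycle_edges ws) = set ws"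
  using Union_path_edges[of ws] by (cases "ws = []") (auto simp: cycle_edges_conv)

lemma Union_path_edges_subset: "\<Union>(path_edges t) \<subseteq> set t"
  and Union_cycle_edges_subset: "\<Union>(cycle_edges t) \<subseteq> set t"
  using path_edges_subset cycle_edges_subset by fastforce+

lemma path_edges_subset_cycle_edges: "path_edges xs \<subseteq> cycle_edges xs"
  by (cases "xs = []") (auto simp: cycle_edges_conv)

text \<open>Two indices can name the same edge only if each is the cyclic successor of the other,
  which the length bound rules out.\<close>

lemma card_cycle_edges:
  assumes "distinct xs" "3 \<le> length xs"
  shows "card (cycle_edges xs) = length xs"
proof -
  have inj: "inj_on (\<lambda>i. {xs ! i, xs ! (Suc i mod length xs)}) {..<length xs}"
  proof (rule inj_onI)
    fix i j
    assume ij: "i \<in> {..<length xs}" "j \<in> {..<length xs}"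
      and eq: "{xs ! i, xs ! (Suc i mod length xs)} = {xs ! j, xs ! (Suc j mod length xs)}"
    have "Suc i mod length xs < length xs" "Suc j mod length xs < length xs"
      using assms by (auto intro: mod_less_divisor)
    with ij eq assms have "i = j \<or> i = Suc j mod length xs \<and> j = Suc i mod length xs"
      by (auto simp: doubleton_eq_iff nth_eq_iff_index_eq)
    then show "i = j"
      using ij assms by (auto simp: mod_Suc split: if_splits)
  qed
  have "cycle_edges xs = (\<lambda>i. {xs ! i, xs ! (Suc i mod length xs)}) ` {..<length xs}"
    by (auto simp: cycle_edges_def)
  with inj show ?thesis by (simp add: card_image)
qed

section \<open>Rotating a cycle to a chosen edge or pair of vertices\<close>

lemma cycle_edge_rotate:
  assumes "e \<in> cycle_edges xs"
  obtains n where "e = {last (rotate n xs), hd (rotate n xs)}"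
proof -
  have ne: "xs \<noteq> []" using assms by (auto simp: cycle_edges_def)
  with assms consider "e = {last xs, hd xs}" | "e \<in> path_edges xs"
    by (auto simp: cycle_edges_conv)
  then show thesis
  proof cases
    case 1
    then show thesis using that[of 0] by simp
  next
    case 2
    then obtain ys zs where "xs = ys @ zs" "ys \<noteq> []" "zs \<noteq> []" "e = {last ys, hd zs}"
      by (rule path_edges_split)
    then show thesis
      using that[of "length ys"] by (simp add: rotate_append insert_commute)
  qed
qed

text \<open>Deleting \<open>f\<close> and \<open>g\<close> from the cycle leaves the two paths
  \<open>as\<close> and \<open>bs\<close>. Once \<open>f\<close> is rotated into the closing
  position, \<open>g\<close> is an edge of the remaining path and splits it.\<close>

lemma two_cycle_edges_rotate:
  assumes "f \<in> cycle_edges xs" "g \<in> cycle_edges xs" "f \<noteq> g"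
  obtains n as bs where "rotate n xs = as @ bs" "as \<noteq> []" "bs \<noteq> []"
    "f = {last bs, hd as}" "g = {last as, hd bs}"
proof -
  obtain n where n: "f = {last (rotate n xs), hd (rotate n xs)}"
    using cycle_edge_rotate assms(1) by blast
  have "xs \<noteq> []" using assms by (auto simp: cycle_edges_def)
  then have "g \<in> path_edges (rotate n xs)"
    using assms n cycle_edges_conv[of "rotate n xs"] by auto
  then obtain as bs where
    "rotate n xs = as @ bs" "as \<noteq> []" "bs \<noteq> []" "g = {last as, hd bs}"
    by (rule path_edges_split)
  with n that show thesis by simp
qed

text \<open>Normal form for a cycle with a chord from \<open>w\<close> to \<open>z\<close>:
  \<open>ps\<close> and \<open>qs\<close> hold the inner vertices of the two arcs.\<close>

lemma rotate_to_two_vertices: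
  assumes "w \<in> set xs" "z \<in> set xs" "w \<noteq> z"
  obtains n ps qs where "rotate n xs = w # ps @ z # qs"
proof -
  obtain ys zs where xs: "xs = ys @ w # zs" using assms split_list by metis
  have "z \<in> set (zs @ ys)" using assms xs by auto
  then obtain ps qs where "zs @ ys = ps @ z # qs" using split_list by metis
  moreover have "rotate (length ys) xs = w # zs @ ys" by (simp add: xs rotate_append)
  ultimately show thesis using that by simp
qed

lemma cycle_edges_chord:
  "cycle_edges (w # ps @ z # qs) = path_edges (w # ps @ [z]) \<union> path_edges (z # qs @ [w])"
proof -
  have "cycle_edges (w # ps @ z # qs) = path_edges (w # ps) \<union> path_edges (z # qs) \<union>
      {{last (w # ps), z}, {last (z # qs), w}}"
    using cycle_edges_append[of "w # ps" "z # qs"] by simp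
  moreover have "path_edges (w # ps @ [z]) = path_edges (w # ps) \<union> {{last (w # ps), z}}"
    using path_edges_append[of "w # ps" "[z]"] by simp
  moreover have "path_edges (z # qs @ [w]) = path_edges (z # qs) \<union> {{last (z # qs), w}}"
    using path_edges_append[of "z # qs" "[w]"] by simp
  ultimately show ?thesis by blast
qed

lemma cycle_neighbours:
  assumes "distinct xs" "3 \<le> length xs" "x \<in> set xs"
  obtains y z where "y \<noteq> z" "y \<noteq> x" "z \<noteq> x" "{x, y} \<in> cycle_edges xs" "{x, z} \<in> cycle_edges xs"
proof -
  obtain ys zs where xs: "xs = ys @ x # zs" using assms split_list by metis
  then have xus: "rotate (length ys) xs = x # zs @ ys" by (simp add: rotate_append)
  moreover obtain h t where "zs @ ys = h # t" "t \<noteq> []"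
  proof -
    have "2 \<le> length (zs @ ys)" using assms xs by simp
    then show thesis
      using that by (cases "zs @ ys"; cases "tl (zs @ ys)") auto
  qed
  ultimately have rot: "rotate (length ys) xs = x # h # t" and "t \<noteq> []" by simp_all
  from rot have "distinct (x # h # t)" using assms(1) by (metis distinct_rotate)
  moreover have "cycle_edges xs = cycle_edges (x # h # t)" by (metis rot cycle_edges_rotate)
  moreover have "last t \<in> set t" using \<open>t \<noteq> []\<close> by simp
  then have "last t \<noteq> h" "last t \<noteq> x" using \<open>distinct (x # h # t)\<close> by auto
  ultimately show thesis
    using that[of h "last t"] \<open>t \<noteq> []\<close>
    by (auto simp: cycle_edges_conv insert_commute)
qed

section \<open>Edges across a partition of a path or cycle\<close>

lemma path_cut:
  assumes "set xs \<subseteq> A \<union> B" "A \<inter> B = {}" "set xs \<inter> A \<noteq> {}" "set xs \<inter> B \<noteq> {}"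
  obtains a b where "a \<in> A" "b \<in> B" "{a, b} \<in> path_edges xs"
proof -
  have "\<exists>a\<in>A. \<exists>b\<in>B. {a, b} \<in> path_edges xs"
    using assms
  proof (induction xs)
    case (Cons x xs)
    show ?case
    proof (cases xs)
      case Nil
      with Cons.prems show ?thesis by auto
    next
      case (Cons y ys)
      show ?thesis
      proof (cases "set xs \<inter> A \<noteq> {} \<and> set xs \<inter> B \<noteq> {}")
        case True
        with Cons.IH Cons.prems Cons show ?thesis by auto
      next
        case False
        with Cons.prems Cons have "x \<in> A \<and> y \<in> B \<or> x \<in> B \<and> y \<in> A" by auto
        with Cons show ?thesis by (auto simp: insert_commute)
      qed
    qed
  qed simp
  with that show thesis by blast
qed

text \<open>Deleting a single vertex or two adjacent ones from a cycle leaves a path, which is still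
  connected; two vertices that are not adjacent could separate it. Therefore \<open>W\<close> has to
  lie within one edge.\<close>

lemma cycle_cut:
  assumes "distinct xs" "e \<in> cycle_edges xs" "W \<subseteq> e" "set xs - W = A \<union> B" "A \<inter> B = {}"
    "A \<noteq> {}" "B \<noteq> {}"
  obtains a b where "a \<in> A" "b \<in> B" "{a, b} \<in> cycle_edges xs"
proof -
  obtain n where n: "e = {last (rotate n xs), hd (rotate n xs)}"
    using cycle_edge_rotate assms(2) by blast
  define ys where "ys = rotate n xs"
  \<comment> \<open>After the rotation \<open>e\<close> joins the last to the first entry, so
    \<open>W\<close> occurs only at the ends of \<open>ys\<close>, and what the filter keeps is
    contiguous.\<close>
  define zs where "zs = filter (\<lambda>x. x \<notin> W) ys"
  have "set zs = A \<union> B" using assms by (auto simp: zs_def ys_def)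
  then obtain a b where ab: "a \<in> A" "b \<in> B" "{a, b} \<in> path_edges zs"
    using path_cut[of zs A B] assms by auto
  have "path_edges zs \<subseteq> path_edges ys"
  proof (cases "ys = []")
    case False
    then obtain h ms where hm: "ys = h # ms" by (cases ys) auto
    show ?thesis
    proof (cases "ms = []")
      case True
      then show ?thesis by (auto simp: zs_def hm)
    next
      case False
      then obtain ks l where kl: "ms = ks @ [l]" by (metis rev_exhaust)
      have d: "distinct ys" using assms by (simp add: ys_def)
      have W: "W \<subseteq> {h, l}" using assms n hm kl by (auto simp: ys_def)
      then have "filter (\<lambda>x. x \<notin> W) ks = ks"
        using d hm kl by (auto simp: filter_id_conv)
      then have "zs = (if h \<in> W then [] else [h]) @ ks @ (if l \<in> W then [] else [l])"
        by (simp add: zs_def hm kl)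
      then show ?thesis
        by (cases "ks = []") (auto simp: hm kl path_edges_append[of "[h]", simplified]
          path_edges_append)
    qed
  qed (simp add: zs_def)
  then have "{a, b} \<in> cycle_edges xs"
    using ab path_edges_subset_cycle_edges[of ys] by (auto simp: ys_def)
  with ab that show thesis by blast
qed

section \<open>Curves in the plane\<close>

text \<open>By continuity, as the open interval is dense in the closed one. Through closures,
  statements on an edge without its ends extend to the ends.\<close>

lemma arc_subset_closure_endless:
  fixes g :: "real \<Rightarrow> 'b::t2_space"
  assumes "arc g"
  shows "path_image g \<subseteq> closure (path_image g - {pathstart g, pathfinish g})"
proof -
  have "g ` {0<..<1} = path_image g - {pathstart g, pathfinish g}"
    using assms by (simp add: arc_imp_simple_path simple_path_endless)
  moreover have "g ` closure {0<..<1} \<subseteq> closure (g ` {0<..<1})"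
    by (rule image_closure_subset)
      (use assms in \<open>auto simp: arc_def path_def closure_subset\<close>)
  ultimately show ?thesis by (simp add: path_image_def)
qed

lemma connected_subset_one_side:
  assumes "A \<subseteq> U \<union> W" "connected A" "A \<inter> U \<noteq> {}" "open U" "open W" "U \<inter> W = {}"
  shows "A \<subseteq> U"
  using connectedD[of A U W] assms by blast

text \<open>If \<open>c\<close> avoids the inside of \<open>c1 \<union> c2\<close>, then the three winding numbers around the closed
  curves formed by two of the arcs add up to 0 at a point inside \<open>c1 \<union> c2\<close>, so this point lies inside
  another of the curves.\<close>

lemma theta_curve_cases:
  fixes c1 c2 c :: "real \<Rightarrow> complex"
  assumes c1: "arc c1" "pathstart c1 = a" "pathfinish c1 = b"
    and c2: "arc c2" "pathstart c2 = a" "pathfinish c2 = b"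
    and c: "arc c" "pathstart c = a" "pathfinish c = b"
    and int: "path_image c1 \<inter> path_image c2 \<subseteq> {a, b}" "path_image c1 \<inter> path_image c \<subseteq> {a, b}"
      "path_image c2 \<inter> path_image c \<subseteq> {a, b}"
    and disj: "path_image c \<inter> inside (path_image c1 \<union> path_image c2) = {}"
  shows "path_image c1 - {a, b} \<subseteq> inside (path_image c2 \<union> path_image c) \<or>
    path_image c2 - {a, b} \<subseteq> inside (path_image c1 \<union> path_image c)"
proof -
  define g where "g = c1 +++ reversepath c2"
  have g: "simple_path g" "pathfinish g = pathstart g"
    "path_image g = path_image c1 \<union> path_image c2"
    using c1 c2 int by (auto simp: g_def arc_reversepath path_image_join intro!: simple_path_join_loop)
  note J = Jordan_inside_outside[OF g(1,2)]
  define A where "A = inside (path_image g)"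
  from J obtain z where z: "z \<in> A" by (auto simp: A_def)
  have zn: "z \<notin> path_image c1" "z \<notin> path_image c2" "z \<notin> path_image c"
    using z disj inside_no_overlap[of "path_image g"] unfolding A_def g by blast+
  have paths: "path c1" "path c2" "path c" using c1 c2 c by (auto simp: arc_def)
  have "winding_number g z \<noteq> 0"
    using simple_closed_path_norm_winding_number_inside[OF g(1), of z] z unfolding A_def by fastforce
  then have wn: "winding_number c1 z \<noteq> winding_number c2 z"
    using c1 c2 zn paths
    by (simp add: g_def winding_number_join winding_number_reversepath)
  \<comment> \<open>The region \<open>A\<close> avoids the closed curve \<open>h\<close> formed by
    \<open>d'\<close> and \<open>c\<close>. It is connected and contains \<open>z\<close>, around
    which \<open>h\<close> winds, so it lies inside \<open>h\<close>; its frontier, and with it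
    \<open>d\<close>, lies in the closed inside.\<close>
  have swallow: "path_image d - {a, b} \<subseteq> inside (path_image d' \<union> path_image c)"
    if d: "arc d" "pathstart d = a" "pathfinish d = b" "z \<notin> path_image d" "path d"
      and d': "arc d'" "pathstart d' = a" "pathfinish d' = b" "z \<notin> path_image d'" "path d'"
      and un: "path_image d \<union> path_image d' = path_image g"
      and dint: "path_image d \<inter> path_image d' \<subseteq> {a, b}" "path_image d \<inter> path_image c \<subseteq> {a, b}"
        "path_image d' \<inter> path_image c \<subseteq> {a, b}"
      and w: "winding_number d' z \<noteq> winding_number c z" for d d'
  proof -
    define h where "h = d' +++ reversepath c"
    have h: "simple_path h" "pathfinish h = pathstart h"
      "path_image h = path_image d' \<union> path_image c"
      using d' c dint by (auto simp: h_def arc_reversepath path_image_join intro!: simple_path_join_loop)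
    note H = Jordan_inside_outside[OF h(1,2)]
    have "winding_number h z \<noteq> 0"
      using d' c zn paths w
      by (simp add: h_def winding_number_join winding_number_reversepath)
    then have "z \<notin> outside (path_image h)"
      using winding_number_zero_in_outside h simple_path_imp_path by blast
    then have zh: "z \<in> inside (path_image h)"
      using zn d' inside_Un_outside[of "path_image h"] unfolding h by blast
    have "A \<inter> path_image h = {}"
      using disj inside_no_overlap[of "path_image g"] un unfolding h A_def g by blast
    then have "A \<subseteq> inside (path_image h) \<union> outside (path_image h)"
      by auto
    moreover have "connected A" using J by (simp add: A_def)
    moreover have "A \<inter> inside (path_image h) \<noteq> {}" using z zh by blast
    ultimately have "A \<subseteq> inside (path_image h)"
      by (rule connected_subset_one_side[of A _ "outside (path_image h)"]) (use H in blast)+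
    then have "closure A \<subseteq> closure (inside (path_image h))" by (rule closure_mono)
    also have "\<dots> = inside (path_image h) \<union> path_image h"
    proof -
      have "frontier (inside (path_image h)) = path_image h" using H by blast
      then show ?thesis by (simp add: closure_Un_frontier)
    qed
    finally have "frontier A \<subseteq> inside (path_image h) \<union> path_image h"
      by (auto simp: frontier_def)
    moreover have "frontier A = path_image g" using J unfolding A_def by blast
    ultimately have "path_image d \<subseteq> inside (path_image h) \<union> path_image h" using un by blast
    then show ?thesis using dint unfolding h by blast
  qed
  \<comment> \<open>At \<open>z\<close> the winding number of \<open>c\<close> cannot equal those of
    both \<open>c1\<close> and \<open>c2\<close>. The arc from which it differs encloses
    \<open>z\<close> together with \<open>c\<close>, and the remaining arc is swallowed.\<close>
  show ?thesis
  proof (cases "winding_number c2 z = winding_number c z")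
    case True
    then have "path_image c2 - {a, b} \<subseteq> inside (path_image c1 \<union> path_image c)"
      using wn zn paths c1 c2 int g by (intro swallow) auto
    then show ?thesis ..
  next
    case False
    then have "path_image c1 - {a, b} \<subseteq> inside (path_image c2 \<union> path_image c)"
      using wn zn paths c1 c2 int g by (intro swallow) auto
    then show ?thesis ..
  qed
qed

section \<open>Plane drawings\<close>

locale plane_graph =
  fixes V :: "'a set" and E :: "'a set set"
    and pos :: "'a \<Rightarrow> complex" and crv :: "'a set \<Rightarrow> real \<Rightarrow> complex"
  assumes simple: "simple_graph V E"
    and planar: "planar_embedding V E pos crv"
begin

abbreviation img :: "'a set set \<Rightarrow> complex set" where
  "img F \<equiv> \<Union>e\<in>F. path_image (crv e)"

lemma finite_E: "finite E"
  using simple by (auto simp: simple_graph_def intro: finite_subset[of E "Pow V"])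

lemma edge_subset: "e \<in> E \<Longrightarrow> e \<subseteq> V"
  and edge_card: "e \<in> E \<Longrightarrow> card e = 2"
  using simple by (auto simp: simple_graph_def)

lemma edge_neq: "{x, y} \<in> E \<Longrightarrow> x \<noteq> y"
  using edge_card[of "{x, y}"] by auto

lemma pos_eq_iff: "x \<in> V \<Longrightarrow> y \<in> V \<Longrightarrow> pos x = pos y \<longleftrightarrow> x = y"
  using planar by (auto simp: planar_embedding_def inj_on_eq_iff)

lemma arc_crv: "e \<in> E \<Longrightarrow> arc (crv e)"
  and crv_ends: "e \<in> E \<Longrightarrow> {pathstart (crv e), pathfinish (crv e)} = pos ` e"
  and crv_Int_pos: "e \<in> E \<Longrightarrow> path_image (crv e) \<inter> pos ` V = pos ` e"
  and crv_Int: "e \<in> E \<Longrightarrow> f \<in> E \<Longrightarrow> e \<noteq> f \<Longrightarrow>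
    path_image (crv e) \<inter> path_image (crv f) = pos ` (e \<inter> f)"
  using planar by (auto simp: planar_embedding_def)

lemma pos_in_crv_iff: "e \<in> E \<Longrightarrow> v \<in> V \<Longrightarrow> pos v \<in> path_image (crv e) \<longleftrightarrow> v \<in> e"
  using crv_Int_pos[of e] edge_subset[of e] pos_eq_iff by blast

lemma connected_crv_endless: "e \<in> E \<Longrightarrow> connected (path_image (crv e) - pos ` e)"
  using connected_simple_path_endless[OF arc_imp_simple_path[OF arc_crv]] crv_ends by metis

lemma crv_endless_nonempty: "e \<in> E \<Longrightarrow> path_image (crv e) - pos ` e \<noteq> {}"
  using nonempty_simple_path_endless[OF arc_imp_simple_path[OF arc_crv]] crv_ends by metis

lemma crv_subset_closure_endless: "e \<in> E \<Longrightarrow> path_image (crv e) \<subseteq> closure (path_image (crv e) - pos ` e)"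
  using arc_subset_closure_endless[OF arc_crv] crv_ends by metis

text \<open>\<open>planar_embedding\<close> leaves open at which end of an edge its curve starts; a
  reversal fixes the direction.\<close>

lemma edge_arc:
  assumes "{x, y} \<in> E"
  obtains g where "arc g" "pathstart g = pos x" "pathfinish g = pos y"
    "path_image g = path_image (crv {x, y})"
proof -
  have "pathstart (crv {x, y}) = pos x \<and> pathfinish (crv {x, y}) = pos y \<or>
      pathstart (crv {x, y}) = pos y \<and> pathfinish (crv {x, y}) = pos x"
    using crv_ends[OF assms] by (auto simp: doubleton_eq_iff)
  then show thesis
    using that[of "crv {x, y}"] that[of "reversepath (crv {x, y})"] arc_crv[OF assms]
    by (auto simp: arc_reversepath)
qed

text \<open>Lifts the pairwise conditions of a planar embedding to subgraphs without common edges.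
  The intersections of arcs in \<open>chord_arcs\<close> and of attached paths in
  \<open>core_subset_cycle\<close> are computed by it.\<close>

lemma drawing_Int:
  assumes "S \<subseteq> V" "F \<subseteq> E" "\<Union>F \<subseteq> S" "S' \<subseteq> V" "F' \<subseteq> E" "\<Union>F' \<subseteq> S'" "F \<inter> F' = {}"
  shows "drawing S F pos crv \<inter> drawing S' F' pos crv \<subseteq> pos ` (S \<inter> S')"
proof
  fix p assume p: "p \<in> drawing S F pos crv \<inter> drawing S' F' pos crv"
  then consider v w where "v \<in> S" "w \<in> S'" "p = pos v" "p = pos w"
    | v f where "v \<in> S" "f \<in> F'" "p = pos v" "p \<in> path_image (crv f)"
    | f v where "v \<in> S'" "f \<in> F" "p = pos v" "p \<in> path_image (crv f)"
    | f f' where "f \<in> F" "f' \<in> F'" "p \<in> path_image (crv f)" "p \<in> path_image (crv f')"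
    by (auto simp: drawing_def)
  then show "p \<in> pos ` (S \<inter> S')"
  proof cases
    case 1
    then have "v = w" using pos_eq_iff assms by blast
    with 1 show ?thesis by auto
  next
    case 2
    then have "f \<in> E" "v \<in> V" using assms by auto
    then have "v \<in> f" using pos_in_crv_iff[of f v] 2 by auto
    with 2 assms show ?thesis by blast
  next
    case 3
    then have "f \<in> E" "v \<in> V" using assms by auto
    then have "v \<in> f" using pos_in_crv_iff[of f v] 3 by auto
    with 3 assms show ?thesis by blast
  next
    case 4
    then have "f \<noteq> f'" "f \<in> E" "f' \<in> E" using assms by auto
    then have "p \<in> pos ` (f \<inter> f')" using crv_Int 4 by blast
    with 4 assms show ?thesis by blast
  qed
qed

section \<open>Paths as arcs and cycles as Jordan curves\<close>

lemma drawing_eq_img: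
  assumes "F \<subseteq> E" "\<Union>F = S"
  shows "drawing S F pos crv = img F"
  using assms crv_Int_pos by (fastforce simp: drawing_def)

text \<open>A single vertex yields no arc, hence the length bound. An edge can be prepended because
  its new vertex lies on no later edge, so the pieces meet only in their common end.\<close>

lemma path_arc:
  assumes "distinct ws" "2 \<le> length ws" "path_edges ws \<subseteq> E"
  shows "\<exists>g. arc g \<and> pathstart g = pos (hd ws) \<and> pathfinish g = pos (last ws) \<and>
    path_image g = img (path_edges ws)"
  using assms
proof (induction ws)
  case (Cons x ws)
  then obtain y zs where ws: "ws = y # zs" by (cases ws) auto
  with Cons.prems have e: "{x, y} \<in> E" by auto
  obtain h where h: "arc h" "pathstart h = pos x" "pathfinish h = pos y"
    "path_image h = path_image (crv {x, y})"
    using edge_arc[OF e] .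
  show ?case
  proof (cases zs)
    case Nil
    with h ws show ?thesis by (intro exI[of _ h]) auto
  next
    case (Cons z us)
    then obtain g where g: "arc g" "pathstart g = pos y" "pathfinish g = pos (last ws)"
      "path_image g = img (path_edges ws)"
      using Cons.IH Cons.prems ws by auto
    have "path_image h \<inter> path_image g \<subseteq> {pos y}"
    proof
      fix p assume "p \<in> path_image h \<inter> path_image g"
      then obtain f where f: "f \<in> path_edges ws" "p \<in> path_image (crv f)"
        "p \<in> path_image (crv {x, y})"
        using h g by auto
      have "x \<notin> f" using f Cons.prems path_edges_subset by fastforce
      moreover have "f \<in> E" using f Cons.prems ws by auto
      ultimately have "p \<in> pos ` ({x, y} \<inter> f)" using crv_Int[OF e] f by blast
      with \<open>x \<notin> f\<close> show "p \<in> {pos y}" by auto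
    qed
    then show ?thesis
      using h g ws by (intro exI[of _ "h +++ g"]) (auto simp: arc_join path_image_join)
  qed
qed simp

lemma cycle_curve:
  assumes "cycle_in V E xs"
  obtains g where "simple_path g" "pathfinish g = pathstart g" "path_image g = img (cycle_edges xs)"
proof -
  from assms have xs: "distinct xs" "3 \<le> length xs" "set xs \<subseteq> V" "cycle_edges xs \<subseteq> E"
    by (auto simp: cycle_in_def)
  then have ne: "xs \<noteq> []" by auto
  have sub: "path_edges xs \<subseteq> E" using xs path_edges_subset_cycle_edges by blast
  then obtain g where g: "arc g" "pathstart g = pos (hd xs)" "pathfinish g = pos (last xs)"
    "path_image g = img (path_edges xs)"
    using path_arc[of xs] xs by auto
  have e: "{last xs, hd xs} \<in> E" using xs ne by (auto simp: cycle_edges_conv)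
  then obtain h where h: "arc h" "pathstart h = pos (last xs)" "pathfinish h = pos (hd xs)"
    "path_image h = path_image (crv {last xs, hd xs})"
    by (rule edge_arc)
  \<comment> \<open>Here length at least 3 matters: with two vertices the closing edge would be the
    path itself.\<close>
  have "{last xs, hd xs} \<notin> path_edges xs"
    using path_edges_nth_iff[of xs 0 "length xs - 1"] xs ne
    by (auto simp: last_conv_nth hd_conv_nth insert_commute)
  then have "path_image g \<inter> path_image h \<subseteq> {pos (hd xs), pos (last xs)}"
    unfolding g h using crv_Int[OF _ e] sub by fastforce
  then have "simple_path (g +++ h)" using g h by (intro simple_path_join_loop) auto
  moreover have "path_image (g +++ h) = img (cycle_edges xs)"
    using g h ne by (auto simp: path_image_join cycle_edges_conv)
  ultimately show thesis using that g h by simp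
qed

lemma Jordan_cycle:
  assumes "cycle_in V E xs"
  shows "open (inside (img (cycle_edges xs)))" "connected (inside (img (cycle_edges xs)))"
    "inside (img (cycle_edges xs)) \<noteq> {}" "bounded (inside (img (cycle_edges xs)))"
    "open (outside (img (cycle_edges xs)))" "connected (outside (img (cycle_edges xs)))"
    "\<not> bounded (outside (img (cycle_edges xs)))"
    "frontier (inside (img (cycle_edges xs))) = img (cycle_edges xs)"
    "frontier (outside (img (cycle_edges xs))) = img (cycle_edges xs)"
    "closure (inside (img (cycle_edges xs))) = inside (img (cycle_edges xs)) \<union> img (cycle_edges xs)"
    "closure (outside (img (cycle_edges xs))) = outside (img (cycle_edges xs)) \<union> img (cycle_edges xs)"
    "compact (img (cycle_edges xs))"
proof -
  obtain g where g: "simple_path g" "pathfinish g = pathstart g"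
    "path_image g = img (cycle_edges xs)"
    using cycle_curve[OF assms] .
  show "compact (img (cycle_edges xs))" using g by (metis compact_simple_path_image)
  note J = Jordan_inside_outside[OF g(1,2), unfolded g(3)]
  from J show "open (inside (img (cycle_edges xs)))" "connected (inside (img (cycle_edges xs)))"
    "inside (img (cycle_edges xs)) \<noteq> {}" "bounded (inside (img (cycle_edges xs)))"
    "open (outside (img (cycle_edges xs)))" "connected (outside (img (cycle_edges xs)))"
    "\<not> bounded (outside (img (cycle_edges xs)))"
    "frontier (inside (img (cycle_edges xs))) = img (cycle_edges xs)"
    "frontier (outside (img (cycle_edges xs))) = img (cycle_edges xs)"
    by auto
  with J show
    "closure (inside (img (cycle_edges xs))) = inside (img (cycle_edges xs)) \<union> img (cycle_edges xs)"
    "closure (outside (img (cycle_edges xs))) = outside (img (cycle_edges xs)) \<union> img (cycle_edges xs)"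
    by (metis closure_Un_frontier)+
qed

lemma pos_in_cycle_iff:
  assumes "cycle_in V E xs" "v \<in> V"
  shows "pos v \<in> img (cycle_edges xs) \<longleftrightarrow> v \<in> set xs"
proof -
  have "\<Union>(cycle_edges xs) = set xs" using assms by (intro Union_cycle_edges) (auto simp: cycle_in_def)
  moreover have "cycle_edges xs \<subseteq> E" using assms by (simp add: cycle_in_def)
  ultimately show ?thesis using pos_in_crv_iff assms(2) by blast
qed

end

section \<open>Cycles and chords when every vertex borders the unbounded face\<close>

locale outerplane_graph = plane_graph +
  assumes outer: "\<And>v. v \<in> V \<Longrightarrow> pos v \<in> frontier (unbounded_face V E pos crv)"
begin

text \<open>The cycle is part of the drawing, so the unbounded face lies outside the cycle. Its
  frontier is contained in the closure of that outside, which misses the inside.\<close>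

lemma vertex_not_inside:
  assumes "cycle_in V E xs" "v \<in> V"
  shows "pos v \<notin> inside (img (cycle_edges xs))"
proof -
  have "img (cycle_edges xs) \<subseteq> drawing V E pos crv"
    using assms by (auto simp: drawing_def cycle_in_def)
  then have "outside (drawing V E pos crv) \<subseteq> outside (img (cycle_edges xs))"
    by (rule outside_mono)
  then have "frontier (unbounded_face V E pos crv) \<subseteq> closure (outside (img (cycle_edges xs)))"
    by (auto simp: unbounded_face_def frontier_def dest: closure_mono)
  with outer[OF assms(2)] show ?thesis
    unfolding Jordan_cycle(11)[OF assms(1)]
    using inside_Int_outside[of "img (cycle_edges xs)"] inside_no_overlap[of "img (cycle_edges xs)"]
    by blast
qed

lemma edge_crv_meets_cycle:
  assumes "cycle_in V E xs" "e \<in> E" "e \<notin> cycle_edges xs"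
  shows "path_image (crv e) \<inter> img (cycle_edges xs) \<subseteq> pos ` (e \<inter> set xs)"
proof
  fix p assume "p \<in> path_image (crv e) \<inter> img (cycle_edges xs)"
  then obtain f where f: "f \<in> cycle_edges xs" "p \<in> path_image (crv f)" "p \<in> path_image (crv e)"
    by auto
  then have "f \<in> E" "f \<noteq> e" using assms by (auto simp: cycle_in_def)
  then have "p \<in> pos ` (e \<inter> f)" using crv_Int[of e f] assms f by auto
  with f(1) show "p \<in> pos ` (e \<inter> set xs)" using cycle_edges_subset by fastforce
qed

text \<open>Without its ends the edge is connected and avoids the cycle, so it stays on one
  side.\<close>

lemma edge_inside_or_disjoint:
  assumes "cycle_in V E xs" "e \<in> E" "e \<notin> cycle_edges xs"
    "path_image (crv e) \<inter> inside (img (cycle_edges xs)) \<noteq> {}"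
  shows "path_image (crv e) - pos ` e \<subseteq> inside (img (cycle_edges xs))"
proof -
  let ?J = "img (cycle_edges xs)"
  have "pos ` e \<inter> inside ?J = {}"
    using vertex_not_inside[OF assms(1)] edge_subset[OF assms(2)] by auto
  then have ne: "(path_image (crv e) - pos ` e) \<inter> inside ?J \<noteq> {}" using assms(4) by blast
  have "path_image (crv e) - pos ` e \<subseteq> - ?J"
    using edge_crv_meets_cycle[OF assms(1-3)] by blast
  then have "path_image (crv e) - pos ` e \<subseteq> inside ?J \<union> outside ?J"
    by (simp only: inside_Un_outside)
  then show ?thesis
    by (rule connected_subset_one_side[OF _ connected_crv_endless[OF assms(2)] ne
          Jordan_cycle(1,5)[OF assms(1)] inside_Int_outside])
qed

text \<open>The whole edge lies in the closed inside of the cycle. Its ends are vertices, which are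
  never inside, so they are on the cycle.\<close>

lemma edge_inside_imp_chord:
  assumes "cycle_in V E xs" "e \<in> E" "path_image (crv e) \<inter> inside (img (cycle_edges xs)) \<noteq> {}"
  shows "e \<subseteq> set xs" "e \<notin> cycle_edges xs"
proof -
  let ?J = "img (cycle_edges xs)"
  show "e \<notin> cycle_edges xs"
    using assms(3) inside_no_overlap[of ?J] by blast
  then have "path_image (crv e) - pos ` e \<subseteq> inside ?J"
    using edge_inside_or_disjoint assms by blast
  then have "closure (path_image (crv e) - pos ` e) \<subseteq> inside ?J \<union> ?J"
    unfolding Jordan_cycle(10)[OF assms(1), symmetric] by (rule closure_mono)
  then have "path_image (crv e) \<subseteq> inside ?J \<union> ?J"
    using crv_subset_closure_endless[OF assms(2)] by (rule order_trans[rotated])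
  moreover have "pos ` e \<subseteq> path_image (crv e)" using crv_Int_pos[OF assms(2)] by auto
  moreover have "pos ` e \<inter> inside ?J = {}"
    using vertex_not_inside[OF assms(1)] edge_subset[OF assms(2)] by auto
  ultimately have "pos ` e \<subseteq> ?J" by blast
  then show "e \<subseteq> set xs"
    using pos_in_cycle_iff[OF assms(1)] edge_subset[OF assms(2)] by auto
qed

text \<open>Presents a cycle with a chord as a theta curve, in the form that
  \<open>theta_curve_cases\<close> and \<open>split_inside_simple_closed_curve\<close> expect: three
  arcs that all run from \<open>w\<close> to \<open>z\<close>. That \<open>ps\<close> and
  \<open>qs\<close> are nonempty says that the chord is no edge of the cycle.\<close>

lemma chord_arcs:
  assumes cyc: "cycle_in V E (w # ps @ z # qs)" and e: "{w, z} \<in> E"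
    and ne: "ps \<noteq> []" "qs \<noteq> []"
  obtains c1 c2 c where "arc c1" "pathstart c1 = pos w" "pathfinish c1 = pos z"
    "arc c2" "pathstart c2 = pos w" "pathfinish c2 = pos z"
    "arc c" "pathstart c = pos w" "pathfinish c = pos z"
    "path_image c1 \<inter> path_image c2 = {pos w, pos z}"
    "path_image c1 \<inter> path_image c = {pos w, pos z}"
    "path_image c2 \<inter> path_image c = {pos w, pos z}"
    "path_image c = path_image (crv {w, z})"
    "path_image c1 \<union> path_image c2 = img (cycle_edges (w # ps @ z # qs))"
    "path_image c1 \<union> path_image c = img (cycle_edges (w # ps @ [z]))"
    "path_image c2 \<union> path_image c = img (cycle_edges (z # qs @ [w]))"
    "cycle_in V E (w # ps @ [z])" "cycle_in V E (z # qs @ [w])"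
    "{w, z} \<notin> cycle_edges (w # ps @ z # qs)"
proof -
  define P1 P2 where "P1 = path_edges (w # ps @ [z])" and "P2 = path_edges (z # qs @ [w])"
  have un: "cycle_edges (w # ps @ z # qs) = P1 \<union> P2"
    by (simp add: P1_def P2_def cycle_edges_chord)
  have d: "distinct (w # ps @ z # qs)" and sub: "P1 \<subseteq> E" "P2 \<subseteq> E"
    and V: "set (w # ps @ z # qs) \<subseteq> V"
    using cyc un by (auto simp: cycle_in_def)
  have d1: "distinct (w # ps @ [z])" and d2: "distinct (z # qs @ [w])" using d by auto
  have U1: "\<Union>P1 = set (w # ps @ [z])" and U2: "\<Union>P2 = set (z # qs @ [w])"
    unfolding P1_def P2_def by (rule Union_path_edges; simp)+
  have w1: "{w, z} \<notin> P1"
    using path_edges_nth_iff[OF d1, of 0 "length (ps @ [z])"] ne by (auto simp: P1_def nth_append)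
  have w2: "{w, z} \<notin> P2"
    using path_edges_nth_iff[OF d2, of 0 "length (qs @ [w])"] ne
    by (auto simp: P2_def nth_append insert_commute)
  \<comment> \<open>A common edge would lie within the two common vertices and so be the chord,
    which belongs to neither arc.\<close>
  have disj: "P1 \<inter> P2 = {}"
  proof (rule ccontr)
    assume "P1 \<inter> P2 \<noteq> {}"
    then obtain f where f: "f \<in> P1" "f \<in> P2" by auto
    then have "f \<subseteq> {w, z}" using U1 U2 d by auto
    moreover have "card f = 2" using f sub edge_card by auto
    moreover have "card {w, z} = 2" using edge_card[OF e] .
    ultimately have "f = {w, z}" by (metis card_subset_eq finite.emptyI finite.insertI)
    with f w1 show False by simp
  qed
  obtain c1 where c1: "arc c1" "pathstart c1 = pos w" "pathfinish c1 = pos z"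
    "path_image c1 = img P1"
    using path_arc[OF d1] sub by (auto simp: P1_def)
  obtain c2' where c2': "arc c2'" "pathstart c2' = pos z" "pathfinish c2' = pos w"
    "path_image c2' = img P2"
    using path_arc[OF d2] sub by (auto simp: P2_def)
  define c2 where "c2 = reversepath c2'"
  have c2: "arc c2" "pathstart c2 = pos w" "pathfinish c2 = pos z" "path_image c2 = img P2"
    using c2' by (auto simp: c2_def arc_reversepath)
  obtain c where c: "arc c" "pathstart c = pos w" "pathfinish c = pos z"
    "path_image c = path_image (crv {w, z})"
    using edge_arc[OF e] .
  have ends: "{pos w, pos z} \<subseteq> path_image c1" "{pos w, pos z} \<subseteq> path_image c2"
    "{pos w, pos z} \<subseteq> path_image c"
    using c1 c2 c by (metis insert_subset empty_subsetI pathstart_in_path_image pathfinish_in_path_image)+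
  have dr: "drawing (set (w # ps @ [z])) P1 pos crv = img P1"
    "drawing (set (z # qs @ [w])) P2 pos crv = img P2"
    using drawing_eq_img U1 U2 sub by auto
  have drc: "drawing {w, z} {{w, z}} pos crv = path_image c"
    using drawing_eq_img[of "{{w, z}}"] e by (simp add: c)
  have "path_image c1 \<inter> path_image c2 \<subseteq> pos ` (set (w # ps @ [z]) \<inter> set (z # qs @ [w]))"
    unfolding c1 c2 dr[symmetric] using U1 U2 V sub disj by (intro drawing_Int) auto
  moreover have "set (w # ps @ [z]) \<inter> set (z # qs @ [w]) = {w, z}" using d by auto
  ultimately have i12: "path_image c1 \<inter> path_image c2 = {pos w, pos z}" using ends by auto
  have "path_image c1 \<inter> path_image c \<subseteq> pos ` (set (w # ps @ [z]) \<inter> {w, z})"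
    unfolding drc[symmetric] c1 dr[symmetric] using U1 V sub w1 e by (intro drawing_Int) auto
  then have i1: "path_image c1 \<inter> path_image c = {pos w, pos z}" using ends by auto
  have "path_image c2 \<inter> path_image c \<subseteq> pos ` (set (z # qs @ [w]) \<inter> {w, z})"
    unfolding drc[symmetric] c2 dr[symmetric] using U2 V sub w2 e by (intro drawing_Int) auto
  then have i2: "path_image c2 \<inter> path_image c = {pos w, pos z}" using ends by auto
  have ce1: "cycle_edges (w # ps @ [z]) = insert {w, z} P1"
    and ce2: "cycle_edges (z # qs @ [w]) = insert {w, z} P2"
    by (simp_all add: cycle_edges_conv P1_def P2_def insert_commute)
  have "cycle_in V E (w # ps @ [z])" "cycle_in V E (z # qs @ [w])"
    using d V sub e ne ce1 ce2 by (auto simp: cycle_in_def Suc_le_eq)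
  with c1 c2 c i12 i1 i2 un w1 w2 ce1 ce2 show thesis
    by (intro that[of c1 c2 c]) auto
qed

lemma cycle_in_rotate: "cycle_in V E (rotate n xs) = cycle_in V E xs"
  by (simp add: cycle_in_def)

lemma non_cycle_edge_ne:
  assumes "{w, z} \<notin> cycle_edges (w # ps @ z # qs)"
  shows "ps \<noteq> []" "qs \<noteq> []"
  using assms by (auto simp: cycle_edges_chord)

text \<open>If the chord did not enter the inside, \<open>theta_curve_cases\<close> would put one of
  the two arcs, and thus an inner vertex of it, inside the cycle formed by the chord and the other
  arc. This contradicts \<open>vertex_not_inside\<close>.\<close>

lemma chord_inside:
  assumes cyc: "cycle_in V E xs" and e: "e \<in> E" "e \<subseteq> set xs" "e \<notin> cycle_edges xs"
  shows "path_image (crv e) - pos ` e \<subseteq> inside (img (cycle_edges xs))"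
proof -
  obtain w z where wz: "e = {w, z}" using edge_card[OF e(1)] by (auto simp: card_2_iff)
  then have "w \<noteq> z" using e edge_neq by auto
  then obtain n ps qs where n: "rotate n xs = w # ps @ z # qs"
    using rotate_to_two_vertices e wz by (metis insert_subset)
  have cyc': "cycle_in V E (w # ps @ z # qs)" using cyc n cycle_in_rotate by metis
  have ce: "cycle_edges (w # ps @ z # qs) = cycle_edges xs" by (metis n cycle_edges_rotate)
  then have ne: "ps \<noteq> []" "qs \<noteq> []" using e wz non_cycle_edge_ne[of w z ps qs] by auto
  have wzE: "{w, z} \<in> E" using e wz by simp
  obtain c1 c2 c where c: "arc c1" "pathstart c1 = pos w" "pathfinish c1 = pos z"
    "arc c2" "pathstart c2 = pos w" "pathfinish c2 = pos z"
    "arc c" "pathstart c = pos w" "pathfinish c = pos z"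
    "path_image c1 \<inter> path_image c2 = {pos w, pos z}"
    "path_image c1 \<inter> path_image c = {pos w, pos z}"
    "path_image c2 \<inter> path_image c = {pos w, pos z}"
    "path_image c = path_image (crv {w, z})"
    "path_image c1 \<union> path_image c2 = img (cycle_edges (w # ps @ z # qs))"
    "path_image c1 \<union> path_image c = img (cycle_edges (w # ps @ [z]))"
    "path_image c2 \<union> path_image c = img (cycle_edges (z # qs @ [w]))"
    "cycle_in V E (w # ps @ [z])" "cycle_in V E (z # qs @ [w])"
    "{w, z} \<notin> cycle_edges (w # ps @ z # qs)"
    by (rule chord_arcs[OF cyc' wzE ne])
  have V: "set (w # ps @ z # qs) \<subseteq> V" and d: "distinct (w # ps @ z # qs)"
    using cyc' by (auto simp: cycle_in_def)
  have "path_image c \<inter> inside (path_image c1 \<union> path_image c2) \<noteq> {}"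
  proof
    assume "path_image c \<inter> inside (path_image c1 \<union> path_image c2) = {}"
    then consider "path_image c1 - {pos w, pos z} \<subseteq> inside (path_image c2 \<union> path_image c)"
      | "path_image c2 - {pos w, pos z} \<subseteq> inside (path_image c1 \<union> path_image c)"
      using theta_curve_cases[OF c(1-9)] c(10-12) by auto
    then show False
    proof cases
      case 1
      have "pos (hd ps) \<in> img (cycle_edges (w # ps @ [z]))"
        using pos_in_cycle_iff[OF c(17), of "hd ps"] V ne by (cases ps) auto
      moreover have "pos (hd ps) \<notin> {pos w, pos z}"
        using pos_eq_iff V d ne by (cases ps) auto
      moreover have "pos (hd ps) \<notin> path_image c"
        using pos_in_crv_iff[of "{w, z}" "hd ps"] e wz V d ne c by (cases ps) auto
      ultimately have "pos (hd ps) \<in> inside (img (cycle_edges (z # qs @ [w])))"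
        using 1 c(15,16) by auto
      then show False using vertex_not_inside[OF c(18), of "hd ps"] V ne by (cases ps) auto
    next
      case 2
      have "pos (hd qs) \<in> img (cycle_edges (z # qs @ [w]))"
        using pos_in_cycle_iff[OF c(18), of "hd qs"] V ne by (cases qs) auto
      moreover have "pos (hd qs) \<notin> {pos w, pos z}"
        using pos_eq_iff V d ne by (cases qs) auto
      moreover have "pos (hd qs) \<notin> path_image c"
        using pos_in_crv_iff[of "{w, z}" "hd qs"] e wz V d ne c by (cases qs) auto
      ultimately have "pos (hd qs) \<in> inside (img (cycle_edges (w # ps @ [z])))"
        using 2 c(15,16) by auto
      then show False using vertex_not_inside[OF c(17), of "hd qs"] V ne by (cases qs) auto
    qed
  qed
  then have "path_image (crv e) \<inter> inside (img (cycle_edges xs)) \<noteq> {}"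
    using c(13,14) ce wz by auto
  then show ?thesis using edge_inside_or_disjoint cyc e by blast
qed

text \<open>The first chord divides the inside of the cycle into the insides of the two cycles that
  it forms with the arcs. The second one is connected off its ends and thus enters only one of them;
  then both of its ends lie on that cycle, although one of them is an inner vertex of the other
  arc.\<close>

lemma chords_noncrossing:
  assumes cyc: "cycle_in V E (w # ps @ z # qs)" and e: "{w, z} \<in> E" and f: "{x, y} \<in> E"
    and x: "x \<in> set ps" and y: "y \<in> set qs"
  shows False
proof -
  have ne: "ps \<noteq> []" "qs \<noteq> []" using x y by auto
  obtain c1 c2 c where c: "arc c1" "pathstart c1 = pos w" "pathfinish c1 = pos z"
    "arc c2" "pathstart c2 = pos w" "pathfinish c2 = pos z"
    "arc c" "pathstart c = pos w" "pathfinish c = pos z"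
    "path_image c1 \<inter> path_image c2 = {pos w, pos z}"
    "path_image c1 \<inter> path_image c = {pos w, pos z}"
    "path_image c2 \<inter> path_image c = {pos w, pos z}"
    "path_image c = path_image (crv {w, z})"
    "path_image c1 \<union> path_image c2 = img (cycle_edges (w # ps @ z # qs))"
    "path_image c1 \<union> path_image c = img (cycle_edges (w # ps @ [z]))"
    "path_image c2 \<union> path_image c = img (cycle_edges (z # qs @ [w]))"
    "cycle_in V E (w # ps @ [z])" "cycle_in V E (z # qs @ [w])"
    "{w, z} \<notin> cycle_edges (w # ps @ z # qs)"
    by (rule chord_arcs[OF cyc e ne])
  have V: "set (w # ps @ z # qs) \<subseteq> V" and d: "distinct (w # ps @ z # qs)"
    using cyc by (auto simp: cycle_in_def)
  let ?U1 = "inside (img (cycle_edges (w # ps @ [z])))"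
  let ?U2 = "inside (img (cycle_edges (z # qs @ [w])))"
  let ?f = "path_image (crv {x, y}) - pos ` {x, y}"
  have "path_image (crv {w, z}) - pos ` {w, z} \<subseteq> inside (img (cycle_edges (w # ps @ z # qs)))"
    using chord_inside[OF cyc e] c(19) by auto
  then have "path_image c \<inter> inside (path_image c1 \<union> path_image c2) \<noteq> {}"
    using c(13,14) crv_endless_nonempty[OF e] by auto
  moreover have "pos w \<noteq> pos z" using pos_eq_iff V edge_neq[OF e] by auto
  ultimately have split: "?U1 \<inter> ?U2 = {} \<and>
      ?U1 \<union> ?U2 \<union> (path_image c - {pos w, pos z}) = inside (path_image c1 \<union> path_image c2)"
    using split_inside_simple_closed_curve[OF arc_imp_simple_path[OF c(1)] c(2,3)
        arc_imp_simple_path[OF c(4)] c(5,6) arc_imp_simple_path[OF c(7)] c(8,9) _ c(10-12)]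
    unfolding c(15,16) by blast
  have fn: "{x, y} \<notin> cycle_edges (w # ps @ z # qs)"
    using path_edges_subset[of "{x, y}" "w # ps @ [z]"] path_edges_subset[of "{x, y}" "z # qs @ [w]"] d x y
    unfolding cycle_edges_chord by auto
  then have "?f \<subseteq> inside (path_image c1 \<union> path_image c2)"
    using chord_inside[OF cyc f] x y c(14) by auto
  moreover have "?f \<inter> path_image c = {}"
    using crv_Int[OF f e] c(13) x y d by (auto simp: doubleton_eq_iff)
  ultimately have sub: "?f \<subseteq> ?U1 \<union> ?U2" using split by blast
  have ne': "?f \<noteq> {}" using crv_endless_nonempty[OF f] .
  have "?f \<inter> ?U1 = {} \<or> ?f \<inter> ?U2 = {}"
    using connectedD[OF connected_crv_endless[OF f]
        Jordan_cycle(1)[OF c(17)] Jordan_cycle(1)[OF c(18)]] sub split by blast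
  then consider "path_image (crv {x, y}) \<inter> ?U1 \<noteq> {}" | "path_image (crv {x, y}) \<inter> ?U2 \<noteq> {}"
    using ne' sub by blast
  then show False
  proof cases
    case 1
    then show False using edge_inside_imp_chord(1)[OF c(17) f] y d by auto
  next
    case 2
    then show False using edge_inside_imp_chord(1)[OF c(18) f] x d by auto
  qed
qed

section \<open>Faces, core and outer boundary\<close>

lemma induced_cycle_subset_core:
  assumes "induced_cycle V E S"
  shows "S \<subseteq> core V E pos crv"
proof -
  obtain xs where xs: "cycle_in V E xs" "set xs = S" "induced_edges E S = cycle_edges xs"
    using assms
    by (auto simp: induced_cycle_def is_cycle_graph_def hamiltonian_cycle_def cycle_in_def
        induced_edges_def)
  let ?J = "img (cycle_edges xs)"
  note J = Jordan_cycle[OF xs(1)]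
  \<comment> \<open>An edge that enters the inside would be a chord, and an induced cycle has none.
    So the inside misses the drawing and is a face.\<close>
  have "drawing V E pos crv \<inter> inside ?J = {}"
  proof -
    have "path_image (crv e) \<inter> inside ?J = {}" if "e \<in> E" for e
      using edge_inside_imp_chord[OF xs(1) that] xs that by (auto simp: induced_edges_def)
    then show ?thesis using vertex_not_inside[OF xs(1)] by (auto simp: drawing_def)
  qed
  moreover have Jd: "?J \<subseteq> drawing V E pos crv" using xs by (auto simp: cycle_in_def drawing_def)
  moreover have "D = inside ?J"
    if D: "inside ?J \<subseteq> D" "D \<subseteq> - drawing V E pos crv" "connected D" for D
  proof -
    have "D \<subseteq> inside ?J \<union> outside ?J" using D Jd by auto
    moreover have "D \<inter> inside ?J \<noteq> {}" using D J(3) by blast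
    ultimately have "D \<subseteq> inside ?J"
      by (rule connected_subset_one_side[OF _ D(3) _ J(1,5) inside_Int_outside])
    with D show ?thesis by simp
  qed
  ultimately have "inside ?J \<in> faces V E pos crv"
    using J unfolding faces_def in_components_maximal by blast
  moreover have "pos v \<in> frontier (inside ?J)" if "v \<in> S" for v
    using that xs pos_in_cycle_iff[OF xs(1), of v] J by (auto simp: cycle_in_def)
  moreover have "S \<subseteq> V" using assms by (simp add: induced_cycle_def)
  ultimately show ?thesis using J by (auto simp: core_def)
qed

text \<open>All vertices of \<open>R\<close> are on the cycle, so every further edge of
  \<open>G[R]\<close> is a chord and runs inside. Hence the drawing has the same outside as the
  cycle alone. The frontier clause of \<open>outer_cycle\<close> is obtained from this.\<close>

lemma frontier_unbounded_face_hamiltonian: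
  assumes "hamiltonian_cycle R (induced_edges E R) cs" "R \<subseteq> V"
  shows "frontier (unbounded_face R (induced_edges E R) pos crv) = img (cycle_edges cs)"
proof -
  have cyc: "cycle_in V E cs" and R: "set cs = R"
    using assms by (auto simp: hamiltonian_cycle_def cycle_in_def induced_edges_def)
  let ?J = "img (cycle_edges cs)" and ?D = "drawing R (induced_edges E R) pos crv"
  note J = Jordan_cycle[OF cyc]
  have "cycle_edges cs \<subseteq> induced_edges E R"
    using assms by (simp add: hamiltonian_cycle_def cycle_in_def)
  then have JD: "?J \<subseteq> ?D" by (auto simp: drawing_def)
  have vJ: "pos ` R \<subseteq> ?J" using pos_in_cycle_iff[OF cyc] R assms(2) by auto
  have "?D \<subseteq> inside ?J \<union> ?J"
  proof -
    have "path_image (crv e) \<subseteq> inside ?J \<union> ?J" if e: "e \<in> E" "e \<subseteq> R" for e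
    proof (cases "e \<in> cycle_edges cs")
      case False
      with chord_inside[OF cyc] e R have "path_image (crv e) - pos ` e \<subseteq> inside ?J" by auto
      moreover have "pos ` e \<subseteq> ?J" using e vJ by auto
      ultimately show ?thesis by auto
    qed auto
    then show ?thesis using vJ by (auto simp: drawing_def induced_edges_def)
  qed
  then have "outside ?J \<subseteq> - ?D" by (auto simp: outside_inside)
  then have "outside ?J \<subseteq> outside ?D"
  proof (intro subsetI)
    fix z assume z: "z \<in> outside ?J" and sub: "outside ?J \<subseteq> - ?D"
    then have "outside ?J \<subseteq> connected_component_set (- ?D) z"
      using J(6) by (intro connected_component_maximal)
    then have "\<not> bounded (connected_component_set (- ?D) z)" using J(7) bounded_subset by blast
    then show "z \<in> outside ?D" unfolding outside[of ?D] by simp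
  qed
  moreover have "outside ?D \<subseteq> outside ?J" using JD by (rule outside_mono)
  ultimately show ?thesis using J by (simp add: unbounded_face_def)
qed

text \<open>By Janiszewski's theorem, attaching the paths \<open>ts\<close>, each at one point, to the closed disc
  bounded by the cycle does not separate the plane; so every bounded face lies in the disc.\<close>

lemma core_subset_cycle:
  assumes cyc: "cycle_in V E cs"
    and ts: "\<And>t. t \<in> set ts \<Longrightarrow> t \<noteq> [] \<and> distinct t \<and> set t \<subseteq> V \<and> path_edges t \<subseteq> E \<and>
      set t \<inter> set cs = {hd t}"
    and dis: "sorted_wrt (\<lambda>s t. set s \<inter> set t \<subseteq> set cs) ts"
    and V: "V = set cs \<union> (\<Union>t\<in>set ts. set t)"
    and E: "E = induced_edges E (set cs) \<union> (\<Union>t\<in>set ts. path_edges t)"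
  shows "core V E pos crv \<subseteq> set cs"
proof -
  let ?J = "img (cycle_edges cs)"
  note J = Jordan_cycle[OF cyc]
  have cs: "set cs \<subseteq> V" "cycle_edges cs \<subseteq> E" "2 \<le> length cs" using cyc by (auto simp: cycle_in_def)
  define A where "A t = drawing (set t) (path_edges t) pos crv" for t
  have At: "compact (A t) \<and> connected (- A t)" if t: "t \<in> set ts" for t
  proof (cases "2 \<le> length t")
    case True
    then obtain g where "arc g" "path_image g = img (path_edges t)"
      using path_arc[of t] ts[OF t] by auto
    moreover have "A t = img (path_edges t)"
      unfolding A_def using ts[OF t] True by (intro drawing_eq_img Union_path_edges) auto
    ultimately show ?thesis using compact_arc_image connected_arc_complement by (metis DIM_complex order_refl)
  next
    case False
    then obtain x where "t = [x]" using ts[OF t] by (cases t; cases "tl t") auto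
    then have "A t = {pos x}" by (simp add: A_def drawing_def)
    then show ?thesis by (simp add: connected_complement_bounded_convex)
  qed
  have AJ: "A t \<inter> (?J \<union> inside ?J) \<subseteq> {pos (hd t)}" if "t \<in> set ts" for t
  proof -
    note t = ts[OF that]
    \<comment> \<open>An attached path has only one vertex on the cycle, so none of its edges has
      both ends there. This keeps its edges off the cycle and, by
      \<open>edge_inside_imp_chord\<close>, out of its inside.\<close>
    have out: "\<not> e \<subseteq> set cs" if e: "e \<in> path_edges t" for e
    proof
      assume "e \<subseteq> set cs"
      then have "e \<subseteq> {hd t}" using path_edges_subset[OF e] t by auto
      then have "card e \<le> 1" using card_mono[of "{hd t}" e] by auto
      then show False using edge_card e t by fastforce
    qed
    have "path_edges t \<inter> cycle_edges cs = {}" using out cycle_edges_subset by fastforce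
    then have "A t \<inter> drawing (set cs) (cycle_edges cs) pos crv \<subseteq> pos ` (set t \<inter> set cs)"
      unfolding A_def using t cs
      by (intro drawing_Int Union_path_edges_subset Union_cycle_edges_subset) auto
    moreover have "drawing (set cs) (cycle_edges cs) pos crv = ?J"
      using drawing_eq_img[OF cs(2)] Union_cycle_edges[OF cs(3)] by simp
    moreover have "A t \<inter> inside ?J = {}"
    proof -
      have "path_image (crv e) \<inter> inside ?J = {}" if "e \<in> path_edges t" for e
      proof (rule ccontr)
        assume "path_image (crv e) \<inter> inside ?J \<noteq> {}"
        moreover have "e \<in> E" using that t by auto
        ultimately show False using edge_inside_imp_chord(1)[OF cyc] out[OF that] by simp
      qed
      then show ?thesis using vertex_not_inside[OF cyc] t by (auto simp: A_def drawing_def)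
    qed
    ultimately show ?thesis using t by auto
  qed
  have K: "compact (?J \<union> inside ?J \<union> (\<Union>t\<in>set us. A t)) \<and>
      connected (- (?J \<union> inside ?J \<union> (\<Union>t\<in>set us. A t)))"
    if "set us \<subseteq> set ts" "sorted_wrt (\<lambda>s t. set s \<inter> set t \<subseteq> set cs) us" for us
    using that
  proof (induction us)
    case Nil
    have "- (?J \<union> inside ?J) = outside ?J" by (simp add: outside_inside)
    moreover have "compact (?J \<union> inside ?J)"
      using J(4,10) compact_closure by (metis sup_commute)
    ultimately show ?case using J by simp
  next
    case (Cons t us)
    let ?K = "?J \<union> inside ?J \<union> (\<Union>t\<in>set us. A t)"
    have t: "t \<in> set ts" using Cons.prems by simp
    \<comment> \<open>Two attached paths may start at the same vertex of the cycle, as in an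
      \<alpha>-graph, so \<open>dis\<close> asks for disjointness off the cycle only. A common
      vertex must then be \<open>hd t\<close>, and the intersection remains connected, as
      Janiszewski's theorem requires.\<close>
    have "A t \<inter> A s \<subseteq> {pos (hd t)}" if s: "s \<in> set us" for s
    proof -
      have int: "set t \<inter> set s \<subseteq> set cs" and s': "s \<in> set ts" using Cons.prems s by auto
      have "path_edges t \<inter> path_edges s = {}"
      proof (rule ccontr)
        assume "path_edges t \<inter> path_edges s \<noteq> {}"
        then obtain e where e: "e \<in> path_edges t" "e \<in> path_edges s" by auto
        then have "e \<subseteq> set t \<inter> set s" using path_edges_subset by fastforce
        then have "e \<subseteq> {hd t}" using int ts[OF t] by blast
        then have "card e \<le> 1" using card_mono[of "{hd t}" e] by auto
        then show False using edge_card e ts[OF t] by fastforce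
      qed
      then have "A t \<inter> A s \<subseteq> pos ` (set t \<inter> set s)"
        unfolding A_def using ts[OF t] ts[OF s']
        by (intro drawing_Int Union_path_edges_subset) auto
      moreover have "set t \<inter> set s \<subseteq> {hd t}" using int ts[OF t] by blast
      ultimately show ?thesis by auto
    qed
    then have "A t \<inter> ?K \<subseteq> {pos (hd t)}" using AJ[OF t] by auto
    then have conn: "connected (A t \<inter> ?K)"
      by (metis connected_empty connected_sing subset_singletonD)
    have IH: "compact ?K" "connected (- ?K)" using Cons by auto
    have "connected (- (A t \<union> ?K))"
      by (rule Janiszewski_connected[OF conjunct1[OF At[OF t]] compact_imp_closed[OF IH(1)] conn
            conjunct2[OF At[OF t]] IH(2)])
    moreover have "compact (A t \<union> ?K)" by (rule compact_Un[OF conjunct1[OF At[OF t]] IH(1)])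
    moreover have "?J \<union> inside ?J \<union> (\<Union>t\<in>set (t # us). A t) = A t \<union> ?K" by auto
    ultimately show ?case by simp
  qed
  define Z where "Z = ?J \<union> inside ?J \<union> (\<Union>t\<in>set ts. A t)"
  have Z: "compact Z" "connected (- Z)" using K[of ts] dis by (auto simp: Z_def)
  let ?D = "drawing V E pos crv"
  have DZ: "?D \<subseteq> Z"
  proof -
    have "path_image (crv e) \<subseteq> Z" if "e \<in> E" for e
    proof -
      have "e \<in> induced_edges E (set cs) \<union> (\<Union>t\<in>set ts. path_edges t)"
        using E that by blast
      then consider "e \<subseteq> set cs" | t where "t \<in> set ts" "e \<in> path_edges t"
        unfolding induced_edges_def by blast
      then show ?thesis
      proof cases
        case 1
        then show ?thesis
        proof (cases "e \<in> cycle_edges cs")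
          case False
          then have "path_image (crv e) - pos ` e \<subseteq> inside ?J" using chord_inside[OF cyc that 1] by simp
          moreover have "pos v \<in> ?J" if "v \<in> e" for v
            using 1 that pos_in_cycle_iff[OF cyc, of v] cs(1) by blast
          ultimately have "path_image (crv e) \<subseteq> ?J \<union> inside ?J" by blast
          then show ?thesis by (auto simp: Z_def)
        qed (auto simp: Z_def)
      next
        case 2
        then show ?thesis by (auto simp: Z_def A_def drawing_def)
      qed
    qed
    moreover have "pos v \<in> Z" if "v \<in> V" for v
    proof -
      have "v \<in> set cs \<union> (\<Union>t\<in>set ts. set t)" using V that by blast
      then show ?thesis
        using pos_in_cycle_iff[OF cyc that] by (auto simp: Z_def A_def drawing_def)
    qed
    ultimately show ?thesis by (auto simp: drawing_def)
  qed
  show ?thesis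
  proof
    fix v assume "v \<in> core V E pos crv"
    then obtain F where v: "v \<in> V" and F: "F \<in> components (- ?D)" "bounded F" "pos v \<in> frontier F"
      by (auto simp: core_def faces_def)
    \<comment> \<open>The complement of \<open>Z\<close> is connected, misses the drawing and is
      unbounded; a face that met it would contain it.\<close>
    have "F \<inter> - Z = {}"
    proof (rule ccontr)
      assume "F \<inter> - Z \<noteq> {}"
      then have "- Z \<subseteq> F" using components_maximal[OF F(1) Z(2)] DZ by auto
      then have "bounded (- Z)" using F(2) bounded_subset by blast
      then show False using Z(1) compact_imp_bounded cobounded_imp_unbounded by blast
    qed
    moreover have "F \<subseteq> - ?D" using F(1) in_components_subset by blast
    moreover have "?J \<subseteq> ?D" using cs by (auto simp: drawing_def)
    moreover have "A t \<subseteq> ?D" if "t \<in> set ts" for t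
      using ts[OF that] by (auto simp: A_def drawing_def)
    ultimately have "F \<subseteq> inside ?J" unfolding Z_def by blast
    then have "closure F \<subseteq> inside ?J \<union> ?J"
      unfolding J(10)[symmetric] by (rule closure_mono)
    then have "frontier F \<subseteq> inside ?J \<union> ?J"
      by (auto simp: frontier_def)
    then have "pos v \<in> ?J" using F(3) vertex_not_inside[OF cyc v] by auto
    then show "v \<in> set cs" using pos_in_cycle_iff[OF cyc v] by simp
  qed
qed

end

section \<open>Ladders\<close>

text \<open>By the last assumption the edges between the two paths form a chain in the product order of
  their indices, so they are ordered by the index sum \<open>rk\<close> below.\<close>

locale ladder =
  fixes V :: "'a set" and E :: "'a set set" and v u :: "nat \<Rightarrow> 'a" and p q :: nat
  assumes simple: "simple_graph V E"
    and inj_v: "inj_on v {..<p}" and inj_u: "inj_on u {..<q}"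
    and vu_disjoint: "v ` {..<p} \<inter> u ` {..<q} = {}"
    and V_eq: "V = v ` {..<p} \<union> u ` {..<q}"
    and v_edge: "\<And>i j. i < j \<Longrightarrow> j < p \<Longrightarrow> {v i, v j} \<in> E \<longleftrightarrow> j = Suc i"
    and u_edge: "\<And>i j. i < j \<Longrightarrow> j < q \<Longrightarrow> {u i, u j} \<in> E \<longleftrightarrow> j = Suc i"
    and noncrossing: "\<And>i j x y. i < p \<Longrightarrow> j < q \<Longrightarrow> x < p \<Longrightarrow> y < q \<Longrightarrow>
      {v i, u j} \<in> E \<Longrightarrow> {v x, u y} \<in> E \<Longrightarrow> i < x \<Longrightarrow> j \<le> y"
begin

section \<open>Rungs, that is, the edges between the two paths, and the blocks between them\<close>

definition cross :: "(nat \<times> nat) set" where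
  "cross = {(i, j). i < p \<and> j < q \<and> {v i, u j} \<in> E}"

definition rk :: "nat \<times> nat \<Rightarrow> nat" where
  "rk f = fst f + snd f"

definition edge :: "nat \<times> nat \<Rightarrow> 'a set" where
  "edge f = {v (fst f), u (snd f)}"

definition block :: "nat \<times> nat \<Rightarrow> nat \<times> nat \<Rightarrow> 'a set" where
  "block f g = v ` {fst f..fst g} \<union> u ` {snd f..snd g}"

text \<open>The second path is read backwards so that the list goes once around the block: the rungs
  \<open>g\<close> and \<open>f\<close> become the edges between the two halves.\<close>

definition block_list :: "nat \<times> nat \<Rightarrow> nat \<times> nat \<Rightarrow> 'a list" where
  "block_list f g = map v [fst f..<Suc (fst g)] @ rev (map u [snd f..<Suc (snd g)])"

lemma v_eq_iff: "i < p \<Longrightarrow> j < p \<Longrightarrow> v i = v j \<longleftrightarrow> i = j"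
  using inj_v by (auto simp: inj_on_eq_iff)

lemma u_eq_iff: "i < q \<Longrightarrow> j < q \<Longrightarrow> u i = u j \<longleftrightarrow> i = j"
  using inj_u by (auto simp: inj_on_eq_iff)

lemma v_neq_u: "i < p \<Longrightarrow> j < q \<Longrightarrow> v i \<noteq> u j"
  using vu_disjoint by auto

text \<open>\<open>noncrossing\<close> is stated from the side of the first path; its contrapositive
  is the same statement from the side of the second. Every result on one path thus transfers to the
  other.\<close>

lemma swap: "ladder V E u v q p"
proof
  fix i j x y
  assume *: "i < q" "j < p" "x < q" "y < p" "{u i, v j} \<in> E" "{u x, v y} \<in> E" "i < x"
  show "j \<le> y"
  proof (rule ccontr)
    assume "\<not> j \<le> y"
    then have "x \<le> i" using noncrossing[of y x j i] * by (auto simp: insert_commute)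
    with * show False by simp
  qed
qed (use simple inj_v inj_u vu_disjoint V_eq v_edge u_edge in auto)

lemma crossD: "f \<in> cross \<Longrightarrow> fst f < p \<and> snd f < q \<and> edge f \<in> E"
  by (auto simp: cross_def edge_def)

lemma crossI: "i < p \<Longrightarrow> j < q \<Longrightarrow> {v i, u j} \<in> E \<Longrightarrow> (i, j) \<in> cross"
  by (auto simp: cross_def)

lemma finite_cross: "finite cross"
  by (rule finite_subset[of _ "{..<p} \<times> {..<q}"]) (auto simp: cross_def)

text \<open>If the first index decreased from \<open>f\<close> to \<open>g\<close>, noncrossing
  would keep the second from increasing, and the index sum would drop. With the first index settled,
  the second follows in the same way.\<close>

lemma cross_mono:
  assumes "f \<in> cross" "g \<in> cross" "rk f \<le> rk g"
  shows "fst f \<le> fst g" "snd f \<le> snd g"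
proof -
  have f: "fst f < p" "snd f < q" "{v (fst f), u (snd f)} \<in> E"
    and g: "fst g < p" "snd g < q" "{v (fst g), u (snd g)} \<in> E"
    using assms by (auto dest!: crossD simp: edge_def)
  show "fst f \<le> fst g"
    using noncrossing[of "fst g" "snd g" "fst f" "snd f"] f g assms(3) by (force simp: rk_def)
  show "snd f \<le> snd g"
    using noncrossing[of "fst f" "snd f" "fst g" "snd g"] f g assms(3) \<open>fst f \<le> fst g\<close>
    by (cases "fst f = fst g") (auto simp: rk_def)
qed

lemma rk_eq_iff: "f \<in> cross \<Longrightarrow> g \<in> cross \<Longrightarrow> rk f = rk g \<longleftrightarrow> f = g"
  by (metis cross_mono order_refl order_antisym prod_eqI)

lemma rk_between:
  assumes "f \<in> cross" "g \<in> cross" "(i, j) \<in> cross"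
    "fst f \<le> i" "i \<le> fst g" "snd f \<le> j" "j \<le> snd g"
  shows "(i, j) = f \<or> (i, j) = g \<or> rk f < rk (i, j) \<and> rk (i, j) < rk g"
proof -
  have "rk f \<le> rk (i, j)" "rk (i, j) \<le> rk g" using assms by (auto simp: rk_def)
  then show ?thesis using rk_eq_iff assms by (metis le_neq_implies_less)
qed

lemma edge_cases:
  assumes "e \<in> E"
  obtains (v) i where "Suc i < p" "e = {v i, v (Suc i)}"
    | (u) j where "Suc j < q" "e = {u j, u (Suc j)}"
    | (cross) i j where "(i, j) \<in> cross" "e = {v i, u j}"
proof -
  have "card e = 2" "e \<subseteq> V" using assms simple by (auto simp: simple_graph_def)
  then obtain x y where e: "e = {x, y}" "x \<noteq> y" "x \<in> V" "y \<in> V" by (auto simp: card_2_iff)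
  have vv: thesis if "i < j" "j < p" "e = {v i, v j}" for i j
    using v_edge[OF that(1,2)] that assms v[of i] by auto
  have uu: thesis if "i < j" "j < q" "e = {u i, u j}" for i j
    using u_edge[OF that(1,2)] that assms u[of i] by auto
  have vu: thesis if "i < p" "j < q" "e = {v i, u j}" for i j
    using that assms cross[OF crossI] by auto
  from e V_eq consider i j where "i < p" "j < p" "x = v i" "y = v j"
    | i j where "i < q" "j < q" "x = u i" "y = u j"
    | i j where "i < p" "j < q" "x = v i" "y = u j"
    | i j where "i < p" "j < q" "y = v i" "x = u j" by auto
  then show thesis
  proof cases
    case (1 i j)
    then have "i \<noteq> j" "e = {v i, v j}" "e = {v j, v i}" using e by auto
    moreover from \<open>i \<noteq> j\<close> have "i < j \<or> j < i" by auto
    ultimately show thesis using vv[of i j] vv[of j i] 1 by blast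
  next
    case (2 i j)
    then have "i \<noteq> j" "e = {u i, u j}" "e = {u j, u i}" using e by auto
    moreover from \<open>i \<noteq> j\<close> have "i < j \<or> j < i" by auto
    ultimately show thesis using uu[of i j] uu[of j i] 2 by blast
  next
    case (3 i j)
    then show thesis using vu e by auto
  next
    case (4 i j)
    then have "e = {v i, u j}" using e by auto
    then show thesis using vu 4 by blast
  qed
qed

lemma v_path_edge: "Suc i < p \<Longrightarrow> {v i, v (Suc i)} \<in> E"
  using v_edge[of i "Suc i"] by simp

lemma u_path_edge: "Suc i < q \<Longrightarrow> {u i, u (Suc i)} \<in> E"
  using u_edge[of i "Suc i"] by simp

lemma edge_eq_iff: "f \<in> cross \<Longrightarrow> g \<in> cross \<Longrightarrow> edge f = edge g \<longleftrightarrow> f = g"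
  using v_neq_u by (auto simp: edge_def doubleton_eq_iff v_eq_iff u_eq_iff prod_eq_iff dest!: crossD)

lemma v_in_block_iff: "k < p \<Longrightarrow> fst g < p \<Longrightarrow> snd g < q \<Longrightarrow> v k \<in> block f g \<longleftrightarrow> fst f \<le> k \<and> k \<le> fst g"
proof -
  assume k: "k < p" "fst g < p" "snd g < q"
  have "v k \<in> v ` {fst f..fst g} \<longleftrightarrow> k \<in> {fst f..fst g}"
    using k by (intro inj_on_image_mem_iff[OF inj_v]) auto
  moreover have "v k \<notin> u ` {snd f..snd g}" using k v_neq_u by auto
  ultimately show ?thesis by (auto simp: block_def)
qed

lemma u_in_block_iff: "k < q \<Longrightarrow> fst g < p \<Longrightarrow> snd g < q \<Longrightarrow> u k \<in> block f g \<longleftrightarrow> snd f \<le> k \<and> k \<le> snd g"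
proof -
  assume k: "k < q" "fst g < p" "snd g < q"
  have "u k \<in> u ` {snd f..snd g} \<longleftrightarrow> k \<in> {snd f..snd g}"
    using k by (intro inj_on_image_mem_iff[OF inj_u]) auto
  moreover have "u k \<notin> v ` {fst f..fst g}"
  proof
    assume "u k \<in> v ` {fst f..fst g}"
    then obtain i where "i \<le> fst g" "u k = v i" by auto
    then show False using v_neq_u[of i k] k by auto
  qed
  ultimately show ?thesis by (auto simp: block_def)
qed

lemma set_block_list: "set (block_list f g) = block f g"
  by (simp add: block_list_def block_def atLeastLessThanSuc_atLeastAtMost del: upt_Suc)

lemma cycle_edges_block_list:
  assumes "f \<in> cross" "g \<in> cross" "rk f < rk g"
  shows "cycle_edges (block_list f g) = {{v k, v (Suc k)} | k. fst f \<le> k \<and> k < fst g} \<union>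
    {{u k, u (Suc k)} | k. snd f \<le> k \<and> k < snd g} \<union> {edge f, edge g}"
proof -
  have le: "fst f \<le> fst g" "snd f \<le> snd g" using cross_mono assms by auto
  have "cycle_edges (block_list f g) = path_edges (map v [fst f..<Suc (fst g)]) \<union>
      path_edges (map u [snd f..<Suc (snd g)]) \<union> {{v (fst g), u (snd g)}, {u (snd f), v (fst f)}}"
    unfolding block_list_def using le
    by (subst cycle_edges_append) (auto simp: last_rev hd_rev hd_map last_map simp del: upt_Suc
        intro: arg_cong[where f = "\<lambda>x. {x, _}"])
  then show ?thesis
    by (simp only: path_edges_map_upt Suc_less_eq edge_def insert_commute)
qed

lemma distinct_block_list:
  assumes "f \<in> cross" "g \<in> cross"
  shows "distinct (block_list f g)"
proof -
  have "fst g < p" "snd g < q" using assms crossD by auto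
  then have "inj_on v {fst f..<Suc (fst g)}" "inj_on u {snd f..<Suc (snd g)}"
    by (auto intro: inj_on_subset[OF inj_v] inj_on_subset[OF inj_u])
  moreover have "v ` {fst f..<Suc (fst g)} \<inter> u ` {snd f..<Suc (snd g)} = {}"
    using v_neq_u \<open>fst g < p\<close> \<open>snd g < q\<close> by (auto simp: less_Suc_eq_le)
  ultimately show ?thesis by (simp add: block_list_def distinct_map del: upt_Suc)
qed

lemma length_block_list:
  assumes "f \<in> cross" "g \<in> cross" "rk f < rk g"
  shows "3 \<le> length (block_list f g)"
  using cross_mono[of f g] assms by (auto simp: block_list_def rk_def simp del: upt_Suc)

lemma block_subset:
  assumes "f \<in> cross" "g \<in> cross"
  shows "block f g \<subseteq> V"
  using crossD[OF assms(2)] by (auto simp: block_def V_eq)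

lemma cycle_in_block_list:
  assumes "f \<in> cross" "g \<in> cross" "rk f < rk g"
  shows "cycle_in V E (block_list f g)"
  using assms distinct_block_list length_block_list block_subset crossD[of f] crossD[of g]
  by (auto simp: cycle_in_def set_block_list cycle_edges_block_list intro!: v_path_edge u_path_edge)

lemma edge_not_in_cycle_edges_block_list:
  assumes "f \<in> cross" "g \<in> cross" "rk f < rk g" "h \<in> cross" "h \<noteq> f" "h \<noteq> g"
  shows "edge h \<notin> cycle_edges (block_list f g)"
proof -
  have h: "fst h < p" "snd h < q" and g: "fst g < p" "snd g < q" using assms crossD by auto
  have "edge h \<noteq> {v k, v (Suc k)}" if "k < fst g" for k
    using v_neq_u[of k "snd h"] v_neq_u[of "Suc k" "snd h"] h g that
    by (auto simp: edge_def doubleton_eq_iff)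
  moreover have "edge h \<noteq> {u k, u (Suc k)}" if "k < snd g" for k
    using v_neq_u[of "fst h" k] v_neq_u[of "fst h" "Suc k"] h g that
    by (auto simp: edge_def doubleton_eq_iff)
  ultimately show ?thesis
    using assms edge_eq_iff unfolding cycle_edges_block_list[OF assms(1-3)] by blast
qed

text \<open>A rung with both ends in the block lies between \<open>f\<close> and \<open>g\<close> in
  both indices, so by \<open>rk_between\<close> it is one of them or has a rank strictly between
  theirs. The latter rungs are the chords of the cycle around the block.\<close>

lemma induced_edges_block:
  assumes "f \<in> cross" "g \<in> cross" "rk f < rk g"
  shows "induced_edges E (block f g) =
    cycle_edges (block_list f g) \<union> edge ` {h \<in> cross. rk f < rk h \<and> rk h < rk g}"
proof -
  have g: "fst g < p" "snd g < q" using assms crossD by auto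
  note inb = v_in_block_iff[OF _ g] u_in_block_iff[OF _ g]
  have "e \<in> cycle_edges (block_list f g) \<union> edge ` {h \<in> cross. rk f < rk h \<and> rk h < rk g}"
    if e: "e \<in> E" "e \<subseteq> block f g" for e
    using e(1)
  proof (cases rule: edge_cases)
    case (v i)
    then show ?thesis using e inb by (auto simp: cycle_edges_block_list[OF assms])
  next
    case (u j)
    then show ?thesis using e inb by (auto simp: cycle_edges_block_list[OF assms])
  next
    case (cross i j)
    then have "i < p" "j < q" by (auto simp: cross_def)
    then have "fst f \<le> i" "i \<le> fst g" "snd f \<le> j" "j \<le> snd g" using cross e inb by auto
    then have "(i, j) = f \<or> (i, j) = g \<or> rk f < rk (i, j) \<and> rk (i, j) < rk g"
      using rk_between assms cross by blast
    moreover have "e = edge (i, j)" using cross by (simp add: edge_def)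
    ultimately show ?thesis using cross by (auto simp: cycle_edges_block_list[OF assms])
  qed
  moreover have "e \<in> E \<and> e \<subseteq> block f g" if "e \<in> cycle_edges (block_list f g)" for e
    using that cycle_in_block_list[OF assms] cycle_edges_subset[OF that] by (auto simp: cycle_in_def set_block_list)
  moreover have "edge h \<in> E \<and> edge h \<subseteq> block f g" if h: "h \<in> cross" "rk f < rk h" "rk h < rk g" for h
  proof -
    have "fst f \<le> fst h" "snd f \<le> snd h" "fst h \<le> fst g" "snd h \<le> snd g"
      using cross_mono assms h by (auto simp: less_imp_le)
    then show ?thesis using inb crossD[OF h(1)] by (simp add: edge_def)
  qed
  ultimately show ?thesis unfolding induced_edges_def by blast
qed

section \<open>How a cycle can run in a ladder\<close>

lemma cycle_end_vertex:
  assumes zs: "cycle_in V E zs" and i: "i < p" "v i \<in> set zs"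
    and ext: "(\<forall>k<p. v k \<in> set zs \<longrightarrow> i \<le> k) \<or> (\<forall>k<p. v k \<in> set zs \<longrightarrow> k \<le> i)"
  obtains j where "(i, j) \<in> cross" "{v i, u j} \<in> cycle_edges zs"
proof -
  obtain y z where yz: "y \<noteq> z" "y \<noteq> v i" "z \<noteq> v i"
    "{v i, y} \<in> cycle_edges zs" "{v i, z} \<in> cycle_edges zs"
    using cycle_neighbours[of zs "v i"] zs i by (auto simp: cycle_in_def)
  \<comment> \<open>On its path an extreme vertex has a neighbour on at most one side that still
    belongs to the cycle; the \<open>if\<close> names that neighbour. Since two different neighbours
    on the cycle exist, one of them is reached by a rung.\<close>
  have nb: "(\<exists>j. (i, j) \<in> cross \<and> w = u j) \<or>
      w = (if \<forall>k<p. v k \<in> set zs \<longrightarrow> i \<le> k then v (Suc i) else v (i - 1))"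
    if w: "w \<noteq> v i" "{v i, w} \<in> cycle_edges zs" for w
  proof -
    have wz: "w \<in> set zs" using cycle_edges_subset[OF w(2)] by simp
    have "{v i, w} \<in> E" using zs w by (auto simp: cycle_in_def)
    then show ?thesis
    proof (cases rule: edge_cases)
      case (v k)
      then consider "k = i" "w = v (Suc i)" | "i = Suc k" "w = v k"
        using i w v_eq_iff by (auto simp: doubleton_eq_iff)
      then show ?thesis
      proof cases
        case 1
        then show ?thesis using ext wz v by auto
      next
        case 2
        then have "v k \<in> set zs" "k < p" "\<not> i \<le> k" using wz v by auto
        then have "\<not> (\<forall>k<p. v k \<in> set zs \<longrightarrow> i \<le> k)" by blast
        then show ?thesis using 2 by auto
      qed
    next
      case (u j)
      then have "v i = u j \<or> v i = u (Suc j)" by (auto simp: doubleton_eq_iff)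
      then show ?thesis using v_neq_u i u by auto
    next
      case (cross k j)
      then have "k < p" "j < q" by (auto simp: cross_def)
      then show ?thesis using cross v_neq_u v_eq_iff i by (auto simp: doubleton_eq_iff)
    qed
  qed
  from nb[OF yz(2,4)] nb[OF yz(3,5)] yz(1) consider
    j where "(i, j) \<in> cross" "y = u j" | j where "(i, j) \<in> cross" "z = u j" by metis
  then show thesis using that yz by cases auto
qed

text \<open>If the cycle stayed on the second path, its last vertex there would, by
  \<open>cycle_end_vertex\<close> for the exchanged paths, be the end of a rung of the cycle, which
  leads to the first path after all.\<close>

lemma cycle_meets_v:
  assumes zs: "cycle_in V E zs"
  shows "\<exists>i<p. v i \<in> set zs"
proof (rule ccontr)
  assume no: "\<not> (\<exists>i<p. v i \<in> set zs)"
  define J where "J = {j. j < q \<and> u j \<in> set zs}"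
  have "zs \<noteq> []" using zs by (auto simp: cycle_in_def)
  then have "hd zs \<in> V" "hd zs \<in> set zs" using zs by (auto simp: cycle_in_def)
  then have "J \<noteq> {}" using no by (auto simp: V_eq J_def)
  moreover have "finite J" by (simp add: J_def)
  ultimately have J: "Max J \<in> J" "\<And>k. k \<in> J \<Longrightarrow> k \<le> Max J" by auto
  then obtain i where "(Max J, i) \<in> ladder.cross E u v q p" "{u (Max J), v i} \<in> cycle_edges zs"
    using ladder.cycle_end_vertex[OF swap zs, of "Max J"] by (auto simp: J_def)
  then have "i < p" "v i \<in> set zs"
    using cycle_edges_subset by (fastforce simp: ladder.cross_def[OF swap])+
  with no show False by blast
qed

lemma cycle_bounds:
  assumes zs: "cycle_in V E zs"
  obtains i x where "i < p" "x < p" "v i \<in> set zs" "v x \<in> set zs"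
    "\<forall>k<p. v k \<in> set zs \<longrightarrow> i \<le> k \<and> k \<le> x"
proof -
  define I where "I = {i. i < p \<and> v i \<in> set zs}"
  have "I \<noteq> {}" "finite I" using cycle_meets_v[OF zs] by (auto simp: I_def)
  then have "Min I \<in> I" "Max I \<in> I" "\<And>k. k \<in> I \<Longrightarrow> Min I \<le> k \<and> k \<le> Max I" by auto
  then show thesis using that[of "Min I" "Max I"] by (auto simp: I_def)
qed

text \<open>By \<open>cycle_end_vertex\<close> the extreme vertices of the cycle on either path are
  ends of rungs of the cycle. With \<open>f\<close> and \<open>g\<close> the first and the last of
  these rungs, monotonicity bounds all indices that occur.\<close>

lemma cycle_in_block:
  assumes zs: "cycle_in V E zs"
  obtains f g where "f \<in> cross" "g \<in> cross" "rk f < rk g" "edge f \<in> cycle_edges zs"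
    "edge g \<in> cycle_edges zs" "set zs \<subseteq> block f g"
proof -
  define F where "F = {f \<in> cross. edge f \<in> cycle_edges zs}"
  obtain i x where ix: "i < p" "x < p" "v i \<in> set zs" "v x \<in> set zs"
    "\<forall>k<p. v k \<in> set zs \<longrightarrow> i \<le> k \<and> k \<le> x"
    by (rule cycle_bounds[OF zs])
  obtain j y where jy: "j < q" "y < q" "u j \<in> set zs" "u y \<in> set zs"
    "\<forall>k<q. u k \<in> set zs \<longrightarrow> j \<le> k \<and> k \<le> y"
    by (rule ladder.cycle_bounds[OF swap zs])
  have sw: "(a, b) \<in> ladder.cross E u v q p \<longleftrightarrow> (b, a) \<in> cross" for a b
    by (auto simp: ladder.cross_def[OF swap] cross_def insert_commute)
  obtain i' where i': "(i, i') \<in> F"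
    using cycle_end_vertex[OF zs ix(1,3)] ix by (auto simp: F_def edge_def)
  obtain x' where x': "(x, x') \<in> F"
    using cycle_end_vertex[OF zs ix(2,4)] ix by (auto simp: F_def edge_def)
  obtain j' where j': "(j', j) \<in> F"
    using ladder.cycle_end_vertex[OF swap zs jy(1,3)] jy by (auto simp: F_def edge_def sw insert_commute)
  obtain y' where y': "(y', y) \<in> F"
    using ladder.cycle_end_vertex[OF swap zs jy(2,4)] jy by (auto simp: F_def edge_def sw insert_commute)
  have fin: "finite F" using finite_cross by (simp add: F_def)
  have "F \<noteq> {}" using i' by auto
  then obtain f where f: "f \<in> F" "\<And>h. h \<in> F \<Longrightarrow> rk f \<le> rk h"
    using arg_min_if_finite[OF fin, of rk] by (metis linorder_le_less_linear)
  have "Max (rk ` F) \<in> rk ` F" using \<open>F \<noteq> {}\<close> fin by simp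
  then obtain g where g: "g \<in> F" "Max (rk ` F) = rk g" by blast
  have g_max: "rk h \<le> rk g" if "h \<in> F" for h using Max_ge[of "rk ` F" "rk h"] fin that g(2) by simp
  have fg: "fst f \<le> fst h \<and> snd f \<le> snd h \<and> fst h \<le> fst g \<and> snd h \<le> snd g" if "h \<in> F" for h
    using cross_mono[of f h] cross_mono[of h g] f g(1) g_max[OF that] that by (auto simp: F_def)
  have block: "set zs \<subseteq> block f g"
  proof
    fix w assume w: "w \<in> set zs"
    then have "w \<in> V" using zs by (auto simp: cycle_in_def)
    then consider k where "k < p" "w = v k" | k where "k < q" "w = u k" by (auto simp: V_eq)
    then show "w \<in> block f g"
    proof cases
      case 1
      then have "fst f \<le> k" "k \<le> fst g" using ix(5) w 1 fg[OF i'] fg[OF x'] by auto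
      then show ?thesis using 1 by (auto simp: block_def)
    next
      case 2
      then have "snd f \<le> k" "k \<le> snd g" using jy(5) w 2 fg[OF j'] fg[OF y'] by auto
      then show ?thesis using 2 by (auto simp: block_def)
    qed
  qed
  \<comment> \<open>A single rung would confine the cycle to its two ends.\<close>
  have "rk f < rk g"
  proof (rule ccontr)
    assume "\<not> rk f < rk g"
    then have "f = g" using f(1) f(2)[OF g(1)] g(1) rk_eq_iff[of f g] by (auto simp: F_def)
    then have "set zs \<subseteq> {v (fst g), u (snd g)}" using block by (auto simp: block_def)
    then have "card (set zs) \<le> 2"
      using card_mono[of "{v (fst g), u (snd g)}" "set zs"] card_insert_le_m1[of 2 "{u (snd g)}"]
      by (auto simp: card_insert_if split: if_splits)
    then show False using zs by (auto simp: cycle_in_def distinct_card)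
  qed
  then show thesis using that[of f g] f(1) g(1) block unfolding F_def by blast
qed

definition consecutive :: "nat \<times> nat \<Rightarrow> nat \<times> nat \<Rightarrow> bool" where
  "consecutive f g \<longleftrightarrow> f \<in> cross \<and> g \<in> cross \<and> rk f < rk g \<and>
    (\<forall>h\<in>cross. \<not> (rk f < rk h \<and> rk h < rk g))"

lemma induced_edges_consecutive:
  "consecutive f g \<Longrightarrow> induced_edges E (block f g) = cycle_edges (block_list f g)"
  by (auto simp: consecutive_def induced_edges_block)

lemma induced_cycle_block:
  assumes "consecutive f g"
  shows "induced_cycle V E (block f g)"
proof -
  have fg: "f \<in> cross" "g \<in> cross" "rk f < rk g" using assms by (auto simp: consecutive_def)
  have "hamiltonian_cycle (block f g) (induced_edges E (block f g)) (block_list f g)"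
    unfolding hamiltonian_cycle_def cycle_in_def induced_edges_consecutive[OF assms]
    using fg distinct_block_list length_block_list set_block_list by auto
  then show ?thesis
    unfolding induced_cycle_def is_cycle_graph_def
    using induced_edges_consecutive[OF assms] block_subset fg by blast
qed

text \<open>If \<open>v t\<close> were missing, the part \<open>A\<close> of the cycle before it
  could be left by a rung only, and the only rung available there is the given one. Its other end
  \<open>u j\<close> is deleted, so no edge leads from \<open>A\<close> to the rest, although
  deleting one vertex does not disconnect a cycle.\<close>

lemma cycle_contiguous:
  assumes zs: "cycle_in V E zs" and ij: "(i, j) \<in> cross" "{v i, u j} \<in> cycle_edges zs"
    and x: "x < p" "v x \<in> set zs"
    and only: "\<And>k l. (k, l) \<in> cross \<Longrightarrow> v k \<in> set zs \<Longrightarrow> u l \<in> set zs \<Longrightarrow> (k, l) = (i, j) \<or> k = x"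
    and t: "i < t" "t < x"
  shows "v t \<in> set zs"
proof (rule ccontr)
  assume vt: "v t \<notin> set zs"
  define A where "A = {w \<in> set zs. \<exists>k<t. w = v k}"
  define B where "B = set zs - A - {u j}"
  have jq: "j < q" and ip: "i < p" using ij by (auto simp: cross_def)
  have "v i \<in> set zs" "u j \<in> set zs" using cycle_edges_subset[OF ij(2)] by auto
  then have "v i \<in> A" using t by (auto simp: A_def)
  have "v x \<in> B" using x t v_neq_u[OF x(1) jq] v_eq_iff by (force simp: B_def A_def)
  have uA: "u j \<notin> A"
  proof
    assume "u j \<in> A"
    then obtain k where "k < t" "u j = v k" by (auto simp: A_def)
    then show False using v_neq_u[OF _ jq, of k] t x by auto
  qed
  obtain a b where ab: "a \<in> A" "b \<in> B" "{a, b} \<in> cycle_edges zs"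
  proof (rule cycle_cut[of zs "{v i, u j}" "{u j}" A B])
    show "distinct zs" using zs by (simp add: cycle_in_def)
    show "set zs - {u j} = A \<union> B" using uA by (auto simp: B_def A_def)
  qed (use ij \<open>v i \<in> A\<close> \<open>v x \<in> B\<close> in \<open>auto simp: B_def\<close>)
  obtain k where k: "a = v k" "k < t" using ab by (auto simp: A_def)
  have mem: "a \<in> set zs" "b \<in> set zs" using ab by (auto simp: A_def B_def)
  have "{a, b} \<in> E" using ab zs by (auto simp: cycle_in_def)
  then show False
  proof (cases rule: edge_cases)
    case (v l)
    then consider "k = l" "b = v (Suc l)" | "k = Suc l" "b = v l"
      using k t x v_eq_iff by (auto simp: doubleton_eq_iff)
    then show False
    proof cases
      case 1
      then have "Suc l \<noteq> t" using vt mem by auto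
      then have "Suc l < t" using 1 k by auto
      then have "b \<in> A" using 1 mem unfolding A_def by blast
      then show False using ab by (auto simp: B_def)
    next
      case 2
      then have "l < t" using k by auto
      then have "b \<in> A" using 2 mem unfolding A_def by blast
      then show False using ab by (auto simp: B_def)
    qed
  next
    case (u l)
    then show False using k t x v_neq_u by (auto simp: doubleton_eq_iff)
  next
    case (cross l m)
    then have lm: "l < p" "m < q" by (auto simp: cross_def)
    then have "v k = v l" "b = u m" using cross k t x v_neq_u by (auto simp: doubleton_eq_iff)
    then have "k = l" using v_eq_iff[of k l] k t x lm by auto
    then have "(l, m) = (i, j)" using only[of l m] cross mem k t x \<open>b = u m\<close> by auto
    then show False using ab \<open>b = u m\<close> by (auto simp: B_def)
  qed
qed

text \<open>An edge between the two paths that lies strictly between the first and the last such edge of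
  the cycle would separate the cycle.\<close>

lemma induced_cycle_is_block:
  assumes "induced_cycle V E S"
  obtains f g where "consecutive f g" "S = block f g"
proof -
  obtain zs where zs: "cycle_in V E zs" "set zs = S" "induced_edges E S = cycle_edges zs"
    using assms
    by (auto simp: induced_cycle_def is_cycle_graph_def hamiltonian_cycle_def cycle_in_def
        induced_edges_def)
  obtain f g where fg: "f \<in> cross" "g \<in> cross" "rk f < rk g" "edge f \<in> cycle_edges zs"
    "edge g \<in> cycle_edges zs" "set zs \<subseteq> block f g"
    using cycle_in_block[OF zs(1)] .
  have fS: "v (fst f) \<in> S" "u (snd f) \<in> S" and gS: "v (fst g) \<in> S" "u (snd g) \<in> S"
    using cycle_edges_subset[OF fg(4)] cycle_edges_subset[OF fg(5)] zs by (auto simp: edge_def)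
  have bd: "fst f < p" "snd f < q" "fst g < p" "snd g < q" using fg crossD by auto
  have cons: "consecutive f g"
  proof (rule ccontr)
    assume "\<not> consecutive f g"
    then obtain h where h: "h \<in> cross" "rk f < rk h" "rk h < rk g"
      using fg by (auto simp: consecutive_def)
    have hb: "fst h < p" "snd h < q" using h crossD by auto
    have le: "fst f \<le> fst h" "snd f \<le> snd h" "fst h \<le> fst g" "snd h \<le> snd g"
      using cross_mono fg h by (auto simp: less_imp_le)
    \<comment> \<open>\<open>W\<close> is the part of the intermediate rung \<open>h\<close> that
      lies on the cycle, \<open>A\<close> and \<open>B\<close> are the parts of the cycle before and
      after \<open>h\<close>. If both ends of \<open>h\<close> are in \<open>S\<close>, then
      \<open>h\<close> is an edge of the induced cycle; otherwise \<open>W\<close> has at most one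
      vertex. Either way \<open>W\<close> lies in an edge of the cycle, as \<open>cycle_cut\<close>
      demands.\<close>
    define W where "W = edge h \<inter> S"
    define A where "A = {w \<in> S. (\<exists>k\<le>fst h. w = v k) \<or> (\<exists>k\<le>snd h. w = u k)} - W"
    define B where "B = S - W - A"
    have "\<exists>e\<in>cycle_edges zs. W \<subseteq> e"
    proof (cases "edge h \<subseteq> S")
      case True
      then have "edge h \<in> cycle_edges zs"
        using zs(3) crossD[OF h(1)] by (auto simp: induced_edges_def)
      then show ?thesis by (auto simp: W_def)
    next
      case False
      then obtain w where w: "W \<subseteq> {w}" by (auto simp: W_def edge_def)
      show ?thesis
      proof (cases "W = {}")
        case True
        then show ?thesis using fg(4) by auto
      next
        case False
        then have "w \<in> set zs" "W = {w}" using w zs by (auto simp: W_def)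
        then obtain y where "{w, y} \<in> cycle_edges zs"
          using cycle_neighbours[of zs w thesis] zs(1) unfolding cycle_in_def by blast
        with \<open>W = {w}\<close> show ?thesis by auto
      qed
    qed
    then obtain e where e: "e \<in> cycle_edges zs" "W \<subseteq> e" by auto
    have nW: "v k \<notin> W" if "k < p" "k \<noteq> fst h" for k
      using that hb v_eq_iff v_neq_u by (auto simp: W_def edge_def)
    have nW': "u k \<notin> W" if "k < q" "k \<noteq> snd h" for k
      using that hb u_eq_iff v_neq_u by (force simp: W_def edge_def)
    have A: "A \<noteq> {}"
    proof (cases "fst f < fst h")
      case True
      then have "v (fst f) \<notin> W" using nW bd by auto
      then have "v (fst f) \<in> A" using fS le(1) unfolding A_def by blast
      then show ?thesis by auto
    next
      case False
      then have "snd f < snd h" using h(2) le by (auto simp: rk_def)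
      then have "u (snd f) \<notin> W" using nW' bd by auto
      then have "u (snd f) \<in> A" using fS le(2) unfolding A_def by blast
      then show ?thesis by auto
    qed
    have vA: "v k \<in> A \<longleftrightarrow> v k \<in> S \<and> k < fst h" if "k < p" for k
    proof -
      have "v k \<noteq> u l" if "l \<le> snd h" for l using v_neq_u \<open>k < p\<close> hb that by auto
      moreover have "v k = v l \<longleftrightarrow> k = l" if "l \<le> fst h" for l using v_eq_iff \<open>k < p\<close> hb that by auto
      moreover have "v (fst h) \<in> S \<Longrightarrow> v (fst h) \<in> W" by (auto simp: W_def edge_def)
      ultimately show ?thesis using nW[OF that] by (auto simp: A_def le_less)
    qed
    have uA: "u k \<in> A \<longleftrightarrow> u k \<in> S \<and> k < snd h" if "k < q" for k
    proof -
      have "u k \<noteq> v l" if "l \<le> fst h" for l using v_neq_u[of l k] \<open>k < q\<close> hb that by auto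
      moreover have "u k = u l \<longleftrightarrow> k = l" if "l \<le> snd h" for l using u_eq_iff \<open>k < q\<close> hb that by auto
      moreover have "u (snd h) \<in> S \<Longrightarrow> u (snd h) \<in> W" by (auto simp: W_def edge_def)
      ultimately show ?thesis using nW'[OF that] by (auto simp: A_def le_less)
    qed
    have vB: "v k \<in> B \<longleftrightarrow> v k \<in> S \<and> fst h < k" if "k < p" for k
      using vA[OF that] nW[OF that] nat_neq_iff[of k "fst h"]
      by (cases "k = fst h") (auto simp: B_def W_def edge_def)
    have uB: "u k \<in> B \<longleftrightarrow> u k \<in> S \<and> snd h < k" if "k < q" for k
      using uA[OF that] nW'[OF that] nat_neq_iff[of k "snd h"]
      by (cases "k = snd h") (auto simp: B_def W_def edge_def)
    have B: "B \<noteq> {}"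
    proof (cases "fst h < fst g")
      case True
      then have "v (fst g) \<in> B" using gS vB bd by auto
      then show ?thesis by auto
    next
      case False
      then have "snd h < snd g" using h(3) le by (auto simp: rk_def)
      then have "u (snd g) \<in> B" using gS uB bd by auto
      then show ?thesis by auto
    qed
    obtain a b where ab: "a \<in> A" "b \<in> B" "{a, b} \<in> cycle_edges zs"
    proof (rule cycle_cut[of zs e W A B])
      show "distinct zs" using zs(1) by (simp add: cycle_in_def)
      show "set zs - W = A \<union> B" using zs(2) by (auto simp: B_def A_def)
    qed (use e A B in \<open>auto simp: B_def\<close>)
    have "{a, b} \<in> E" using ab zs(1) by (auto simp: cycle_in_def)
    then show False
    proof (cases rule: edge_cases)
      case (v l)
      then have "v l \<in> A \<and> v (Suc l) \<in> B \<or> v l \<in> B \<and> v (Suc l) \<in> A"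
        using ab by (auto simp: doubleton_eq_iff)
      then show False using vA[of l] vA[of "Suc l"] vB[of l] vB[of "Suc l"] v by auto
    next
      case (u l)
      then have "u l \<in> A \<and> u (Suc l) \<in> B \<or> u l \<in> B \<and> u (Suc l) \<in> A"
        using ab by (auto simp: doubleton_eq_iff)
      then show False using uA[of l] uA[of "Suc l"] uB[of l] uB[of "Suc l"] u by auto
    next
      case (cross l m)
      then have lm: "l < p" "m < q" by (auto simp: cross_def)
      have "v l \<in> A \<and> u m \<in> B \<or> v l \<in> B \<and> u m \<in> A"
        using ab cross by (auto simp: doubleton_eq_iff)
      \<comment> \<open>A rung between the two parts would cross \<open>h\<close>.\<close>
      then have "l < fst h \<and> snd h < m \<or> fst h < l \<and> m < snd h"
        using vA[OF lm(1)] uA[OF lm(2)] vB[OF lm(1)] uB[OF lm(2)] by auto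
      then show False
        using cross_mono[OF cross(1) h(1)] cross_mono[OF h(1) cross(1)]
        by (cases "rk (l, m) \<le> rk h") auto
    qed
  qed
  have only: "(k, l) = f \<or> (k, l) = g" if "(k, l) \<in> cross" "v k \<in> S" "u l \<in> S" for k l
  proof -
    have "k < p" "l < q" using that by (auto simp: cross_def)
    then have "fst f \<le> k" "k \<le> fst g" "snd f \<le> l" "l \<le> snd g"
      using that fg(6) zs(2) v_in_block_iff[of k g f] u_in_block_iff[of l g f] bd by auto
    then show ?thesis using rk_between[OF fg(1,2) that(1)] cons that(1) by (auto simp: consecutive_def)
  qed
  \<comment> \<open>As \<open>f\<close> and \<open>g\<close> are the only rungs within
    \<open>S\<close>, \<open>cycle_contiguous\<close> applies to either path and shows that no index
    between them is skipped.\<close>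
  have v_all: "v t \<in> S" if t: "fst f \<le> t" "t \<le> fst g" for t
  proof (cases "t = fst f \<or> t = fst g")
    case True
    then show ?thesis using fS gS by auto
  next
    case False
    then have "fst f < t" "t < fst g" using t by auto
    moreover have "(k, l) = (fst f, snd f) \<or> k = fst g"
      if "(k, l) \<in> cross" "v k \<in> set zs" "u l \<in> set zs" for k l
      using only[of k l] that zs(2) by auto
    ultimately show ?thesis
      using cycle_contiguous[of zs "fst f" "snd f" "fst g" t] zs(1,2) fg(1,4) bd gS
      by (auto simp: edge_def)
  qed
  have sw: "(a, b) \<in> ladder.cross E u v q p \<longleftrightarrow> (b, a) \<in> cross" for a b
    by (auto simp: ladder.cross_def[OF swap] cross_def insert_commute)
  have u_all: "u t \<in> S" if t: "snd f \<le> t" "t \<le> snd g" for t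
  proof (cases "t = snd f \<or> t = snd g")
    case True
    then show ?thesis using fS gS by auto
  next
    case False
    then have "snd f < t" "t < snd g" using t by auto
    moreover have "(k, l) = (snd f, fst f) \<or> k = snd g"
      if "(k, l) \<in> ladder.cross E u v q p" "u k \<in> set zs" "v l \<in> set zs" for k l
      using only[of l k] that sw zs(2) by auto
    ultimately show ?thesis
      using ladder.cycle_contiguous[OF swap, of zs "snd f" "fst f" "snd g" t] zs(1,2) fg(1,4) bd gS
      by (auto simp: edge_def sw insert_commute)
  qed
  have "S = block f g" using fg(6) zs(2) v_all u_all by (auto simp: block_def)
  with cons that show thesis by blast
qed

end

section \<open>The straight-line drawing of a ladder\<close>

lemma closed_segment_horizontal:
  assumes "a \<le> b"
  shows "z \<in> closed_segment (Complex a h) (Complex b h) \<longleftrightarrow> Im z = h \<and> a \<le> Re z \<and> Re z \<le> b"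
  using assms by (auto simp: closed_segment_same_Im closed_segment_eq_real_ivl)

lemma closed_segment_strip:
  "z \<in> closed_segment (Complex a 0) (Complex b 1) \<longleftrightarrow>
    0 \<le> Im z \<and> Im z \<le> 1 \<and> Re z = (1 - Im z) * a + Im z * b"
  by (auto simp: in_segment complex_eq_iff)

context ladder
begin

definition line_pos :: "'a \<Rightarrow> complex" where
  "line_pos w = (if w \<in> v ` {..<p} then Complex (real (inv_into {..<p} v w)) 0
    else Complex (real (inv_into {..<q} u w)) 1)"

text \<open>An edge is an unordered pair, so \<open>SOME\<close> picks a direction for the segment;
  its image and its set of ends do not depend on the choice.\<close>

definition line_crv :: "'a set \<Rightarrow> real \<Rightarrow> complex" where
  "line_crv e = (let xy = SOME xy. e = {fst xy, snd xy} in
    linepath (line_pos (fst xy)) (line_pos (snd xy)))"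

lemma line_pos_v: "i < p \<Longrightarrow> line_pos (v i) = Complex (real i) 0"
  using inj_v by (simp add: line_pos_def)

lemma line_pos_u: "j < q \<Longrightarrow> line_pos (u j) = Complex (real j) 1"
proof -
  assume "j < q"
  moreover from this have "u j \<notin> v ` {..<p}" using vu_disjoint by auto
  ultimately show ?thesis using inj_u by (simp add: line_pos_def)
qed

lemma line_crv_linepath:
  obtains x' y' where "{x, y} = {x', y'}" "line_crv {x, y} = linepath (line_pos x') (line_pos y')"
proof -
  define xy where "xy = (SOME xy. {x, y} = {fst xy, snd xy})"
  have "{x, y} = {fst xy, snd xy}"
    unfolding xy_def by (rule someI[of _ "(x, y)"]) simp
  moreover have "line_crv {x, y} = linepath (line_pos (fst xy)) (line_pos (snd xy))"
    unfolding line_crv_def xy_def Let_def ..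
  ultimately show thesis by (rule that)
qed

lemma path_image_line_crv: "path_image (line_crv {x, y}) = closed_segment (line_pos x) (line_pos y)"
proof -
  obtain x' y' where *: "{x, y} = {x', y'}" "line_crv {x, y} = linepath (line_pos x') (line_pos y')"
    by (rule line_crv_linepath)
  then have "x = x' \<and> y = y' \<or> x = y' \<and> y = x'" by (auto simp: doubleton_eq_iff)
  with * show ?thesis by (auto simp: closed_segment_commute)
qed

lemma line_crv_v: "Suc i < p \<Longrightarrow> z \<in> path_image (line_crv {v i, v (Suc i)}) \<longleftrightarrow>
    Im z = 0 \<and> real i \<le> Re z \<and> Re z \<le> real i + 1"
  by (simp add: path_image_line_crv line_pos_v closed_segment_horizontal add.commute)

lemma line_crv_u: "Suc i < q \<Longrightarrow> z \<in> path_image (line_crv {u i, u (Suc i)}) \<longleftrightarrow>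
    Im z = 1 \<and> real i \<le> Re z \<and> Re z \<le> real i + 1"
  by (simp add: path_image_line_crv line_pos_u closed_segment_horizontal add.commute)

lemma line_crv_cross: "(i, j) \<in> cross \<Longrightarrow> z \<in> path_image (line_crv {v i, u j}) \<longleftrightarrow>
    0 \<le> Im z \<and> Im z \<le> 1 \<and> Re z = (1 - Im z) * real i + Im z * real j"
  by (simp add: path_image_line_crv line_pos_v line_pos_u closed_segment_strip cross_def)

lemma inj_line_pos: "inj_on line_pos V"
  by (auto simp: V_eq inj_on_def line_pos_v line_pos_u)

lemma line_crv_endpoints:
  assumes "e \<in> E"
  shows "line_pos ` e \<subseteq> path_image (line_crv e)"
proof -
  obtain x y where "e = {x, y}"
    using assms simple by (auto simp: simple_graph_def card_2_iff)
  then show ?thesis by (auto simp: path_image_line_crv)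
qed

text \<open>At height \<open>s\<close> the abscissae of the two segments differ by a convex
  combination of the nonnegative numbers \<open>x - i\<close> and \<open>y - j\<close>. At a common
  point both terms vanish, and as the rungs differ this happens at a shared end only.\<close>

lemma line_crv_Int_less:
  assumes "(i, j) \<in> cross" "(x, y) \<in> cross" "rk (i, j) \<le> rk (x, y)" "(i, j) \<noteq> (x, y)"
    and z: "z \<in> path_image (line_crv {v i, u j})" "z \<in> path_image (line_crv {v x, u y})"
  shows "z \<in> line_pos ` ({v i, u j} \<inter> {v x, u y})"
proof -
  have le: "i \<le> x" "j \<le> y" using cross_mono[OF assms(1-3)] by auto
  define s where "s = Im z"
  have s: "0 \<le> s" "s \<le> 1" "Re z = (1 - s) * real i + s * real j"
    "Re z = (1 - s) * real x + s * real y"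
    using z assms by (auto simp: line_crv_cross s_def)
  then have "(1 - s) * (real x - real i) + s * (real y - real j) = 0" by (simp add: algebra_simps)
  moreover have "0 \<le> (1 - s) * (real x - real i)" "0 \<le> s * (real y - real j)"
    using s le by auto
  ultimately have "(1 - s) * (real x - real i) = 0" "s * (real y - real j) = 0" by linarith+
  then have "s = 1 \<or> x = i" "s = 0 \<or> y = j" by auto
  then consider "s = 1" "y = j" | "s = 0" "x = i" using assms(4) by auto
  then show ?thesis
  proof cases
    case 1
    then have "z = line_pos (u j)"
      using s assms by (auto simp: line_pos_u cross_def complex_eq_iff s_def)
    with 1 show ?thesis by auto
  next
    case 2
    then have "z = line_pos (v i)"
      using s assms by (auto simp: line_pos_v cross_def complex_eq_iff s_def)
    with 2 show ?thesis by auto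
  qed
qed

lemma line_crv_Int:
  assumes "e \<in> E" "f \<in> E" "e \<noteq> f" and z: "z \<in> path_image (line_crv e)" "z \<in> path_image (line_crv f)"
  shows "z \<in> line_pos ` (e \<inter> f)"
proof -
  have vv: "z \<in> line_pos ` ({v i, v (Suc i)} \<inter> {v j, v (Suc j)})"
    if "i < j" "Suc j < p" "z \<in> path_image (line_crv {v i, v (Suc i)})"
      "z \<in> path_image (line_crv {v j, v (Suc j)})" for i j
  proof -
    from that have "Im z = 0" "Re z \<le> real i + 1" "real j \<le> Re z" by (auto simp: line_crv_v)
    moreover from that this have "j = Suc i" by auto
    ultimately show ?thesis using that by (auto simp: line_pos_v complex_eq_iff intro!: image_eqI[of _ _ "v j"])
  qed
  have uu: "z \<in> line_pos ` ({u i, u (Suc i)} \<inter> {u j, u (Suc j)})"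
    if "i < j" "Suc j < q" "z \<in> path_image (line_crv {u i, u (Suc i)})"
      "z \<in> path_image (line_crv {u j, u (Suc j)})" for i j
  proof -
    from that have "Im z = 1" "Re z \<le> real i + 1" "real j \<le> Re z" by (auto simp: line_crv_u)
    moreover from that this have "j = Suc i" by auto
    ultimately show ?thesis using that by (auto simp: line_pos_u complex_eq_iff intro!: image_eqI[of _ _ "u j"])
  qed
  have vc: "z \<in> line_pos ` ({v k, v (Suc k)} \<inter> {v i, u j})"
    if "Suc k < p" "(i, j) \<in> cross" "z \<in> path_image (line_crv {v k, v (Suc k)})"
      "z \<in> path_image (line_crv {v i, u j})" for i j k
  proof -
    from that have "Im z = 0" "real k \<le> Re z" "Re z \<le> real k + 1" "Re z = real i"
      by (auto simp: line_crv_v line_crv_cross)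
    moreover from this have "i = k \<or> i = Suc k" by auto
    ultimately show ?thesis
      using that by (auto simp: line_pos_v complex_eq_iff cross_def intro!: image_eqI[of _ _ "v i"])
  qed
  have uc: "z \<in> line_pos ` ({u k, u (Suc k)} \<inter> {v i, u j})"
    if "Suc k < q" "(i, j) \<in> cross" "z \<in> path_image (line_crv {u k, u (Suc k)})"
      "z \<in> path_image (line_crv {v i, u j})" for i j k
  proof -
    from that have "Im z = 1" "real k \<le> Re z" "Re z \<le> real k + 1" "Re z = real j"
      by (auto simp: line_crv_u line_crv_cross)
    moreover from this have "j = k \<or> j = Suc k" by auto
    ultimately show ?thesis
      using that by (auto simp: line_pos_u complex_eq_iff cross_def intro!: image_eqI[of _ _ "u j"])
  qed
  show ?thesis
    using assms(1)
  proof (cases rule: edge_cases)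
    case e: (v i)
    show ?thesis
      using assms(2)
    proof (cases rule: edge_cases)
      case f: (v j)
      have "i \<noteq> j" using e f assms(3) by auto
      then consider "i < j" | "j < i" by linarith
      then show ?thesis
        using vv[of i j] vv[of j i] e f z by cases (simp_all add: Int_commute)
    next
      case f: (u j)
      then show ?thesis using e z by (simp add: line_crv_v line_crv_u)
    next
      case f: (cross x y)
      then show ?thesis using e z vc[of i x y] by simp
    qed
  next
    case e: (u i)
    show ?thesis
      using assms(2)
    proof (cases rule: edge_cases)
      case f: (v j)
      then show ?thesis using e z by (simp add: line_crv_v line_crv_u)
    next
      case f: (u j)
      have "i \<noteq> j" using e f assms(3) by auto
      then consider "i < j" | "j < i" by linarith
      then show ?thesis
        using uu[of i j] uu[of j i] e f z by cases (simp_all add: Int_commute)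
    next
      case f: (cross x y)
      then show ?thesis using e z uc[of i x y] by simp
    qed
  next
    case e: (cross i j)
    show ?thesis
      using assms(2)
    proof (cases rule: edge_cases)
      case f: (v k)
      then show ?thesis using e z vc[of k i j] by (simp add: Int_commute)
    next
      case f: (u k)
      then show ?thesis using e z uc[of k i j] by (simp add: Int_commute)
    next
      case f: (cross x y)
      then show ?thesis
        using e z assms(3) line_crv_Int_less[of i j x y] line_crv_Int_less[of x y i j]
        by (cases "rk (i, j) \<le> rk (x, y)") (auto simp: Int_commute)
    qed
  qed
qed

lemma line_crv_Int_pos:
  assumes "e \<in> E" "w \<in> V" "line_pos w \<in> path_image (line_crv e)"
  shows "w \<in> e"
proof -
  from assms(2) consider m where "m < p" "w = v m" | m where "m < q" "w = u m" by (auto simp: V_eq)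
  then show ?thesis
  proof cases
    case 1
    show ?thesis
      using assms(1)
    proof (cases rule: edge_cases)
      case (v i)
      then have "m = i \<or> m = Suc i" using 1 assms(3) by (auto simp: line_crv_v line_pos_v)
      then show ?thesis using 1 v by auto
    next
      case (u i)
      then show ?thesis using 1 assms(3) by (auto simp: line_crv_u line_pos_v)
    next
      case (cross i j)
      then have "m = i" using 1 assms(3) by (auto simp: line_crv_cross line_pos_v)
      then show ?thesis using 1 cross by auto
    qed
  next
    case 2
    show ?thesis
      using assms(1)
    proof (cases rule: edge_cases)
      case (u i)
      then have "m = i \<or> m = Suc i" using 2 assms(3) by (auto simp: line_crv_u line_pos_u)
      then show ?thesis using 2 u by auto
    next
      case (v i)
      then show ?thesis using 2 assms(3) by (auto simp: line_crv_v line_pos_u)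
    next
      case (cross i j)
      then have "m = j" using 2 assms(3) by (auto simp: line_crv_cross line_pos_u)
      then show ?thesis using 2 cross by auto
    qed
  qed
qed

lemma planar_embedding_line: "planar_embedding V E line_pos line_crv"
proof -
  have "arc (line_crv e) \<and> {pathstart (line_crv e), pathfinish (line_crv e)} = line_pos ` e"
    if e: "e \<in> E" for e
  proof -
    obtain x y where xy: "e = {x, y}" "x \<noteq> y" "x \<in> V" "y \<in> V"
      using e simple by (auto simp: simple_graph_def card_2_iff)
    obtain x' y' where *: "{x, y} = {x', y'}" "line_crv {x, y} = linepath (line_pos x') (line_pos y')"
      by (rule line_crv_linepath)
    then have "x' \<noteq> y'" "x' \<in> V" "y' \<in> V" using xy by (auto simp: doubleton_eq_iff)
    then have "line_pos x' \<noteq> line_pos y'" using inj_line_pos by (auto simp: inj_on_eq_iff)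
    then have "arc (line_crv e)" using * xy by (simp add: arc_linepath)
    moreover have "line_pos ` e = line_pos ` {x', y'}" using xy * by simp
    ultimately show ?thesis using * xy by simp
  qed
  moreover have "path_image (line_crv e) \<inter> line_pos ` V = line_pos ` e" if "e \<in> E" for e
  proof -
    have "e \<subseteq> V" using that simple by (auto simp: simple_graph_def)
    then show ?thesis using line_crv_endpoints[OF that] line_crv_Int_pos[OF that] by auto
  qed
  moreover have "path_image (line_crv e) \<inter> path_image (line_crv f) = line_pos ` (e \<inter> f)"
    if "e \<in> E" "f \<in> E" "e \<noteq> f" for e f
    using line_crv_endpoints[OF that(1)] line_crv_endpoints[OF that(2)] line_crv_Int[OF that] by auto
  ultimately show ?thesis
    using inj_line_pos by (auto simp: planar_embedding_def)
qed

text \<open>The complement of a convex set that contains the drawing lies in the unbounded face.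
  Applied to two closed half-planes, this gives the regions above and below the strip, and every
  vertex is on the border of one of them.\<close>

lemma outerplanar: "outerplanar V E"
proof -
  let ?D = "drawing V E line_pos line_crv"
  have strip: "0 \<le> Im z \<and> Im z \<le> 1" if z: "z \<in> ?D" for z
  proof -
    from z consider w where "w \<in> V" "z = line_pos w" | e where "e \<in> E" "z \<in> path_image (line_crv e)"
      by (auto simp: drawing_def)
    then show ?thesis
    proof cases
      case 1
      then show ?thesis by (auto simp: V_eq line_pos_v line_pos_u)
    next
      case 2
      from 2(1) show ?thesis
        by (cases rule: edge_cases) (use 2 in \<open>auto simp: line_crv_v line_crv_u line_crv_cross\<close>)
    qed
  qed
  have below: "{z. Im z < 0} \<subseteq> outside ?D"
  proof -
    have "- {z. 0 \<le> Im z} \<subseteq> outside ?D"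
      by (rule outside_subset_convex) (use strip convex_halfspace_Im_ge[of 0] in auto)
    then show ?thesis by (auto simp: not_le)
  qed
  have above: "{z. 1 < Im z} \<subseteq> outside ?D"
  proof -
    have "- {z. Im z \<le> 1} \<subseteq> outside ?D"
      by (rule outside_subset_convex) (use strip convex_halfspace_Im_le[of 1] in auto)
    then show ?thesis by (auto simp: not_le)
  qed
  have "line_pos w \<in> frontier (outside ?D)" if w: "w \<in> V" for w
  proof -
    have "line_pos w \<notin> outside ?D"
      using w outside_no_overlap[of ?D] unfolding drawing_def by blast
    moreover have "w \<in> v ` {..<p} \<union> u ` {..<q}" using w V_eq by blast
    then have "line_pos w \<in> closure (outside ?D)"
    proof
      assume "w \<in> v ` {..<p}"
      then have "Im (line_pos w) \<le> 0" by (auto simp: line_pos_v)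
      moreover have "closure {z. Im z < 0} = {z. Im z \<le> 0}"
        using closure_halfspace_lt[of \<i> 0] by (simp add: inner_complex_def)
      ultimately show ?thesis using closure_mono[OF below] by auto
    next
      assume "w \<in> u ` {..<q}"
      then have "Im (line_pos w) \<ge> 1" by (auto simp: line_pos_u)
      moreover have "closure {z. 1 < Im z} = {z. 1 \<le> Im z}"
        using closure_halfspace_gt[of \<i> 1] by (simp add: inner_complex_def)
      ultimately show ?thesis using closure_mono[OF above] by auto
    qed
    ultimately show ?thesis using interior_subset by (auto simp: frontier_def)
  qed
  then show ?thesis
    using planar_embedding_line
    unfolding outerplanar_def outerplanar_embedding_def unbounded_face_def by blast
qed

end

section \<open>Graphs of two parallel paths satisfy the conditions\<close>

text \<open>All Hamiltonian cycles of \<open>R\<close> have \<open>card R\<close> edges. If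
  \<open>F\<close> is the edge set of one, then \<open>cycle_edges cs\<close> is a subset of
  \<open>F\<close> of the same size. So the outer-cycle at hand decides whether the core is a
  cycle.\<close>

lemma is_cycle_graph_iff:
  assumes "finite F" "hamiltonian_cycle R F cs"
  shows "is_cycle_graph R F \<longleftrightarrow> F = cycle_edges cs"
proof
  assume "is_cycle_graph R F"
  then obtain xs where xs: "hamiltonian_cycle R F xs" "F = cycle_edges xs"
    by (auto simp: is_cycle_graph_def)
  have "card F = card R"
    using xs by (auto simp: hamiltonian_cycle_def cycle_in_def card_cycle_edges distinct_card)
  moreover have "card (cycle_edges cs) = card R" "cycle_edges cs \<subseteq> F"
    using assms by (auto simp: hamiltonian_cycle_def cycle_in_def card_cycle_edges distinct_card)
  ultimately show "F = cycle_edges cs" using assms(1) by (metis card_subset_eq)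
qed (use assms in \<open>auto simp: is_cycle_graph_def\<close>)

lemma (in outerplane_graph) outer_cycleI:
  assumes "hamiltonian_cycle (core V E pos crv) (induced_edges E (core V E pos crv)) cs"
  shows "outer_cycle V E pos crv cs"
proof -
  have "core V E pos crv \<subseteq> V" by (auto simp: core_def)
  then show ?thesis
    using assms frontier_unbounded_face_hamiltonian[OF assms]
    by (simp add: outer_cycle_def Let_def)
qed

lemma disjoint_union_of_paths_list:
  assumes "\<And>t. t \<in> set L \<Longrightarrow> distinct (fst t)"
    and sorted: "sorted_wrt (\<lambda>s t. set (fst s) \<inter> set (fst t) = {}) L"
    and "W = (\<Union>t\<in>set L. set (fst t))" "F = (\<Union>t\<in>set L. path_edges (fst t))"
  shows "disjoint_union_of_paths W F (length L) (\<lambda>i. fst (L ! i))"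
proof -
  have "set (fst (L ! i)) \<inter> set (fst (L ! j)) = {}"
    if ij: "i < length L" "j < length L" "i \<noteq> j" for i j
  proof -
    consider "i < j" | "j < i" using ij by linarith
    then show ?thesis
      using sorted_wrt_nth_less[OF sorted] ij by cases blast+
  qed
  moreover have un: "(\<Union>i<length L. f (fst (L ! i))) = (\<Union>t\<in>set L. f (fst t))" for f :: "'a list \<Rightarrow> 'e set"
    by (auto simp: set_conv_nth)
  moreover have "distinct (fst (L ! i))" if "i < length L" for i
    using assms(1) nth_mem[OF that] by simp
  ultimately show ?thesis
    using assms(3,4) un[of set] un[of path_edges] by (simp add: disjoint_union_of_paths_def)
qed

text \<open>Empty paths contribute neither vertices nor edges. \<open>alpha_graph\<close> admits
  them and \<open>pendant_paths\<close> does not; dropping them lets both be derived from the same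
  list.\<close>

lemma disjoint_union_of_paths_filter:
  assumes "\<And>t. t \<in> set L \<Longrightarrow> distinct (fst t)"
    and "sorted_wrt (\<lambda>s t. set (fst s) \<inter> set (fst t) = {}) L"
    and "W = (\<Union>t\<in>set L. set (fst t))" "F = (\<Union>t\<in>set L. path_edges (fst t))"
    and L': "L' = filter (\<lambda>t. fst t \<noteq> []) L"
  shows "disjoint_union_of_paths W F (length L') (\<lambda>i. fst (L' ! i))"
proof (rule disjoint_union_of_paths_list)
  have filt: "(\<Union>t\<in>set L'. f (fst t)) = (\<Union>t\<in>set L. f (fst t))" if "f [] = {}"
    for f :: "'a list \<Rightarrow> 'e set"
    using that by (force simp: L')
  show "W = (\<Union>t\<in>set L'. set (fst t))" "F = (\<Union>t\<in>set L'. path_edges (fst t))"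
    using filt[of set] filt[of path_edges] assms(3,4) by simp_all
qed (use assms(1,2) in \<open>auto simp: L' sorted_wrt_filter\<close>)

section \<open>The small graphs of condition (ii)\<close>

lemma graph_P_3: "graph_P 3 = ({0, 1, 2}, {{0, 1}, {1, 2}})"
  and graph_P_4: "graph_P 4 = ({0, 1, 2, 3}, {{0, 1}, {1, 2}, {2, 3}})"
  and graph_C_3: "graph_C 3 = ({0, 1, 2}, {{0, 1}, {1, 2}, {0, 2}})"
  and graph_C_4: "graph_C 4 = ({0, 1, 2, 3}, {{0, 1}, {1, 2}, {2, 3}, {0, 3}})"
proof -
  have l: "[0..<3] = [0, 1, 2::nat]" "[0..<4] = [0, 1, 2, 3::nat]" by (simp_all add: upt_rec)
  have s: "{0..<3} = {0, 1, 2::nat}" "{0..<4} = {0, 1, 2, 3::nat}" by auto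
  show "graph_P 3 = ({0, 1, 2}, {{0, 1}, {1, 2}})"
    "graph_P 4 = ({0, 1, 2, 3}, {{0, 1}, {1, 2}, {2, 3}})"
    "graph_C 3 = ({0, 1, 2}, {{0, 1}, {1, 2}, {0, 2}})"
    "graph_C 4 = ({0, 1, 2, 3}, {{0, 1}, {1, 2}, {2, 3}, {0, 3}})"
    unfolding graph_P_def graph_C_def l s by (simp_all add: cycle_edges_conv insert_commute)
qed

text \<open>One edge is given, so the other two pairs leave four possibilities. The numbering
  \<open>f\<close> suits all of them but the path with middle vertex \<open>x\<close>, for which
  \<open>g\<close> is used.\<close>

lemma graph_iso_three:
  assumes d: "x \<noteq> y" "x \<noteq> z" "y \<noteq> z" and F: "{x, y} \<in> F"
    and sub: "F \<subseteq> {{x, y}, {y, z}, {x, z}}" and Y: "Y = {x, y, z}"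
  shows "\<exists>H\<in>{graph_K2_K1, graph_P 3, graph_C 3}. graph_iso (Y, F) H"
proof -
  define f :: "'a \<Rightarrow> nat" where "f = (\<lambda>t. if t = x then 0 else if t = y then 1 else 2)"
  define g :: "'a \<Rightarrow> nat" where "g = (\<lambda>t. if t = y then 0 else if t = x then 1 else 2)"
  have bij: "bij_betw f Y {0, 1, 2}" "bij_betw g Y {0, 1, 2}"
    using d by (auto simp: bij_betw_def inj_on_def f_def g_def Y)
  have im: "f ` {x, y} = {0, 1}" "f ` {y, z} = {1, 2}" "f ` {x, z} = {0, 2}"
    "g ` {x, y} = {0, 1}" "g ` {y, z} = {0, 2}" "g ` {x, z} = {1, 2}"
    using d by (auto simp: f_def g_def)
  consider "F = {{x, y}}" | "F = {{x, y}, {y, z}}" | "F = {{x, y}, {x, z}}"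
    | "F = {{x, y}, {y, z}, {x, z}}"
  proof -
    define X where "X = F \<inter> {{y, z}, {x, z}}"
    have FX: "F = insert {x, y} X" using F sub unfolding X_def by blast
    consider "X = {}" | "X = {{y, z}}" | "X = {{x, z}}" | "X = {{y, z}, {x, z}}"
      unfolding X_def by blast
    then show thesis using that unfolding FX by cases simp_all
  qed
  then show ?thesis
  proof cases
    case 1
    then have "graph_iso (Y, F) graph_K2_K1"
      unfolding graph_iso_def graph_K2_K1_def using bij im by (intro exI[of _ f]) simp
    then show ?thesis by blast
  next
    case 2
    then have "graph_iso (Y, F) (graph_P 3)"
      unfolding graph_iso_def graph_P_3 using bij im by (intro exI[of _ f]) simp
    then show ?thesis by blast
  next
    case 3
    then have "graph_iso (Y, F) (graph_P 3)"
      unfolding graph_iso_def graph_P_3 using bij im by (intro exI[of _ g]) simp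
    then show ?thesis by blast
  next
    case 4
    then have "graph_iso (Y, F) (graph_C 3)"
      unfolding graph_iso_def graph_C_3 using bij im
      by (intro exI[of _ f]) simp
    then show ?thesis by blast
  qed
qed

lemma graph_iso_four:
  assumes d: "distinct [x, y, z, w]" and F: "{x, y} \<in> F" "{z, w} \<in> F"
    and sub: "F \<subseteq> {{x, y}, {z, w}, {x, z}, {y, w}}" and Y: "Y = {x, y, z, w}"
  shows "\<exists>H\<in>{graph_2K2, graph_P 4, graph_C 4}. graph_iso (Y, F) H"
proof -
  define f :: "'a \<Rightarrow> nat" where
    "f = (\<lambda>t. if t = x then 0 else if t = y then 1 else if t = w then 2 else 3)"
  define g :: "'a \<Rightarrow> nat" where
    "g = (\<lambda>t. if t = y then 0 else if t = x then 1 else if t = z then 2 else 3)"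
  have bij: "bij_betw f Y {0, 1, 2, 3}" "bij_betw g Y {0, 1, 2, 3}"
    using d by (auto simp: bij_betw_def inj_on_def f_def g_def Y)
  have im: "f ` {x, y} = {0, 1}" "f ` {y, w} = {1, 2}" "f ` {z, w} = {2, 3}" "f ` {x, z} = {0, 3}"
    "g ` {x, y} = {0, 1}" "g ` {x, z} = {1, 2}" "g ` {z, w} = {2, 3}"
    using d by (auto simp: f_def g_def)
  consider "F = {{x, y}, {z, w}}" | "F = {{x, y}, {z, w}, {x, z}}" | "F = {{x, y}, {z, w}, {y, w}}"
    | "F = {{x, y}, {z, w}, {x, z}, {y, w}}"
  proof -
    define X where "X = F \<inter> {{x, z}, {y, w}}"
    have FX: "F = insert {x, y} (insert {z, w} X)" using F sub unfolding X_def by blast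
    consider "X = {}" | "X = {{x, z}}" | "X = {{y, w}}" | "X = {{x, z}, {y, w}}"
      unfolding X_def by blast
    then show thesis using that unfolding FX by cases simp_all
  qed
  then show ?thesis
  proof cases
    case 1
    then have "graph_iso (Y, F) graph_2K2"
      unfolding graph_iso_def graph_2K2_def using bij im by (intro exI[of _ f]) simp
    then show ?thesis by blast
  next
    case 2
    then have "graph_iso (Y, F) (graph_P 4)"
      unfolding graph_iso_def graph_P_4 using bij im
      by (intro exI[of _ g]) (simp add: insert_commute)
    then show ?thesis by blast
  next
    case 3
    then have "graph_iso (Y, F) (graph_P 4)"
      unfolding graph_iso_def graph_P_4 using bij im
      by (intro exI[of _ f]) (simp add: insert_commute)
    then show ?thesis by blast
  next
    case 4
    then have "graph_iso (Y, F) (graph_C 4)"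
      unfolding graph_iso_def graph_C_4 using bij im
      by (intro exI[of _ f]) (simp add: insert_commute)
    then show ?thesis by blast
  qed
qed

section \<open>First and last rung, and the end cycles\<close>

context ladder
begin

definition spans :: "nat \<times> nat \<Rightarrow> nat \<times> nat \<Rightarrow> bool" where
  "spans s t \<longleftrightarrow> s \<in> cross \<and> t \<in> cross \<and> rk s < rk t \<and> (\<forall>h\<in>cross. rk s \<le> rk h \<and> rk h \<le> rk t)"

lemma finite_max_rk:
  assumes "F \<subseteq> cross" "F \<noteq> {}"
  obtains g where "g \<in> F" "\<forall>h\<in>F. rk h \<le> rk g"
proof -
  have fin: "finite F" using assms finite_cross finite_subset by blast
  then have "Max (rk ` F) \<in> rk ` F" using assms by simp
  then obtain g where g: "g \<in> F" "Max (rk ` F) = rk g" by blast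
  then have "\<forall>h\<in>F. rk h \<le> rk g" using fin by (metis Max_ge finite_imageI imageI)
  with g that show thesis by blast
qed

lemma finite_min_rk:
  assumes "F \<subseteq> cross" "F \<noteq> {}"
  obtains g where "g \<in> F" "\<forall>h\<in>F. rk g \<le> rk h"
proof -
  have fin: "finite F" using assms finite_cross finite_subset by blast
  then have "Min (rk ` F) \<in> rk ` F" using assms by simp
  then obtain g where g: "g \<in> F" "Min (rk ` F) = rk g" by blast
  then have "\<forall>h\<in>F. rk g \<le> rk h" using fin by (metis Min_le finite_imageI imageI)
  with g that show thesis by blast
qed

lemma spans_exists:
  assumes "cycle_in V E zs"
  obtains s t where "spans s t"
proof -
  obtain f g where fg: "f \<in> cross" "g \<in> cross" "rk f < rk g"
    by (rule cycle_in_block[OF assms])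
  obtain s where s: "s \<in> cross" "\<forall>h\<in>cross. rk s \<le> rk h"
    by (rule finite_min_rk[of cross]) (use fg in blast)+
  obtain t where t: "t \<in> cross" "\<forall>h\<in>cross. rk h \<le> rk t"
    by (rule finite_max_rk[of cross]) (use fg in blast)+
  have "rk s < rk t" using s(2) t(2) fg by (metis le_less_trans less_le_trans)
  with s t that show thesis unfolding spans_def by blast
qed

lemma next_rung:
  assumes "f \<in> cross" "g \<in> cross" "rk f < rk g"
  obtains h where "consecutive f h" "rk h \<le> rk g"
proof -
  obtain h where h: "h \<in> {h \<in> cross. rk f < rk h}" "\<forall>k\<in>{h \<in> cross. rk f < rk h}. rk h \<le> rk k"
    by (rule finite_min_rk[of "{h \<in> cross. rk f < rk h}"]) (use assms in blast)+
  then have *: "rk h \<le> rk k" if "k \<in> cross" "rk f < rk k" for k using that by blast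
  have "consecutive f h" using assms h(1) * leD unfolding consecutive_def by blast
  moreover have "rk h \<le> rk g" using * assms by blast
  ultimately show thesis by (rule that)
qed

lemma previous_rung:
  assumes "f \<in> cross" "g \<in> cross" "rk f < rk g"
  obtains h where "consecutive h g" "rk f \<le> rk h"
proof -
  obtain h where h: "h \<in> {h \<in> cross. rk h < rk g}" "\<forall>k\<in>{h \<in> cross. rk h < rk g}. rk k \<le> rk h"
    by (rule finite_max_rk[of "{h \<in> cross. rk h < rk g}"]) (use assms in blast)+
  then have *: "rk k \<le> rk h" if "k \<in> cross" "rk k < rk g" for k using that by blast
  have "consecutive h g" using assms h(1) * leD unfolding consecutive_def by blast
  moreover have "rk f \<le> rk h" using * assms by blast
  ultimately show thesis by (rule that)
qed

text \<open>A discrete intermediate value principle: \<open>f\<close> is the last rung other than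
  \<open>t\<close> with property \<open>Q\<close>, and \<open>g\<close> is the rung after
  it.\<close>

lemma consecutive_crossing:
  assumes st: "spans s t" and Q: "Q s"
  obtains f g where "consecutive f g" "Q f" "g = t \<or> \<not> Q g"
proof -
  have st': "s \<in> cross" "t \<in> cross" "rk s < rk t" "\<forall>h\<in>cross. rk h \<le> rk t"
    using st by (auto simp: spans_def)
  let ?F = "{h \<in> cross. Q h \<and> h \<noteq> t}"
  obtain f where f: "f \<in> ?F" "\<forall>h\<in>?F. rk h \<le> rk f"
    by (rule finite_max_rk[of ?F]) (use st' Q in blast)+
  then have "rk f < rk t" using st' rk_eq_iff[of f t] by (auto simp: less_le)
  then obtain g where g: "consecutive f g" using next_rung[of f t] f st' by blast
  have "g = t \<or> \<not> Q g"
  proof (rule ccontr)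
    assume "\<not> (g = t \<or> \<not> Q g)"
    then have "rk g \<le> rk f" using f g unfolding consecutive_def by blast
    then show False using g by (simp add: consecutive_def)
  qed
  with f g that show thesis by blast
qed

text \<open>The chain of rungs is cut where the index on the path of \<open>w\<close> passes that of
  \<open>w\<close>.\<close>

lemma block_covered:
  assumes st: "spans s t" and w: "w \<in> block s t"
  obtains f g where "consecutive f g" "w \<in> block f g"
proof -
  from w consider k where "fst s \<le> k" "k \<le> fst t" "w = v k" | k where "snd s \<le> k" "k \<le> snd t" "w = u k"
    by (auto simp: block_def)
  then show thesis
  proof cases
    case 1
    obtain f g where fg: "consecutive f g" "fst f \<le> k" "g = t \<or> \<not> fst g \<le> k"
      by (rule consecutive_crossing[OF st, of "\<lambda>h. fst h \<le> k"]) (use 1 in auto)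
    then have "w \<in> block f g" using 1 by (auto simp: block_def)
    with fg that show thesis by blast
  next
    case 2
    obtain f g where fg: "consecutive f g" "snd f \<le> k" "g = t \<or> \<not> snd g \<le> k"
      by (rule consecutive_crossing[OF st, of "\<lambda>h. snd h \<le> k"]) (use 2 in auto)
    then have "w \<in> block f g" using 2 by (auto simp: block_def)
    with fg that show thesis by blast
  qed
qed

lemma hamiltonian_block_list:
  assumes "f \<in> cross" "g \<in> cross" "rk f < rk g"
  shows "hamiltonian_cycle (block f g) (induced_edges E (block f g)) (block_list f g)"
  using cycle_in_block_list[OF assms] cycle_edges_subset[of _ "block_list f g"] set_block_list[of f g]
  by (auto simp: hamiltonian_cycle_def cycle_in_def induced_edges_def)

lemma interior_edges_block_list:
  assumes "f \<in> cross" "g \<in> cross" "rk f < rk g"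
  shows "interior_edges E (block_list f g) = edge ` {h \<in> cross. rk f < rk h \<and> rk h < rk g}"
proof -
  have "edge h \<notin> cycle_edges (block_list f g)" if "h \<in> cross" "rk f < rk h" "rk h < rk g" for h
    using edge_not_in_cycle_edges_block_list[OF assms that(1)] that by blast
  then show ?thesis
    unfolding interior_edges_def set_block_list induced_edges_block[OF assms] by blast
qed

lemma inj_edge: "inj_on edge cross"
  using edge_eq_iff by (auto simp: inj_on_def)

text \<open>The interior edges are the rungs other than \<open>s\<close> and \<open>t\<close>, and a
  block between consecutive rungs contains no rung but these two.\<close>

lemma num_interior_block:
  assumes st: "spans s t" and fg: "consecutive f g"
  shows "num_interior E (block_list s t) (block f g) = card ({f, g} - {s, t})"
proof -
  have st': "s \<in> cross" "t \<in> cross" "rk s < rk t" "\<forall>h\<in>cross. rk s \<le> rk h \<and> rk h \<le> rk t"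
    using st by (auto simp: spans_def)
  have fg': "f \<in> cross" "g \<in> cross" "rk f < rk g" using fg by (auto simp: consecutive_def)
  have "interior_edges E (block_list s t) \<inter> induced_edges E (block f g) = edge ` ({f, g} - {s, t})"
  proof -
    have mid: "{h \<in> cross. rk s < rk h \<and> rk h < rk t} = cross - {s, t}"
    proof -
      have "rk s < rk h \<and> rk h < rk t \<longleftrightarrow> h \<noteq> s \<and> h \<noteq> t" if "h \<in> cross" for h
        using st' that rk_eq_iff[of s h] rk_eq_iff[of h t] by (auto simp: less_le)
      then show ?thesis by blast
    qed
    have "edge h \<in> induced_edges E (block f g) \<longleftrightarrow> h = f \<or> h = g" if h: "h \<in> cross" for h
      using edge_not_in_cycle_edges_block_list[OF fg' h] cycle_edges_block_list[OF fg']
      unfolding induced_edges_consecutive[OF fg] by blast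
    then show ?thesis
      unfolding interior_edges_block_list[OF st'(1-3)] mid using fg' by auto
  qed
  moreover have "inj_on edge ({f, g} - {s, t})"
    by (rule inj_on_subset[OF inj_edge]) (use fg' in auto)
  ultimately show ?thesis by (simp add: num_interior_def card_image)
qed

lemma num_interior_le_2:
  assumes "spans s t" "induced_cycle V E S"
  shows "num_interior E (block_list s t) S \<le> 2"
proof -
  obtain f g where fg: "consecutive f g" "S = block f g"
    by (rule induced_cycle_is_block[OF assms(2)])
  have "card ({f, g} - {s, t}) \<le> card {f, g}" by (rule card_mono) auto
  also have "\<dots> \<le> 2" by (simp add: card_insert_if)
  finally show ?thesis using num_interior_block[OF assms(1) fg(1)] fg by simp
qed

text \<open>An induced cycle between consecutive rungs has one interior edge iff exactly one of its
  rungs is \<open>s\<close> or \<open>t\<close>. The third rung \<open>h\<close> keeps the cycle at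
  \<open>s\<close> apart from the one at \<open>t\<close>.\<close>

lemma end_cycles_block_list:
  assumes st: "spans s t" and h: "h \<in> cross" "h \<noteq> s" "h \<noteq> t"
  obtains s' t' where "consecutive s s'" "consecutive t' t" "block s s' \<noteq> block t' t"
    "end_cycles V E (block_list s t) = {block s s', block t' t}"
proof -
  have st': "s \<in> cross" "t \<in> cross" "rk s < rk t" "\<forall>h\<in>cross. rk s \<le> rk h \<and> rk h \<le> rk t"
    using st by (auto simp: spans_def)
  then have h': "rk s < rk h" "rk h < rk t" using h rk_eq_iff by (auto simp: less_le)
  obtain s' where s': "consecutive s s'" "rk s' \<le> rk h" using next_rung[OF st'(1) h(1) h'(1)] .
  obtain t' where t': "consecutive t' t" "rk h \<le> rk t'" using previous_rung[OF h(1) st'(2) h'(2)] .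
  have ne: "s' \<noteq> t" "s' \<noteq> s" "t' \<noteq> s" "t' \<noteq> t" using s' t' h' by (auto simp: consecutive_def)
  \<comment> \<open>Equality would put the ends of \<open>t\<close> into the first block, so
    \<open>t\<close> would have at most the rank of \<open>s'\<close>; but \<open>s'\<close> comes
    no later than \<open>h\<close>, and \<open>h\<close> precedes \<open>t\<close>.\<close>
  have "block s s' \<noteq> block t' t"
  proof
    assume eq: "block s s' = block t' t"
    have ts: "fst t < p" "snd t < q" "fst s' < p" "snd s' < q"
      using st' s' crossD by (auto simp: consecutive_def)
    have "v (fst t) \<in> block t' t" "u (snd t) \<in> block t' t"
      using t' cross_mono[of t' t] by (auto simp: consecutive_def block_def)
    then have "fst t \<le> fst s'" "snd t \<le> snd s'"
      using v_in_block_iff[of "fst t" s' s] u_in_block_iff[of "snd t" s' s] ts eq by auto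
    then have "rk t \<le> rk s'" by (simp add: rk_def)
    then show False using s' h' by simp
  qed
  moreover have "end_cycles V E (block_list s t) = {block s s', block t' t}"
  proof
    show "{block s s', block t' t} \<subseteq> end_cycles V E (block_list s t)"
      using s'(1) t'(1) ne induced_cycle_block num_interior_block[OF st]
      by (auto simp: end_cycles_def insert_Diff_if)
    show "end_cycles V E (block_list s t) \<subseteq> {block s s', block t' t}"
    proof
      fix S assume "S \<in> end_cycles V E (block_list s t)"
      then have S: "induced_cycle V E S" "num_interior E (block_list s t) S = 1"
        by (auto simp: end_cycles_def)
      obtain f g where fg: "consecutive f g" "S = block f g"
        by (rule induced_cycle_is_block[OF S(1)])
      have fg': "f \<in> cross" "g \<in> cross" "rk f < rk g" using fg by (auto simp: consecutive_def)
      have "card ({f, g} - {s, t}) = 1" using num_interior_block[OF st fg(1)] fg S by simp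
      moreover have "f \<noteq> t" "g \<noteq> s" "f \<noteq> g" using fg' st'(4) by auto
      ultimately consider "f = s" | "g = t"
        using fg' by (cases "f = s"; cases "g = t") (auto simp: insert_Diff_if)
      then show "S \<in> {block s s', block t' t}"
      proof cases
        case 1
        then have "rk g = rk s'" using fg(1) s'(1) by (auto simp: consecutive_def) (metis nat_neq_iff)
        then have "g = s'" using rk_eq_iff fg' s'(1) by (auto simp: consecutive_def)
        with 1 fg show ?thesis by simp
      next
        case 2
        then have "rk f = rk t'" using fg(1) t'(1) by (auto simp: consecutive_def) (metis nat_neq_iff)
        then have "f = t'" using rk_eq_iff fg' t'(1) by (auto simp: consecutive_def)
        with 2 fg show ?thesis by simp
      qed
    qed
  qed
  ultimately show thesis using that s' t' by blast
qed

section \<open>The core of an embedded ladder\<close>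

lemma cross_subset_block:
  assumes "spans s t" "(i, j) \<in> cross"
  shows "fst s \<le> i" "i \<le> fst t" "snd s \<le> j" "j \<le> snd t"
  using cross_mono[of s "(i, j)"] cross_mono[of "(i, j)" t] assms by (auto simp: spans_def)

text \<open>Every vertex of the block is on an induced cycle between consecutive rungs, which puts
  it into the core. Conversely the graph consists of the block and the four ends of the paths, so
  \<open>core_subset_cycle\<close> applies.\<close>

lemma core_eq_block:
  assumes st: "spans s t" and emb: "outerplane_graph V E pos crv"
  shows "core V E pos crv = block s t"
proof
  interpret outerplane_graph V E pos crv by (rule emb)
  have st': "s \<in> cross" "t \<in> cross" "rk s < rk t" using st by (auto simp: spans_def)
  have bd: "fst s < p" "snd s < q" "fst t < p" "snd t < q" using st' crossD by auto
  have le: "fst s \<le> fst t" "snd s \<le> snd t" using cross_mono st' by auto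
  show "block s t \<subseteq> core V E pos crv"
  proof
    fix w assume "w \<in> block s t"
    then obtain f g where "consecutive f g" "w \<in> block f g" by (rule block_covered[OF st])
    then show "w \<in> core V E pos crv"
      using induced_cycle_subset_core[OF induced_cycle_block] by blast
  qed
  \<comment> \<open>Unlike in \<open>tails\<close>, each list contains its attachment vertex, and as
    its first entry, because \<open>core_subset_cycle\<close> glues the paths on at
    \<open>hd t\<close>. Therefore the initial segments are reversed.\<close>
  define T1 T2 T3 T4 where "T1 = rev (map v [0..<Suc (fst s)])" and "T2 = map v [fst t..<p]"
    and "T3 = rev (map u [0..<Suc (snd s)])" and "T4 = map u [snd t..<q]"
  note T = T1_def T2_def T3_def T4_def
  have sets: "set T1 = v ` {0..<Suc (fst s)}" "set T2 = v ` {fst t..<p}"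
    "set T3 = u ` {0..<Suc (snd s)}" "set T4 = u ` {snd t..<q}"
    by (simp_all add: T del: upt_Suc)
  have edges: "path_edges T1 = {{v k, v (Suc k)} | k. Suc k < Suc (fst s)}"
    "path_edges T2 = {{v k, v (Suc k)} | k. fst t \<le> k \<and> Suc k < p}"
    "path_edges T3 = {{u k, u (Suc k)} | k. Suc k < Suc (snd s)}"
    "path_edges T4 = {{u k, u (Suc k)} | k. snd t \<le> k \<and> Suc k < q}"
    by (simp_all add: T path_edges_map_upt del: upt_Suc)
  have hds: "hd T1 = v (fst s)" "hd T2 = v (fst t)" "hd T3 = u (snd s)" "hd T4 = u (snd t)"
    using bd by (auto simp: T hd_map)
  have inj: "inj_on v {0..<Suc (fst s)}" "inj_on v {fst t..<p}"
    "inj_on u {0..<Suc (snd s)}" "inj_on u {snd t..<q}"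
    using bd by (auto intro: inj_on_subset[OF inj_v] inj_on_subset[OF inj_u])
  have dist: "distinct T1" "distinct T2" "distinct T3" "distinct T4"
    using inj by (simp_all add: T distinct_map del: upt_Suc)
  note inb = v_in_block_iff[OF _ bd(3,4), of _ s] u_in_block_iff[OF _ bd(3,4), of _ s]
  have meets: "set T1 \<inter> block s t = {hd T1}" "set T2 \<inter> block s t = {hd T2}"
    "set T3 \<inter> block s t = {hd T3}" "set T4 \<inter> block s t = {hd T4}"
    unfolding sets hds using bd le inb by (auto simp: less_Suc_eq_le image_iff)
  have subV: "set T1 \<subseteq> V" "set T2 \<subseteq> V" "set T3 \<subseteq> V" "set T4 \<subseteq> V"
    unfolding sets V_eq using bd by auto
  have subE: "path_edges T1 \<subseteq> E" "path_edges T2 \<subseteq> E" "path_edges T3 \<subseteq> E" "path_edges T4 \<subseteq> E"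
    unfolding edges using bd by (auto intro!: v_path_edge u_path_edge)
  have ne: "T1 \<noteq> []" "T2 \<noteq> []" "T3 \<noteq> []" "T4 \<noteq> []" using bd by (simp_all add: T)
  have "core V E pos crv \<subseteq> set (block_list s t)"
  proof (rule core_subset_cycle[where ts = "[T1, T2, T3, T4]"])
    show "cycle_in V E (block_list s t)" by (rule cycle_in_block_list[OF st'])
    show "t' \<noteq> [] \<and> distinct t' \<and> set t' \<subseteq> V \<and> path_edges t' \<subseteq> E \<and>
        set t' \<inter> set (block_list s t) = {hd t'}"
      if "t' \<in> set [T1, T2, T3, T4]" for t'
      using that ne dist subV subE meets by (auto simp: set_block_list)
    \<comment> \<open>If \<open>s\<close> and \<open>t\<close> have the same vertex on the first
      path, both lists contain it, so disjointness may fail here.\<close>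
    have "set T1 \<inter> set T2 \<subseteq> block s t"
    proof
      fix w assume "w \<in> set T1 \<inter> set T2"
      then obtain i k where "i \<le> fst s" "fst t \<le> k" "k < p" "w = v i" "w = v k"
        by (auto simp: sets less_Suc_eq_le)
      then show "w \<in> block s t" using v_eq_iff[of i k] bd le inb by auto
    qed
    moreover have "set T3 \<inter> set T4 \<subseteq> block s t"
    proof
      fix w assume "w \<in> set T3 \<inter> set T4"
      then obtain i k where "i \<le> snd s" "snd t \<le> k" "k < q" "w = u i" "w = u k"
        by (auto simp: sets less_Suc_eq_le)
      then show "w \<in> block s t" using u_eq_iff[of i k] bd le inb by auto
    qed
    moreover have "set T1 \<inter> set T3 = {}" "set T1 \<inter> set T4 = {}" "set T2 \<inter> set T3 = {}"
      "set T2 \<inter> set T4 = {}"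
    proof -
      have "set T1 \<union> set T2 \<subseteq> v ` {..<p}" "set T3 \<union> set T4 \<subseteq> u ` {..<q}"
        unfolding sets using bd by auto
      then show "set T1 \<inter> set T3 = {}" "set T1 \<inter> set T4 = {}" "set T2 \<inter> set T3 = {}"
        "set T2 \<inter> set T4 = {}"
        using vu_disjoint by blast+
    qed
    ultimately show "sorted_wrt (\<lambda>a b. set a \<inter> set b \<subseteq> set (block_list s t)) [T1, T2, T3, T4]"
      by (simp add: set_block_list)
    show "V = set (block_list s t) \<union> (\<Union>t'\<in>set [T1, T2, T3, T4]. set t')"
    proof
      show "V \<subseteq> set (block_list s t) \<union> (\<Union>t'\<in>set [T1, T2, T3, T4]. set t')"
        unfolding V_eq set_block_list by (force simp: sets block_def)
    qed (use subV block_subset[OF st'(1,2)] in \<open>auto simp: set_block_list\<close>)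
    show "E = induced_edges E (set (block_list s t)) \<union> (\<Union>t'\<in>set [T1, T2, T3, T4]. path_edges t')"
    proof
      show "E \<subseteq> induced_edges E (set (block_list s t)) \<union> (\<Union>t'\<in>set [T1, T2, T3, T4]. path_edges t')"
      proof
        fix e assume e: "e \<in> E"
        then have "e \<subseteq> block s t \<or> (\<exists>t'\<in>set [T1, T2, T3, T4]. e \<in> path_edges t')"
        proof (cases rule: edge_cases)
          case (v i)
          consider "Suc i \<le> fst s" | "fst t \<le> i" | "fst s \<le> i" "Suc i \<le> fst t" by linarith
          then show ?thesis using v by cases (auto simp: edges inb)
        next
          case (u i)
          consider "Suc i \<le> snd s" | "snd t \<le> i" | "snd s \<le> i" "Suc i \<le> snd t" by linarith
          then show ?thesis using u by cases (auto simp: edges inb)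
        next
          case (cross i j)
          then show ?thesis using cross_subset_block[OF st] by (auto simp: block_def)
        qed
        with e show "e \<in> induced_edges E (set (block_list s t)) \<union>
            (\<Union>t'\<in>set [T1, T2, T3, T4]. path_edges t')"
          by (auto simp: induced_edges_def set_block_list)
      qed
    qed (use subE in \<open>auto simp: induced_edges_def\<close>)
  qed
  then show "core V E pos crv \<subseteq> block s t" by (simp add: set_block_list)
qed

end

text \<open>The second alternative of condition 4 of the theorem.\<close>

definition pendant_paths :: "'a set \<Rightarrow> 'a set set \<Rightarrow> 'a set \<Rightarrow> 'a list \<Rightarrow> bool" where
  "pendant_paths V E R cs \<longleftrightarrow>
     (\<exists>k\<le>4. \<exists>(P :: nat \<Rightarrow> 'a list) (y :: nat \<Rightarrow> 'a).
        disjoint_union_of_paths (V - R) (induced_edges E (V - R)) k P \<and>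
        (\<forall>i<k. P i \<noteq> [] \<and> joined_at E R (P i) (y i)) \<and>
        inj_on y {..<k} \<and>
        (\<not> is_cycle_graph R (induced_edges E R) \<longrightarrow>
           (\<forall>i<k. \<exists>S\<in>end_cycles V E cs. y i \<in> S) \<and>
           (\<exists>\<phi> :: 'a \<Rightarrow> 'a set.
              (\<forall>i<k. \<phi> (y i) \<in> end_cycles V E cs \<and> y i \<in> \<phi> (y i)) \<and>
              (\<forall>C\<in>end_cycles V E cs. card {v \<in> y ` {..<k}. \<phi> v = C} \<le> 2) \<and>
              (\<forall>i<k. \<forall>j<k. i \<noteq> j \<and> \<phi> (y i) = \<phi> (y j) \<longrightarrow>
                 {y i, y j} \<in> cycle_edges cs))) \<and>
        (is_cycle_graph R (induced_edges E R) \<and> k \<ge> 3 \<longrightarrow>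
           (\<exists>H\<in>{graph_K2_K1, graph_2K2, graph_P 3, graph_P 4, graph_C 3, graph_C 4}.
              graph_iso (y ` {..<k}, induced_edges E (y ` {..<k})) H)))"

text \<open>Replaces the indexed families by a list of pairs of a path and its attachment vertex, so
  that (i) and (ii) can be verified for the set \<open>Y\<close> of attachment vertices without
  indices.\<close>

lemma pendant_pathsI:
  assumes "disjoint_union_of_paths (V - R) (induced_edges E (V - R)) (length L) (\<lambda>i. fst (L ! i))"
    and "length L \<le> 4"
    and L: "\<And>x. x \<in> set L \<Longrightarrow> fst x \<noteq> [] \<and> joined_at E R (fst x) (snd x)"
    and d: "distinct (map snd L)" and Y: "Y = snd ` set L"
    and ends: "\<not> is_cycle_graph R (induced_edges E R) \<Longrightarrow>
      \<exists>\<phi>. (\<forall>z\<in>Y. \<phi> z \<in> end_cycles V E cs \<and> z \<in> \<phi> z) \<and>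
        (\<forall>C\<in>end_cycles V E cs. card {z \<in> Y. \<phi> z = C} \<le> 2) \<and>
        (\<forall>z\<in>Y. \<forall>z'\<in>Y. z \<noteq> z' \<and> \<phi> z = \<phi> z' \<longrightarrow> {z, z'} \<in> cycle_edges cs)"
    and iso: "is_cycle_graph R (induced_edges E R) \<Longrightarrow> 3 \<le> card Y \<Longrightarrow>
      \<exists>H\<in>{graph_K2_K1, graph_2K2, graph_P 3, graph_P 4, graph_C 3, graph_C 4}.
        graph_iso (Y, induced_edges E Y) H"
  shows "pendant_paths V E R cs"
proof -
  define y where "y i = snd (L ! i)" for i
  have yY: "y ` {..<length L} = Y"
    unfolding Y y_def by (auto simp: set_conv_nth image_iff)
  have inj: "inj_on y {..<length L}"
    using d by (auto simp: y_def inj_on_def distinct_conv_nth)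
  have "card Y = length L"
    using inj yY card_image by fastforce
  have mem: "y i \<in> Y" if "i < length L" for i using yY that by auto
  have neq: "y i \<noteq> y j" if "i < length L" "j < length L" "i \<noteq> j" for i j
    using inj that by (auto simp: inj_on_def)
  have c1: "(\<forall>i<length L. \<exists>S\<in>end_cycles V E cs. y i \<in> S) \<and>
      (\<exists>\<phi>. (\<forall>i<length L. \<phi> (y i) \<in> end_cycles V E cs \<and> y i \<in> \<phi> (y i)) \<and>
        (\<forall>C\<in>end_cycles V E cs. card {v \<in> y ` {..<length L}. \<phi> v = C} \<le> 2) \<and>
        (\<forall>i<length L. \<forall>j<length L. i \<noteq> j \<and> \<phi> (y i) = \<phi> (y j) \<longrightarrow> {y i, y j} \<in> cycle_edges cs))"
    if nc: "\<not> is_cycle_graph R (induced_edges E R)"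
  proof -
    obtain \<phi> where \<phi>: "\<forall>z\<in>Y. \<phi> z \<in> end_cycles V E cs \<and> z \<in> \<phi> z"
      "\<forall>C\<in>end_cycles V E cs. card {z \<in> Y. \<phi> z = C} \<le> 2"
      "\<forall>z\<in>Y. \<forall>z'\<in>Y. z \<noteq> z' \<and> \<phi> z = \<phi> z' \<longrightarrow> {z, z'} \<in> cycle_edges cs"
      using ends[OF nc] by (elim exE conjE) (rule that)
    show ?thesis
    proof (intro conjI exI[of _ \<phi>])
      show "\<forall>i<length L. \<exists>S\<in>end_cycles V E cs. y i \<in> S" using \<phi>(1) mem by blast
      show "\<forall>i<length L. \<phi> (y i) \<in> end_cycles V E cs \<and> y i \<in> \<phi> (y i)" using \<phi>(1) mem by blast
      show "\<forall>C\<in>end_cycles V E cs. card {v \<in> y ` {..<length L}. \<phi> v = C} \<le> 2"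
        unfolding yY by (rule \<phi>(2))
      show "\<forall>i<length L. \<forall>j<length L. i \<noteq> j \<and> \<phi> (y i) = \<phi> (y j) \<longrightarrow> {y i, y j} \<in> cycle_edges cs"
        using \<phi>(3) mem neq by blast
    qed
  qed
  show ?thesis
    unfolding pendant_paths_def
  proof (intro exI conjI)
    show "length L \<le> 4" by fact
    show "disjoint_union_of_paths (V - R) (induced_edges E (V - R)) (length L) (\<lambda>i. fst (L ! i))" by fact
    show "\<forall>i<length L. fst (L ! i) \<noteq> [] \<and> joined_at E R (fst (L ! i)) (y i)"
      using L nth_mem by (auto simp: y_def)
    show "inj_on y {..<length L}" by fact
    show "\<not> is_cycle_graph R (induced_edges E R) \<longrightarrow>
        (\<forall>i<length L. \<exists>S\<in>end_cycles V E cs. y i \<in> S) \<and>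
        (\<exists>\<phi>. (\<forall>i<length L. \<phi> (y i) \<in> end_cycles V E cs \<and> y i \<in> \<phi> (y i)) \<and>
          (\<forall>C\<in>end_cycles V E cs. card {v \<in> y ` {..<length L}. \<phi> v = C} \<le> 2) \<and>
          (\<forall>i<length L. \<forall>j<length L. i \<noteq> j \<and> \<phi> (y i) = \<phi> (y j) \<longrightarrow> {y i, y j} \<in> cycle_edges cs))"
      using c1 by blast
    show "is_cycle_graph R (induced_edges E R) \<and> length L \<ge> 3 \<longrightarrow>
        (\<exists>H\<in>{graph_K2_K1, graph_2K2, graph_P 3, graph_P 4, graph_C 3, graph_C 4}.
          graph_iso (y ` {..<length L}, induced_edges E (y ` {..<length L})) H)"
      using iso \<open>card Y = length L\<close> unfolding yY by simp
  qed
qed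

lemma two_subset_of_three: "card e = 2 \<Longrightarrow> e \<subseteq> {x, y, z} \<Longrightarrow> e \<in> {{x, y}, {y, z}, {x, z}}"
  by (auto simp: card_2_iff)

lemma two_subset_of_four: "card e = 2 \<Longrightarrow> e \<subseteq> {x, y, z, w} \<Longrightarrow>
    e \<in> {{x, y}, {z, w}, {x, z}, {y, w}, {x, w}, {y, z}}"
proof -
  assume "card e = 2" "e \<subseteq> {x, y, z, w}"
  then obtain a b where ab: "e = {a, b}" "a \<noteq> b" by (auto simp: card_2_iff)
  with \<open>e \<subseteq> {x, y, z, w}\<close> have "a \<in> {x, y, z, w}" "b \<in> {x, y, z, w}" by auto
  with ab show ?thesis by (elim insertE emptyE) (simp_all add: insert_commute)
qed

section \<open>Tails beyond the first and the last rung\<close>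

context ladder
begin

lemma swap_cross: "(i, j) \<in> ladder.cross E u v q p \<longleftrightarrow> (j, i) \<in> cross"
  by (auto simp: ladder.cross_def[OF swap] cross_def insert_commute)

lemma swap_block: "ladder.block u v (prod.swap f) (prod.swap g) = block f g"
  by (auto simp: ladder.block_def[OF swap] block_def)

lemma swap_spans:
  assumes "spans s t"
  shows "ladder.spans E u v q p (prod.swap s) (prod.swap t)"
proof -
  have "rk s \<le> rk (prod.swap h) \<and> rk (prod.swap h) \<le> rk t" if "prod.swap h \<in> cross" for h
    using assms that by (auto simp: spans_def)
  then show ?thesis
    using assms swap_cross
    by (cases s; cases t) (auto simp: ladder.spans_def[OF swap] spans_def ladder.rk_def[OF swap]
        rk_def add.commute)
qed

text \<open>No rung precedes \<open>s\<close>, so no rung ends on this tail, and only the path edge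
  at its last vertex leads to the block. The tails of the second path are handled through
  \<open>swap\<close>.\<close>

lemma joined_at_first_tail:
  assumes st: "spans s t" and a: "0 < fst s"
  shows "joined_at E (block s t) (map v [0..<fst s]) (v (fst s))"
proof -
  have bd: "fst s < p" "snd s < q" "fst t < p" "snd t < q" "fst s \<le> fst t" "snd s \<le> snd t"
    using st crossD cross_mono[of s t] by (auto simp: spans_def)
  note inb = v_in_block_iff[OF _ bd(3,4), of _ s] u_in_block_iff[OF _ bd(3,4), of _ s]
  let ?t = "map v [0..<fst s]"
  have last: "last ?t = v (fst s - 1)" using a by (simp add: last_map)
  have mem: "v i \<in> set ?t \<longleftrightarrow> i < fst s" if "i < p" for i
    using that bd v_eq_iff by (auto simp: image_iff)
  have memu: "u j \<notin> set ?t" if "j < q" for j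
  proof -
    have "set ?t \<subseteq> v ` {..<p}" using bd by auto
    moreover have "u j \<in> u ` {..<q}" using that by simp
    ultimately show ?thesis using vu_disjoint by blast
  qed
  have "{e \<in> E. e \<inter> set ?t \<noteq> {} \<and> e \<inter> block s t \<noteq> {}} = {{v (fst s - 1), v (fst s)}}"
  proof
    show "{e \<in> E. e \<inter> set ?t \<noteq> {} \<and> e \<inter> block s t \<noteq> {}} \<subseteq> {{v (fst s - 1), v (fst s)}}"
    proof
      fix e assume "e \<in> {e \<in> E. e \<inter> set ?t \<noteq> {} \<and> e \<inter> block s t \<noteq> {}}"
      then have e: "e \<in> E" "e \<inter> set ?t \<noteq> {}" "e \<inter> block s t \<noteq> {}" by auto
      from e(1) show "e \<in> {{v (fst s - 1), v (fst s)}}"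
      proof (cases rule: edge_cases)
        case (v i)
        then have "i < fst s" "fst s \<le> Suc i" using e(2,3) mem[of i] mem[of "Suc i"] inb(1)[of i] inb(1)[of "Suc i"]
          by (auto simp del: set_map)
        then have "fst s = Suc i" by simp
        then show ?thesis using v by simp
      next
        case (u j)
        then show ?thesis using e(2) memu[of j] memu[of "Suc j"] by (auto simp del: set_map)
      next
        case (cross i j)
        then have "fst s \<le> i" "i < p" "j < q" using cross_subset_block[OF st] by (auto simp: cross_def)
        then show ?thesis using e(2) mem[of i] memu[of j] cross by (auto simp del: set_map)
      qed
    qed
    have "v (fst s - 1) \<in> set ?t" "v (fst s) \<in> block s t" using mem[of "fst s - 1"] inb bd a by auto
    moreover have "{v (fst s - 1), v (fst s)} \<in> E" using v_path_edge[of "fst s - 1"] a bd by simp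
    ultimately show "{{v (fst s - 1), v (fst s)}} \<subseteq> {e \<in> E. e \<inter> set ?t \<noteq> {} \<and> e \<inter> block s t \<noteq> {}}"
      by (auto simp del: set_map)
  qed
  moreover have "v (fst s) \<in> block s t" using inb bd by auto
  moreover have "v (fst s - 1) \<in> {hd ?t, last ?t}" unfolding last by simp
  ultimately show ?thesis
    unfolding joined_at_def by (intro conjI bexI)
qed

lemma joined_at_last_tail:
  assumes st: "spans s t" and b: "Suc (fst t) < p"
  shows "joined_at E (block s t) (map v [Suc (fst t)..<p]) (v (fst t))"
proof -
  have bd: "fst s < p" "snd s < q" "fst t < p" "snd t < q" "fst s \<le> fst t" "snd s \<le> snd t"
    using st crossD cross_mono[of s t] by (auto simp: spans_def)
  note inb = v_in_block_iff[OF _ bd(3,4), of _ s] u_in_block_iff[OF _ bd(3,4), of _ s]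
  let ?t = "map v [Suc (fst t)..<p]"
  have hd: "hd ?t = v (Suc (fst t))" using b by (simp add: hd_map del: upt_Suc)
  have mem: "v i \<in> set ?t \<longleftrightarrow> fst t < i" if "i < p" for i
    using that bd v_eq_iff by (auto simp: image_iff)
  have memu: "u j \<notin> set ?t" if "j < q" for j
  proof -
    have "set ?t \<subseteq> v ` {..<p}" by auto
    moreover have "u j \<in> u ` {..<q}" using that by simp
    ultimately show ?thesis using vu_disjoint by blast
  qed
  have "{e \<in> E. e \<inter> set ?t \<noteq> {} \<and> e \<inter> block s t \<noteq> {}} = {{v (Suc (fst t)), v (fst t)}}"
  proof
    show "{e \<in> E. e \<inter> set ?t \<noteq> {} \<and> e \<inter> block s t \<noteq> {}} \<subseteq> {{v (Suc (fst t)), v (fst t)}}"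
    proof
      fix e assume "e \<in> {e \<in> E. e \<inter> set ?t \<noteq> {} \<and> e \<inter> block s t \<noteq> {}}"
      then have e: "e \<in> E" "e \<inter> set ?t \<noteq> {}" "e \<inter> block s t \<noteq> {}" by auto
      from e(1) show "e \<in> {{v (Suc (fst t)), v (fst t)}}"
      proof (cases rule: edge_cases)
        case (v i)
        then have "fst t < Suc i" "i \<le> fst t" using e(2,3) mem[of i] mem[of "Suc i"] inb(1)[of i] inb(1)[of "Suc i"]
          by (auto simp del: set_map)
        then have "fst t = i" by simp
        then show ?thesis using v by (simp add: insert_commute)
      next
        case (u j)
        then show ?thesis using e(2) memu[of j] memu[of "Suc j"] by (auto simp del: set_map)
      next
        case (cross i j)
        then have "i \<le> fst t" "i < p" "j < q" using cross_subset_block[OF st] by (auto simp: cross_def)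
        then show ?thesis using e(2) mem[of i] memu[of j] cross by (auto simp del: set_map)
      qed
    qed
    have "v (Suc (fst t)) \<in> set ?t" "v (fst t) \<in> block s t" using mem[of "Suc (fst t)"] inb bd b by auto
    moreover have "{v (Suc (fst t)), v (fst t)} \<in> E" using v_path_edge[OF b] by (simp add: insert_commute)
    ultimately show "{{v (Suc (fst t)), v (fst t)}} \<subseteq> {e \<in> E. e \<inter> set ?t \<noteq> {} \<and> e \<inter> block s t \<noteq> {}}"
      by (auto simp del: set_map)
  qed
  moreover have "v (fst t) \<in> block s t" using inb bd by auto
  moreover have "v (Suc (fst t)) \<in> {hd ?t, last ?t}" unfolding hd by simp
  ultimately show ?thesis
    unfolding joined_at_def by (intro conjI bexI)
qed

text \<open>Pairs of a possibly empty path and its attachment vertex. The order is the one of the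
  paths in \<open>alpha_graph\<close> when both tails of the first path hang at the same
  vertex.\<close>

definition tails :: "nat \<times> nat \<Rightarrow> nat \<times> nat \<Rightarrow> ('a list \<times> 'a) list" where
  "tails s t = [(map v [0..<fst s], v (fst s)), (map v [Suc (fst t)..<p], v (fst t)),
    (map u [0..<snd s], u (snd s)), (map u [Suc (snd t)..<q], u (snd t))]"

lemma joined_at_tails:
  assumes st: "spans s t" and x: "x \<in> set (tails s t)" "fst x \<noteq> []"
  shows "joined_at E (block s t) (fst x) (snd x)"
  using x joined_at_first_tail[OF st] joined_at_last_tail[OF st]
    ladder.joined_at_first_tail[OF swap swap_spans[OF st]]
    ladder.joined_at_last_tail[OF swap swap_spans[OF st]]
  by (auto simp: tails_def swap_block)

lemma tails_union:
  assumes st: "spans s t"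
  shows "V - block s t = (\<Union>x\<in>set (tails s t). set (fst x))"
    and "induced_edges E (V - block s t) = (\<Union>x\<in>set (tails s t). path_edges (fst x))"
    and "\<And>x. x \<in> set (tails s t) \<Longrightarrow> distinct (fst x)"
    and "sorted_wrt (\<lambda>x y. set (fst x) \<inter> set (fst y) = {}) (tails s t)"
proof -
  have bd: "fst s < p" "snd s < q" "fst t < p" "snd t < q" "fst s \<le> fst t" "snd s \<le> snd t"
    using st crossD cross_mono[of s t] by (auto simp: spans_def)
  note inb = v_in_block_iff[OF _ bd(3,4), of _ s] u_in_block_iff[OF _ bd(3,4), of _ s]
  define W where "W = v ` ({0..<fst s} \<union> {Suc (fst t)..<p}) \<union> u ` ({0..<snd s} \<union> {Suc (snd t)..<q})"
  have sets: "(\<Union>x\<in>set (tails s t). set (fst x)) = W"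
    by (auto simp: tails_def W_def simp del: upt_Suc)
  have VW: "V - block s t = W"
  proof
    show "V - block s t \<subseteq> W"
    proof
      fix w assume w: "w \<in> V - block s t"
      then consider i where "i < p" "w = v i" | j where "j < q" "w = u j" by (auto simp: V_eq)
      then show "w \<in> W"
      proof cases
        case 1
        then have "i < fst s \<or> fst t < i" using w inb by auto
        then show ?thesis using 1 by (auto simp: W_def)
      next
        case 2
        then have "j < snd s \<or> snd t < j" using w inb by auto
        then show ?thesis using 2 by (auto simp: W_def)
      qed
    qed
    show "W \<subseteq> V - block s t" using inb bd by (auto simp: W_def V_eq)
  qed
  with sets show "V - block s t = (\<Union>x\<in>set (tails s t). set (fst x))" by simp
  have edges: "(\<Union>x\<in>set (tails s t). path_edges (fst x)) =
      {{v k, v (Suc k)} | k. Suc k < fst s} \<union> {{v k, v (Suc k)} | k. fst t < k \<and> Suc k < p} \<union>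
      {{u k, u (Suc k)} | k. Suc k < snd s} \<union> {{u k, u (Suc k)} | k. snd t < k \<and> Suc k < q}"
    by (simp add: tails_def path_edges_map_upt Suc_le_eq Un_assoc del: upt_Suc)
  show "induced_edges E (V - block s t) = (\<Union>x\<in>set (tails s t). path_edges (fst x))"
    unfolding edges
  proof
    show "{{v k, v (Suc k)} | k. Suc k < fst s} \<union> {{v k, v (Suc k)} | k. fst t < k \<and> Suc k < p} \<union>
      {{u k, u (Suc k)} | k. Suc k < snd s} \<union> {{u k, u (Suc k)} | k. snd t < k \<and> Suc k < q}
      \<subseteq> induced_edges E (V - block s t)"
      unfolding VW using bd v_path_edge u_path_edge
      by (auto simp: induced_edges_def W_def)
    show "induced_edges E (V - block s t) \<subseteq>
      {{v k, v (Suc k)} | k. Suc k < fst s} \<union> {{v k, v (Suc k)} | k. fst t < k \<and> Suc k < p} \<union>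
      {{u k, u (Suc k)} | k. Suc k < snd s} \<union> {{u k, u (Suc k)} | k. snd t < k \<and> Suc k < q}"
    proof
      fix e assume "e \<in> induced_edges E (V - block s t)"
      then have e: "e \<in> E" "e \<inter> block s t = {}" by (auto simp: induced_edges_def)
      from e(1) show "e \<in> {{v k, v (Suc k)} | k. Suc k < fst s} \<union>
        {{v k, v (Suc k)} | k. fst t < k \<and> Suc k < p} \<union>
        {{u k, u (Suc k)} | k. Suc k < snd s} \<union> {{u k, u (Suc k)} | k. snd t < k \<and> Suc k < q}"
      proof (cases rule: edge_cases)
        case (v i)
        then have "\<not> (fst s \<le> i \<and> i \<le> fst t)" "\<not> (fst s \<le> Suc i \<and> Suc i \<le> fst t)"
          using e(2) inb(1)[of i] inb(1)[of "Suc i"] by auto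
        then have "Suc i < fst s \<or> fst t < i" using bd by linarith
        then show ?thesis using v by blast
      next
        case (u i)
        then have "\<not> (snd s \<le> i \<and> i \<le> snd t)" "\<not> (snd s \<le> Suc i \<and> Suc i \<le> snd t)"
          using e(2) inb(2)[of i] inb(2)[of "Suc i"] by auto
        then have "Suc i < snd s \<or> snd t < i" using bd by linarith
        then show ?thesis using u by blast
      next
        case (cross i j)
        then have "v i \<in> block s t" using cross_subset_block[OF st cross(1)] by (auto simp: block_def)
        then show ?thesis using cross e(2) by auto
      qed
    qed
  qed
  have "inj_on v {0..<fst s}" "inj_on v {Suc (fst t)..<p}" "inj_on u {0..<snd s}"
    "inj_on u {Suc (snd t)..<q}"
    using bd by (auto intro: inj_on_subset[OF inj_v] inj_on_subset[OF inj_u])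
  then show "distinct (fst x)" if "x \<in> set (tails s t)" for x
    using that by (auto simp: tails_def distinct_map simp del: upt_Suc)
  have "v ` {0..<fst s} \<inter> v ` {Suc (fst t)..<p} = {}" "u ` {0..<snd s} \<inter> u ` {Suc (snd t)..<q} = {}"
    using bd by (auto simp: v_eq_iff u_eq_iff)
  moreover have un: "v ` A \<inter> u ` B = {}" if "A \<subseteq> {..<p}" "B \<subseteq> {..<q}" for A B
    using vu_disjoint that by blast
  have "v ` {0..<fst s} \<inter> u ` {0..<snd s} = {}" "v ` {0..<fst s} \<inter> u ` {Suc (snd t)..<q} = {}"
    "v ` {Suc (fst t)..<p} \<inter> u ` {0..<snd s} = {}" "v ` {Suc (fst t)..<p} \<inter> u ` {Suc (snd t)..<q} = {}"
    by (rule un; use bd in auto)+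
  ultimately show "sorted_wrt (\<lambda>x y. set (fst x) \<inter> set (fst y) = {}) (tails s t)"
    by (simp add: tails_def del: upt_Suc)
qed

text \<open>If \<open>s\<close> and \<open>t\<close> share their vertex on the first path,
  monotonicity makes every rung end there, so this vertex serves as \<open>c_0\<close>. As the
  second path is read backwards, the other ends of \<open>t\<close> and \<open>s\<close> come at
  positions 1 and \<open>r - 1\<close>.\<close>

lemma alpha_graphI:
  assumes st: "spans s t" and emb: "outerplane_graph V E pos crv" and tpp: "two_parallel_paths V E"
    and eq: "fst s = fst t" and tl: "0 < fst s" "Suc (fst t) < p"
  shows "alpha_graph V E pos crv"
proof -
  interpret outerplane_graph V E pos crv by (rule emb)
  have st': "s \<in> cross" "t \<in> cross" "rk s < rk t" using st by (auto simp: spans_def)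
  then have cd: "snd s < snd t" using eq by (simp add: rk_def)
  let ?c = "block_list s t" and ?R = "block s t" and ?r = "length (block_list s t)"
  let ?P = "\<lambda>i. fst (tails s t ! i)"
  have R: "core V E pos crv = ?R" by (rule core_eq_block[OF st emb])
  have len: "length (tails s t) = 4" by (simp add: tails_def)
  have c: "?c = v (fst s) # rev (map u [snd s..<Suc (snd t)])"
    by (simp add: block_list_def eq)
  have r: "?r = snd t - snd s + 2" using cd by (simp add: c Suc_diff_le del: upt_Suc)
  have c0: "?c ! 0 = v (fst s)" by (simp add: c)
  \<comment> \<open>The offset 1 accounts for \<open>v (fst s)\<close> at the head of the list;
    after it the indices on the second path descend from \<open>snd t\<close>.\<close>
  have cj: "?c ! (snd t - j + 1) = u j" if "snd s \<le> j" "j \<le> snd t" for j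
    using that by (simp add: c rev_nth del: upt_Suc)
  have c1: "?c ! 1 = u (snd t)" using cj[of "snd t"] cd by simp
  have cl: "?c ! (?r - 1) = u (snd s)" using cj[of "snd s"] cd r by simp
  have "outer_cycle V E pos crv ?c"
    using outer_cycleI[of ?c] hamiltonian_block_list[OF st'] by (simp add: R)
  moreover have "\<exists>i<?r. i \<notin> {0, 1, ?r - 1} \<and> e = {?c ! 0, ?c ! i}" if e: "e \<in> interior_edges E ?c" for e
  proof -
    obtain h where h: "h \<in> cross" "rk s < rk h" "rk h < rk t" "e = edge h"
      using e unfolding interior_edges_block_list[OF st'] by blast
    then have "fst s \<le> fst h" "fst h \<le> fst t" using cross_mono st' by (auto simp: less_imp_le)
    then have fh: "fst h = fst s" "snd s < snd h" "snd h < snd t" using eq h by (auto simp: rk_def)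
    then have "e = {?c ! 0, ?c ! (snd t - snd h + 1)}" using c0 cj[of "snd h"] h by (simp add: edge_def)
    then show ?thesis using fh r by (intro exI[of _ "snd t - snd h + 1"]) auto
  qed
  moreover have "disjoint_union_of_paths (V - ?R) (induced_edges E (V - ?R)) 4 ?P"
  proof -
    have "disjoint_union_of_paths (V - ?R) (induced_edges E (V - ?R)) (length (tails s t)) ?P"
      using tails_union[OF st] by (intro disjoint_union_of_paths_list) auto
    then show ?thesis by (simp only: len)
  qed
  moreover have "?P 0 \<noteq> []" "?P 1 \<noteq> []" using tl by (simp_all add: tails_def)
  moreover have joined: "joined_at E ?R (?P i) (snd (tails s t ! i))" if "i < 4" "?P i \<noteq> []" for i
    using joined_at_tails[OF st nth_mem, of i] that len by simp
  have "joined_at E ?R (?P 0) (?c ! 0)" "joined_at E ?R (?P 1) (?c ! 0)"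
    "?P 2 \<noteq> [] \<longrightarrow> joined_at E ?R (?P 2) (?c ! (?r - 1))"
    "?P 3 \<noteq> [] \<longrightarrow> joined_at E ?R (?P 3) (?c ! 1)"
    using joined[of 0] joined[of 1] joined[of 2] joined[of 3] tl
    unfolding c0 c1 cl by (simp_all add: tails_def eq del: upt_Suc)
  ultimately show ?thesis
    unfolding alpha_graph_def Let_def R using tpp by blast
qed

text \<open>\<open>nv\<close> and \<open>nu\<close> exclude two nonempty tails at one vertex, so the
  attachment vertices are distinct. Those of tails before \<open>s\<close> are assigned to the first
  end cycle, those after \<open>t\<close> to the last. Two vertices with the same image are then the
  ends of one of these rungs, which is an edge of the outer-cycle.\<close>

lemma pendant_paths_ladder:
  assumes st: "spans s t"
    and nv: "\<not> (fst s = fst t \<and> 0 < fst s \<and> Suc (fst t) < p)"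
    and nu: "\<not> (snd s = snd t \<and> 0 < snd s \<and> Suc (snd t) < q)"
  shows "pendant_paths V E (block s t) (block_list s t)"
proof -
  have st': "s \<in> cross" "t \<in> cross" "rk s < rk t" using st by (auto simp: spans_def)
  have bd: "fst s < p" "snd s < q" "fst t < p" "snd t < q" "fst s \<le> fst t" "snd s \<le> snd t"
    using st crossD cross_mono[of s t] by (auto simp: spans_def)
  define L where "L = filter (\<lambda>x. fst x \<noteq> []) (tails s t)"
  define Y where "Y = snd ` set L"
  have Lset: "x \<in> set L \<longleftrightarrow> x \<in> set (tails s t) \<and> fst x \<noteq> []" for x by (auto simp: L_def)
  have Y: "z \<in> Y \<longleftrightarrow> 0 < fst s \<and> z = v (fst s) \<or> Suc (fst t) < p \<and> z = v (fst t) \<or>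
      0 < snd s \<and> z = u (snd s) \<or> Suc (snd t) < q \<and> z = u (snd t)" for z
    by (auto simp: Y_def L_def tails_def image_iff)
  have ce: "edge s \<in> cycle_edges (block_list s t)" "edge t \<in> cycle_edges (block_list s t)"
    using cycle_edges_block_list[OF st'] by auto
  show ?thesis
  proof (rule pendant_pathsI[of _ _ _ L])
    show "disjoint_union_of_paths (V - block s t) (induced_edges E (V - block s t)) (length L)
        (\<lambda>i. fst (L ! i))"
      using tails_union[OF st] by (intro disjoint_union_of_paths_filter[OF _ _ _ _ L_def]) auto
    show "length L \<le> 4" using length_filter_le[of _ "tails s t"] by (simp add: L_def tails_def)
    show "fst x \<noteq> [] \<and> joined_at E (block s t) (fst x) (snd x)" if "x \<in> set L" for x
      using that joined_at_tails[OF st] by (auto simp: Lset)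
    have "v (fst s) = v (fst t) \<Longrightarrow> fst s = fst t" "u (snd s) = u (snd t) \<Longrightarrow> snd s = snd t"
      "v (fst s) \<noteq> u (snd s)" "v (fst s) \<noteq> u (snd t)" "v (fst t) \<noteq> u (snd s)" "v (fst t) \<noteq> u (snd t)"
      using bd v_eq_iff u_eq_iff v_neq_u by auto
    then show "distinct (map snd L)"
      using nv nu by (auto simp: L_def tails_def)
    show "Y = snd ` set L" by (rule Y_def)
    have cyc: "is_cycle_graph (block s t) (induced_edges E (block s t)) \<longleftrightarrow>
        induced_edges E (block s t) = cycle_edges (block_list s t)"
      using simple hamiltonian_block_list[OF st']
      by (intro is_cycle_graph_iff) (auto simp: induced_edges_def simple_graph_def
        intro: finite_subset[of _ "Pow V"])
    show "\<exists>\<phi>. (\<forall>z\<in>Y. \<phi> z \<in> end_cycles V E (block_list s t) \<and> z \<in> \<phi> z) \<and>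
        (\<forall>C\<in>end_cycles V E (block_list s t). card {z \<in> Y. \<phi> z = C} \<le> 2) \<and>
        (\<forall>z\<in>Y. \<forall>z'\<in>Y. z \<noteq> z' \<and> \<phi> z = \<phi> z' \<longrightarrow> {z, z'} \<in> cycle_edges (block_list s t))"
      if nc: "\<not> is_cycle_graph (block s t) (induced_edges E (block s t))"
    proof -
      obtain h where h: "h \<in> cross" "rk s < rk h" "rk h < rk t"
        using nc cyc induced_edges_block[OF st'] by blast
      obtain s' t' where st'': "consecutive s s'" "consecutive t' t" "block s s' \<noteq> block t' t"
        "end_cycles V E (block_list s t) = {block s s', block t' t}"
        by (rule end_cycles_block_list[OF st h(1)]) (use h in auto)
      \<comment> \<open>If \<open>s\<close> and \<open>t\<close> share a vertex, it is an end of
        both, and the tail that is really present decides on the end cycle. By \<open>nv\<close> and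
        \<open>nu\<close> at most one is attached there.\<close>
      define N where "N z \<longleftrightarrow> 0 < fst s \<and> z = v (fst s) \<or> 0 < snd s \<and> z = u (snd s)" for z
      define \<phi> where "\<phi> z = (if N z then block s s' else block t' t)" for z
      have le: "fst s \<le> fst s'" "snd s \<le> snd s'" "fst t' \<le> fst t" "snd t' \<le> snd t"
        using st''(1,2) cross_mono by (auto simp: consecutive_def less_imp_le)
      have N: "z \<in> {v (fst s), u (snd s)}" if "N z" for z using that by (auto simp: N_def)
      have notN: "z \<in> {v (fst t), u (snd t)}" if "z \<in> Y" "\<not> N z" for z
        using that by (auto simp: N_def Y)
      have card2: "card Z \<le> 2" if "Z \<subseteq> {x, y}" for Z and x y :: 'a
        using card_mono[OF _ that] by (simp add: card_insert_if split: if_splits)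
      show ?thesis
      proof (intro exI[of _ \<phi>] conjI ballI impI)
        fix z assume z: "z \<in> Y"
        show "\<phi> z \<in> end_cycles V E (block_list s t)" by (simp add: \<phi>_def st'')
        show "z \<in> \<phi> z" using N[of z] notN[OF z] le by (auto simp: \<phi>_def block_def)
      next
        fix C assume "C \<in> end_cycles V E (block_list s t)"
        then consider "C = block s s'" | "C = block t' t" by (auto simp: st'')
        then show "card {z \<in> Y. \<phi> z = C} \<le> 2"
        proof cases
          case 1
          have "{z \<in> Y. \<phi> z = C} \<subseteq> {v (fst s), u (snd s)}"
            using N 1 st''(3) by (auto simp: \<phi>_def split: if_splits)
          then show ?thesis by (rule card2)
        next
          case 2
          have "{z \<in> Y. \<phi> z = C} \<subseteq> {v (fst t), u (snd t)}"
            using notN 2 st''(3) by (auto simp: \<phi>_def split: if_splits)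
          then show ?thesis by (rule card2)
        qed
      next
        fix z z' assume z: "z \<in> Y" "z' \<in> Y" "z \<noteq> z' \<and> \<phi> z = \<phi> z'"
        then have "N z \<longleftrightarrow> N z'" using st''(3) by (auto simp: \<phi>_def split: if_splits)
        then have "{z, z'} = edge s \<or> {z, z'} = edge t"
          using N[of z] N[of z'] notN[of z] notN[of z'] z by (cases "N z") (auto simp: edge_def)
        then show "{z, z'} \<in> cycle_edges (block_list s t)" using ce by metis
      qed
    qed
    show "\<exists>H\<in>{graph_K2_K1, graph_2K2, graph_P 3, graph_P 4, graph_C 3, graph_C 4}.
        graph_iso (Y, induced_edges E Y) H"
      if c: "is_cycle_graph (block s t) (induced_edges E (block s t))" and k: "3 \<le> card Y"
    proof -
      \<comment> \<open>If the core is a cycle, a third rung would be a chord of it.\<close>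
      have no: "h = s \<or> h = t" if "h \<in> cross" for h
      proof (rule ccontr)
        assume h: "\<not> (h = s \<or> h = t)"
        then have "edge h \<notin> cycle_edges (block_list s t)"
          using edge_not_in_cycle_edges_block_list[OF st' that] by blast
        moreover have "rk s < rk h" "rk h < rk t"
          using st that h rk_eq_iff[of s h] rk_eq_iff[of h t] by (auto simp: spans_def less_le)
        ultimately show False
          using c cyc induced_edges_block[OF st'] that by blast
      qed
      have two: "card e = 2" if "e \<in> induced_edges E Y" for e
        using that simple by (auto simp: induced_edges_def simple_graph_def)
      have EY: "e \<in> induced_edges E Y \<longleftrightarrow> e \<in> E \<and> e \<subseteq> Y" for e by (auto simp: induced_edges_def)
      have three: ?thesis if "Y = {x, y, z}" "{x, y} \<in> E" for x y z
      proof -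
        have "x \<noteq> y \<and> x \<noteq> z \<and> y \<noteq> z"
          using k that(1) by (auto simp: card_insert_if split: if_splits)
        moreover have "induced_edges E Y \<subseteq> {{x, y}, {y, z}, {x, z}}"
        proof
          fix e assume e: "e \<in> induced_edges E Y"
          then have "e \<subseteq> {x, y, z}" using EY that(1) by simp
          with two_subset_of_three[OF two[OF e]] show "e \<in> {{x, y}, {y, z}, {x, z}}" .
        qed
        ultimately have "\<exists>H\<in>{graph_K2_K1, graph_P 3, graph_C 3}. graph_iso (Y, induced_edges E Y) H"
          using that EY by (intro graph_iso_three[of x y z]) auto
        then show ?thesis by blast
      qed
      have edgeE: "{v (fst s), u (snd s)} \<in> E" "{v (fst t), u (snd t)} \<in> E"
        using st' crossD by (auto simp: edge_def)
      then have edgeE': "{u (snd s), v (fst s)} \<in> E" "{u (snd t), v (fst t)} \<in> E"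
        by (simp_all add: insert_commute)
      have card2: "card Y \<le> 2" if "Y \<subseteq> {x, y}" for x y
        using card_mono[OF _ that] by (simp add: card_insert_if split: if_splits)
      \<comment> \<open>Of any three tails, two hang at the two ends of \<open>s\<close> or of
        \<open>t\<close>. That rung is the edge between attachment vertices that
        \<open>graph_iso_three\<close> needs.\<close>
      consider (four) "0 < fst s" "Suc (fst t) < p" "0 < snd s" "Suc (snd t) < q"
        | "Y = {v (fst s), u (snd s), v (fst t)}" | "Y = {v (fst s), u (snd s), u (snd t)}"
        | "Y = {v (fst t), u (snd t), v (fst s)}" | "Y = {v (fst t), u (snd t), u (snd s)}"
        | x y where "Y \<subseteq> {x, y}"
      proof -
        have "Y = {v (fst s), u (snd s), v (fst t)}"
          if "0 < fst s" "Suc (fst t) < p" "0 < snd s" "\<not> Suc (snd t) < q" using that by (auto simp: Y)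
        moreover have "Y = {v (fst s), u (snd s), u (snd t)}"
          if "0 < fst s" "\<not> Suc (fst t) < p" "0 < snd s" "Suc (snd t) < q" using that by (auto simp: Y)
        moreover have "Y = {v (fst t), u (snd t), v (fst s)}"
          if "0 < fst s" "Suc (fst t) < p" "\<not> 0 < snd s" "Suc (snd t) < q" using that by (auto simp: Y)
        moreover have "Y = {v (fst t), u (snd t), u (snd s)}"
          if "\<not> 0 < fst s" "Suc (fst t) < p" "0 < snd s" "Suc (snd t) < q" using that by (auto simp: Y)
        moreover have "Y \<subseteq> {u (snd s), u (snd t)}" if "\<not> 0 < fst s" "\<not> Suc (fst t) < p"
          using that by (auto simp: Y)
        moreover have "Y \<subseteq> {v (fst t), u (snd t)}" if "\<not> 0 < fst s" "\<not> 0 < snd s"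
          using that by (auto simp: Y)
        moreover have "Y \<subseteq> {v (fst t), u (snd s)}" if "\<not> 0 < fst s" "\<not> Suc (snd t) < q"
          using that by (auto simp: Y)
        moreover have "Y \<subseteq> {v (fst s), u (snd t)}" if "\<not> Suc (fst t) < p" "\<not> 0 < snd s"
          using that by (auto simp: Y)
        moreover have "Y \<subseteq> {v (fst s), u (snd s)}" if "\<not> Suc (fst t) < p" "\<not> Suc (snd t) < q"
          using that by (auto simp: Y)
        moreover have "Y \<subseteq> {v (fst s), v (fst t)}" if "\<not> 0 < snd s" "\<not> Suc (snd t) < q"
          using that by (auto simp: Y)
        ultimately show thesis using that by meson
      qed
      then show ?thesis
      proof cases
        case four
        then have ne: "fst s \<noteq> fst t" "snd s \<noteq> snd t" using nv nu by auto
        have Y4: "Y = {v (fst s), u (snd s), v (fst t), u (snd t)}" using four by (auto simp: Y)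
        have "induced_edges E Y \<subseteq> {{v (fst s), u (snd s)}, {v (fst t), u (snd t)},
            {v (fst s), v (fst t)}, {u (snd s), u (snd t)}}"
        proof
          fix e assume e: "e \<in> induced_edges E Y"
          \<comment> \<open>The diagonals would be rungs other than \<open>s\<close> and
            \<open>t\<close>.\<close>
          have "{v (fst s), u (snd t)} \<notin> E"
            using no[of "(fst s, snd t)"] crossI[of "fst s" "snd t"] bd ne by (auto simp: prod_eq_iff)
          moreover have "{u (snd s), v (fst t)} \<notin> E"
            using no[of "(fst t, snd s)"] crossI[of "fst t" "snd s"] bd ne
            by (auto simp: prod_eq_iff insert_commute)
          moreover have "e \<in> E" "e \<subseteq> {v (fst s), u (snd s), v (fst t), u (snd t)}"
            using e EY Y4 by simp_all
          ultimately show "e \<in> {{v (fst s), u (snd s)}, {v (fst t), u (snd t)},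
            {v (fst s), v (fst t)}, {u (snd s), u (snd t)}}"
            using two_subset_of_four[OF two[OF e], of "v (fst s)" "u (snd s)" "v (fst t)" "u (snd t)"]
            by auto
        qed
        moreover have "distinct [v (fst s), u (snd s), v (fst t), u (snd t)]"
        proof -
          have "v (fst t) \<noteq> u (snd s)" using v_neq_u bd by simp
          then have "u (snd s) \<noteq> v (fst t)" by (rule not_sym)
          then show ?thesis using ne bd v_eq_iff u_eq_iff v_neq_u by simp
        qed
        moreover have "{v (fst s), u (snd s)} \<in> induced_edges E Y" "{v (fst t), u (snd t)} \<in> induced_edges E Y"
          using edgeE EY Y4 by simp_all
        ultimately have "\<exists>H\<in>{graph_2K2, graph_P 4, graph_C 4}. graph_iso (Y, induced_edges E Y) H"
          using Y4 by (intro graph_iso_four[of "v (fst s)" "u (snd s)" "v (fst t)" "u (snd t)"])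
        then show ?thesis by blast
      next
        case 6
        then show ?thesis using card2 k by fastforce
      qed (use three edgeE in blast)+
    qed
  qed
qed

end

section \<open>The conditions yield two parallel paths\<close>

lemma cycle_edges_nth_iff:
  assumes "distinct cs" "i < j" "j < length cs"
  shows "{cs ! i, cs ! j} \<in> cycle_edges cs \<longleftrightarrow> j = Suc i \<or> i = 0 \<and> j = length cs - 1"
proof -
  have ne: "cs \<noteq> []" using assms by auto
  have "{cs ! i, cs ! j} = {last cs, hd cs} \<longleftrightarrow> i = 0 \<and> j = length cs - 1"
    using assms ne by (auto simp: last_conv_nth hd_conv_nth doubleton_eq_iff nth_eq_iff_index_eq)
  then show ?thesis
    using path_edges_nth_iff[OF assms] ne by (auto simp: cycle_edges_conv)
qed

text \<open>Allows the outer-cycle to be rotated.\<close>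

lemma end_cycles_cong:
  assumes "set cs = set cs'" "cycle_edges cs = cycle_edges cs'"
  shows "end_cycles V E cs = end_cycles V E cs'"
  using assms by (simp add: end_cycles_def num_interior_def interior_edges_def)

lemma cycle_edge_at_vertex:
  assumes "distinct cs" "3 \<le> length cs" "x \<in> set cs"
  obtains f where "f \<in> cycle_edges cs" "x \<in> f" "f \<noteq> g"
proof -
  obtain y z where "y \<noteq> z" "y \<noteq> x" "z \<noteq> x" "{x, y} \<in> cycle_edges cs" "{x, z} \<in> cycle_edges cs"
    by (rule cycle_neighbours[OF assms])
  then show thesis using that[of "{x, y}"] that[of "{x, z}"] by (auto simp: doubleton_eq_iff)
qed

text \<open>A shortest chord below a given one bounds an induced cycle with no further interior edge.\<close>

lemma end_cycle_below_chord:
  assumes simple: "simple_graph V E" and cyc: "cycle_in V E cs"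
    and "i < j" "j < length cs" "{cs ! i, cs ! j} \<in> E" "{cs ! i, cs ! j} \<notin> cycle_edges cs"
  shows "\<exists>S\<in>end_cycles V E cs. S \<subseteq> (!) cs ` {i..j}"
  using assms(3-)
proof (induction "j - i" arbitrary: i j rule: less_induct)
  case less
  have cs: "distinct cs" "set cs \<subseteq> V" "cycle_edges cs \<subseteq> E" using cyc by (auto simp: cycle_in_def)
  have nij: "j \<noteq> Suc i" "\<not> (i = 0 \<and> j = length cs - 1)"
    using less.prems cycle_edges_nth_iff[OF cs(1), of i j] by auto
  show ?case
  proof (cases "\<exists>a b. i \<le> a \<and> a < b \<and> b \<le> j \<and> {cs ! a, cs ! b} \<in> E \<and> b \<noteq> Suc a \<and> (a, b) \<noteq> (i, j)")
    case True
    then obtain a b where ab: "i \<le> a" "a < b" "b \<le> j" "{cs ! a, cs ! b} \<in> E" "b \<noteq> Suc a" "(a, b) \<noteq> (i, j)"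
      by blast
    \<comment> \<open>The pair \<open>(a, b)\<close> consists of the first and the last position
      only if \<open>(i, j)\<close> does too, which is excluded.\<close>
    then have "{cs ! a, cs ! b} \<notin> cycle_edges cs"
      using cycle_edges_nth_iff[OF cs(1), of a b] less.prems nij by auto
    moreover have "b - a < j - i" using ab by auto
    ultimately obtain S where "S \<in> end_cycles V E cs" "S \<subseteq> (!) cs ` {a..b}"
      using less.hyps[of b a] ab less.prems by auto
    moreover have "(!) cs ` {a..b} \<subseteq> (!) cs ` {i..j}" using ab by auto
    ultimately show ?thesis by blast
  next
    case False
    define S where "S = (!) cs ` {i..j}"
    define ws where "ws = map ((!) cs) [i..<Suc j]"
    have ws: "set ws = S" "distinct ws" "length ws = Suc j - i"
      using cs(1) less.prems
      by (auto simp: ws_def S_def distinct_map inj_on_def nth_eq_iff_index_eq simp del: upt_Suc)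
    have hl: "hd ws = cs ! i" "last ws = cs ! j"
      using less.prems by (simp_all add: ws_def hd_map last_map)
    have ne: "ws \<noteq> []" using ws less.prems by auto
    have pe: "path_edges ws = {{cs ! k, cs ! Suc k} | k. i \<le> k \<and> k < j}"
      by (simp add: ws_def path_edges_map_upt del: upt_Suc)
    then have ce: "cycle_edges ws = insert {cs ! i, cs ! j} {{cs ! k, cs ! Suc k} | k. i \<le> k \<and> k < j}"
      using ne by (simp add: cycle_edges_conv hl insert_commute)
    have pc: "{{cs ! k, cs ! Suc k} | k. i \<le> k \<and> k < j} \<subseteq> cycle_edges cs"
      using less.prems cycle_edges_nth_iff[OF cs(1)] by auto
    have ie: "induced_edges E S = cycle_edges ws"
    proof
      show "induced_edges E S \<subseteq> cycle_edges ws"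
      proof
        fix e assume "e \<in> induced_edges E S"
        then have e: "e \<in> E" "e \<subseteq> S" "card e = 2"
          using simple by (auto simp: induced_edges_def simple_graph_def)
        then obtain a b where ab: "e = {cs ! a, cs ! b}" "a \<in> {i..j}" "b \<in> {i..j}" "cs ! a \<noteq> cs ! b"
          by (auto simp: card_2_iff S_def)
        have *: "e \<in> cycle_edges ws" if "a < b" "e = {cs ! a, cs ! b}" "i \<le> a" "b \<le> j" for a b
        proof -
          have "b = Suc a \<or> (a, b) = (i, j)" using False that e by blast
          then show ?thesis using that unfolding ce by auto
        qed
        have "a < b \<or> b < a" using ab by (metis nat_neq_iff)
        then show "e \<in> cycle_edges ws" using *[of a b] *[of b a] ab by (auto simp: insert_commute)
      qed
      have "cycle_edges ws \<subseteq> E" using ce pc cs(3) less.prems by auto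
      then show "cycle_edges ws \<subseteq> induced_edges E S"
        using cycle_edges_subset[of _ ws] ws(1) unfolding induced_edges_def by blast
    qed
    have SV: "S \<subseteq> V" using cs(2) less.prems by (auto simp: S_def)
    have "hamiltonian_cycle S (induced_edges E S) ws"
      unfolding hamiltonian_cycle_def cycle_in_def ie using ws nij less.prems by auto
    then have "induced_cycle V E S"
      unfolding induced_cycle_def is_cycle_graph_def using ie SV by blast
    moreover have "interior_edges E cs \<inter> induced_edges E S = {{cs ! i, cs ! j}}"
    proof -
      have "{cs ! i, cs ! j} \<in> interior_edges E cs"
        using less.prems by (simp add: interior_edges_def induced_edges_def)
      moreover have "interior_edges E cs \<inter> cycle_edges cs = {}" by (auto simp: interior_edges_def)
      ultimately show ?thesis unfolding ie ce using pc by blast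
    qed
    ultimately have "S \<in> end_cycles V E cs" by (simp add: end_cycles_def num_interior_def)
    then show ?thesis unfolding S_def by blast
  qed
qed

lemma (in outerplane_graph) chords_noncrossing_nth:
  assumes cyc: "cycle_in V E cs" and idx: "a < b" "b < c" "c < d" "d < length cs"
    and e: "{cs ! a, cs ! c} \<in> E" "{cs ! b, cs ! d} \<in> E"
  shows False
proof -
  define ps where "ps = drop (Suc a) (take c cs)"
  define qs where "qs = drop (Suc c) cs @ take a cs"
  have "cs = take a cs @ cs ! a # ps @ cs ! c # drop (Suc c) cs"
  proof -
    have "cs = take c cs @ cs ! c # drop (Suc c) cs" using idx by (simp add: id_take_nth_drop)
    moreover have "take c cs = take a cs @ cs ! a # ps"
      using id_take_nth_drop[of a "take c cs"] idx by (simp add: ps_def min_def)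
    ultimately show ?thesis by simp
  qed
  then have "rotate a cs = cs ! a # ps @ cs ! c # qs"
    using rotate_append[of "take a cs" "cs ! a # ps @ cs ! c # drop (Suc c) cs"] idx
    by (simp add: qs_def)
  then have "cycle_in V E (cs ! a # ps @ cs ! c # qs)" using cyc cycle_in_rotate by metis
  moreover have "cs ! b \<in> set ps"
  proof -
    have "ps ! (b - Suc a) = cs ! b" "b - Suc a < length ps" using idx by (auto simp: ps_def)
    then show ?thesis by (metis nth_mem)
  qed
  moreover have "cs ! d \<in> set qs"
  proof -
    have "drop (Suc c) cs ! (d - Suc c) = cs ! d" "d - Suc c < length (drop (Suc c) cs)"
      using idx by auto
    then have "cs ! d \<in> set (drop (Suc c) cs)" by (metis nth_mem)
    then show ?thesis by (simp add: qs_def)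
  qed
  ultimately show False using chords_noncrossing e by blast
qed

text \<open>Since \<open>y\<close> is injective, the paths can be indexed by their attachment
  vertices; the default \<open>[]\<close> makes the function total. All paths are oriented towards
  the core, so that the joining edge starts at the last vertex.\<close>

lemma pendant_path_function:
  assumes P: "disjoint_union_of_paths (V - R) (induced_edges E (V - R)) k P"
    and j: "\<forall>i<k. P i \<noteq> [] \<and> joined_at E R (P i) (y i)" and inj: "inj_on y {..<k}"
  obtains T where "\<forall>w. w \<notin> y ` {..<k} \<longrightarrow> T w = []" "\<forall>w. distinct (T w)"
    "\<forall>w w'. w \<noteq> w' \<longrightarrow> set (T w) \<inter> set (T w') = {}" "(\<Union>w. set (T w)) = V - R"
    "(\<Union>w. path_edges (T w)) = induced_edges E (V - R)"
    "\<forall>w. T w \<noteq> [] \<longrightarrow> {e \<in> E. e \<inter> set (T w) \<noteq> {} \<and> e \<inter> R \<noteq> {}} = {{last (T w), w}}"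
proof -
  \<comment> \<open>\<open>joined_at\<close> permits either end of the path to be the joined one; a
    reversal turns it into the last vertex.\<close>
  define Q where "Q i = (if {e \<in> E. e \<inter> set (P i) \<noteq> {} \<and> e \<inter> R \<noteq> {}} = {{last (P i), y i}}
    then P i else rev (P i))" for i
  have Q: "set (Q i) = set (P i)" "path_edges (Q i) = path_edges (P i)" "distinct (Q i) = distinct (P i)"
    for i by (auto simp: Q_def)
  have Qlast: "{e \<in> E. e \<inter> set (Q i) \<noteq> {} \<and> e \<inter> R \<noteq> {}} = {{last (Q i), y i}}" if "i < k" for i
  proof -
    let ?F = "{e \<in> E. e \<inter> set (P i) \<noteq> {} \<and> e \<inter> R \<noteq> {}}"
    have "P i \<noteq> []" and ji: "joined_at E R (P i) (y i)" using j that by auto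
    from ji obtain x where x: "x = hd (P i) \<or> x = last (P i)" "?F = {{x, y i}}"
      unfolding joined_at_def by blast
    show ?thesis
    proof (cases "?F = {{last (P i), y i}}")
      case True
      then show ?thesis by (simp add: Q_def)
    next
      case False
      then have "Q i = rev (P i)" "x = hd (P i)" using x by (auto simp: Q_def)
      then show ?thesis using x(2) \<open>P i \<noteq> []\<close> by (simp add: last_rev)
    qed
  qed
  define T where "T w = (if w \<in> y ` {..<k} then Q (inv_into {..<k} y w) else [])" for w
  have Ty: "T (y i) = Q i" if "i < k" for i using inj that by (simp add: T_def)
  have Tcases: "T w = [] \<and> w \<notin> y ` {..<k} \<or> (\<exists>i<k. w = y i \<and> T w = Q i)" for w
    using Ty by (auto simp: T_def)
  have un: "(\<Union>w. f (T w)) = (\<Union>i<k. f (Q i))" if "f [] = {}" for f :: "'a list \<Rightarrow> 'e set"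
  proof
    show "(\<Union>w. f (T w)) \<subseteq> (\<Union>i<k. f (Q i))"
    proof (rule UN_least)
      fix w show "f (T w) \<subseteq> (\<Union>i<k. f (Q i))" using Tcases[of w] that by auto
    qed
    show "(\<Union>i<k. f (Q i)) \<subseteq> (\<Union>w. f (T w))" using Ty by (auto, metis)
  qed
  have disj: "set (T w) \<inter> set (T w') = {}" if "w \<noteq> w'" for w w'
    using Tcases[of w] Tcases[of w'] that P
    by (elim disjE conjE exE) (simp_all add: Q disjoint_union_of_paths_def, metis)
  have joined: "{e \<in> E. e \<inter> set (T w) \<noteq> {} \<and> e \<inter> R \<noteq> {}} = {{last (T w), w}}"
    if ne: "T w \<noteq> []" for w
  proof -
    obtain i where i: "i < k" "w = y i" "T w = Q i" using Tcases[of w] ne by blast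
    show ?thesis using Qlast[OF i(1)] i by simp
  qed
  show thesis
  proof (rule that)
    show "\<forall>w. w \<notin> y ` {..<k} \<longrightarrow> T w = []" by (simp add: T_def)
    show "\<forall>w. distinct (T w)"
    proof
      fix w show "distinct (T w)"
        using Tcases[of w] P Q(3) by (auto simp: disjoint_union_of_paths_def)
    qed
    show "\<forall>w w'. w \<noteq> w' \<longrightarrow> set (T w) \<inter> set (T w') = {}" using disj by blast
    show "(\<Union>w. set (T w)) = V - R"
      using un[of set] P by (simp add: Q disjoint_union_of_paths_def)
    show "(\<Union>w. path_edges (T w)) = induced_edges E (V - R)"
      using un[of path_edges] P unfolding Q disjoint_union_of_paths_def by auto
    show "\<forall>w. T w \<noteq> [] \<longrightarrow> {e \<in> E. e \<inter> set (T w) \<noteq> {} \<and> e \<inter> R \<noteq> {}} = {{last (T w), w}}"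
      using joined by blast
  qed
qed

section \<open>Prolonging paths of the core by their tails\<close>

locale tailed_core =
  fixes V :: "'a set" and E :: "'a set set" and R :: "'a set" and T :: "'a \<Rightarrow> 'a list"
  assumes simple: "simple_graph V E" and R: "R \<subseteq> V"
    and distinct_T: "\<And>w. distinct (T w)"
    and disjoint_T: "\<And>w w'. w \<noteq> w' \<Longrightarrow> set (T w) \<inter> set (T w') = {}"
    and Union_T: "(\<Union>w. set (T w)) = V - R"
    and edges_T: "(\<Union>w. path_edges (T w)) = induced_edges E (V - R)"
    and joined_T: "\<And>w. T w \<noteq> [] \<Longrightarrow> {e \<in> E. e \<inter> set (T w) \<noteq> {} \<and> e \<inter> R \<noteq> {}} = {{last (T w), w}}"
begin

text \<open>If \<open>ws\<close> is a single vertex, then its tail is put in front of it and nothing is left to be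
  appended.\<close>

definition closing_tail :: "'a list \<Rightarrow> 'a list" where
  "closing_tail ws = (if last ws = hd ws then [] else T (last ws))"

definition extend :: "'a list \<Rightarrow> 'a list" where
  "extend ws = T (hd ws) @ ws @ rev (closing_tail ws)"

lemma T_disjoint_R: "set (T w) \<inter> R = {}"
  using Union_T by blast

lemma T_subset: "set (T w) \<subseteq> V"
  using Union_T by blast

lemma same_tail: "x \<in> set (T w) \<Longrightarrow> x \<in> set (T w') \<Longrightarrow> w = w'"
  using disjoint_T by blast

text \<open>An edge that avoids \<open>R\<close> belongs to some path of \<open>G - R\<close>, by
  disjointness to this one; an edge that meets \<open>R\<close> is the joining edge.\<close>

lemma edge_tail_cases:
  assumes e: "e \<in> E" "e \<inter> set (T w) \<noteq> {}"
  shows "e \<in> path_edges (T w) \<or> e = {last (T w), w}"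
proof (cases "e \<inter> R = {}")
  case True
  then have "e \<in> induced_edges E (V - R)"
    using e simple by (auto simp: induced_edges_def simple_graph_def)
  then obtain w' where w': "e \<in> path_edges (T w')" using edges_T by blast
  then have "w' = w" using e path_edges_subset[OF w'] same_tail by blast
  with w' show ?thesis by simp
next
  case False
  then have "e \<in> {e \<in> E. e \<inter> set (T w) \<noteq> {} \<and> e \<inter> R \<noteq> {}}" using e by simp
  moreover have "T w \<noteq> []" using e by auto
  ultimately show ?thesis using joined_T by blast
qed

lemma joined_T_edge: "T w \<noteq> [] \<Longrightarrow> {last (T w), w} \<in> E"
  using joined_T by blast

lemma closing_tail_cases: "closing_tail ws = [] \<or> last ws \<noteq> hd ws \<and> closing_tail ws = T (last ws)"
  by (simp add: closing_tail_def)

lemma set_extend: "set (extend ws) = set (T (hd ws)) \<union> set ws \<union> set (T (last ws))"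
  by (auto simp: extend_def closing_tail_def)

lemma distinct_extend:
  assumes "distinct ws" "set ws \<subseteq> R"
  shows "distinct (extend ws)"
proof -
  have "set (T w) \<inter> set ws = {}" for w using T_disjoint_R[of w] assms by blast
  then show ?thesis
    using assms(1) distinct_T disjoint_T[of "hd ws" "last ws"] disjoint_T[of "last ws" "hd ws"]
    by (auto simp: extend_def closing_tail_def)
qed

lemma path_edges_extend:
  assumes "ws \<noteq> []"
  shows "path_edges (extend ws) = path_edges (T (hd ws)) \<union> path_edges ws \<union> path_edges (closing_tail ws) \<union>
    (if T (hd ws) = [] then {} else {{last (T (hd ws)), hd ws}}) \<union>
    (if closing_tail ws = [] then {} else {{last (closing_tail ws), last ws}})"
  using assms
  by (cases "T (hd ws) = []"; cases "closing_tail ws = []")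
    (auto simp: extend_def path_edges_append hd_rev insert_commute)

text \<open>Edges that meet a tail are known from \<open>edge_tail_cases\<close>, and every other
  edge has both ends on \<open>ws\<close>, where chords are excluded.\<close>

lemma induced_edges_extend:
  assumes ws: "ws \<noteq> []" "distinct ws" "set ws \<subseteq> R"
    and path: "path_edges ws \<subseteq> E"
    and chordless: "\<And>i j. i < j \<Longrightarrow> j < length ws \<Longrightarrow> {ws ! i, ws ! j} \<in> E \<Longrightarrow> j = Suc i"
  shows "induced_edges E (set (extend ws)) = path_edges (extend ws)"
proof
  have h: "hd ws \<in> set ws" "last ws \<in> set ws" using ws by auto
  show "induced_edges E (set (extend ws)) \<subseteq> path_edges (extend ws)"
  proof
    fix e assume "e \<in> induced_edges E (set (extend ws))"
    then have e: "e \<in> E" "e \<subseteq> set (extend ws)" "card e = 2"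
      using simple by (auto simp: induced_edges_def simple_graph_def)
    consider "e \<subseteq> set ws" | "e \<inter> set (T (hd ws)) \<noteq> {}"
      | "last ws \<noteq> hd ws" "e \<inter> set (T (last ws)) \<noteq> {}"
      using e(2) unfolding set_extend by (cases "last ws = hd ws") auto
    then show "e \<in> path_edges (extend ws)"
    proof cases
      case 1
      obtain x y where "e = {x, y}" "x \<noteq> y" using e by (auto simp: card_2_iff)
      then obtain i j where ij: "e = {ws ! i, ws ! j}" "i < length ws" "j < length ws" "i \<noteq> j"
        using 1 by (auto simp: in_set_conv_nth)
      then have "e \<in> path_edges ws"
        using chordless[of i j] chordless[of j i] e(1)
        by (cases "i < j") (auto simp: path_edges_def insert_commute)
      then show ?thesis by (simp add: path_edges_extend[OF ws(1)])
    next
      case 2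
      then have "T (hd ws) \<noteq> []" by auto
      then show ?thesis
        using edge_tail_cases[OF e(1) 2] by (auto simp: path_edges_extend[OF ws(1)])
    next
      case 3
      then have "closing_tail ws = T (last ws)" "T (last ws) \<noteq> []" by (auto simp: closing_tail_def)
      then show ?thesis
        using edge_tail_cases[OF e(1) 3(2)] by (auto simp: path_edges_extend[OF ws(1)])
    qed
  qed
  have "path_edges (extend ws) \<subseteq> E"
  proof -
    have tE: "path_edges (T w) \<subseteq> E" for w using edges_T by (auto simp: induced_edges_def)
    moreover have "{last (closing_tail ws), last ws} \<in> E" if "closing_tail ws \<noteq> []"
      using closing_tail_cases[of ws] that joined_T_edge[of "last ws"] by auto
    moreover have "path_edges (closing_tail ws) \<subseteq> E"
      using closing_tail_cases[of ws] tE[of "last ws"] by auto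
    ultimately show ?thesis
      using path joined_T_edge[of "hd ws"] tE[of "hd ws"] by (auto simp: path_edges_extend[OF ws(1)])
  qed
  then show "path_edges (extend ws) \<subseteq> induced_edges E (set (extend ws))"
    using path_edges_subset by (auto simp: induced_edges_def)
qed

lemma extend_nth:
  assumes "distinct ws" "set ws \<subseteq> R" "i < length (extend ws)" "extend ws ! i \<in> set ws"
  obtains i' where "i = length (T (hd ws)) + i'" "i' < length ws" "extend ws ! i = ws ! i'"
proof -
  obtain i' where i': "i' < length ws" "ws ! i' = extend ws ! i"
    using assms(4) by (auto simp: in_set_conv_nth)
  have "extend ws ! (length (T (hd ws)) + i') = ws ! i'" using i' by (simp add: extend_def nth_append)
  moreover have "length (T (hd ws)) + i' < length (extend ws)" using i' by (simp add: extend_def)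
  ultimately have "i = length (T (hd ws)) + i'"
    using distinct_extend[OF assms(1,2)] assms(3) i' by (simp add: nth_eq_iff_index_eq)
  with i' that show thesis by simp
qed

text \<open>In the cyclic order \<open>as @ bs\<close> the second part runs against the first, so it
  is reversed to become parallel; accordingly \<open>nc\<close> forbids pairs of edges with both
  indices increasing. The tails add no edges between the two paths.\<close>

lemma two_parallel_paths_extend:
  assumes ab: "as \<noteq> []" "bs \<noteq> []" "distinct (as @ bs)" "set (as @ bs) = R"
    and ce: "cycle_edges (as @ bs) \<subseteq> E"
    and as: "\<And>i j. i < j \<Longrightarrow> j < length as \<Longrightarrow> {as ! i, as ! j} \<in> E \<Longrightarrow> j = Suc i"
    and bs: "\<And>i j. i < j \<Longrightarrow> j < length bs \<Longrightarrow> {bs ! i, bs ! j} \<in> E \<Longrightarrow> j = Suc i"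
    and T: "\<And>w. w \<notin> {hd as, last as, hd bs, last bs} \<Longrightarrow> T w = []"
    and nc: "\<And>i x j y. i < x \<Longrightarrow> x < length as \<Longrightarrow> j < y \<Longrightarrow> y < length bs \<Longrightarrow>
      {as ! i, bs ! j} \<in> E \<Longrightarrow> {as ! x, bs ! y} \<in> E \<Longrightarrow> False"
  shows "two_parallel_paths V E"
proof -
  define vs where "vs = extend as"
  define us where "us = rev (extend bs)"
  have d: "distinct as" "distinct bs" "set as \<inter> set bs = {}" and sub: "set as \<subseteq> R" "set bs \<subseteq> R"
    using ab by auto
  have h: "hd as \<in> set as" "last as \<in> set as" "hd bs \<in> set bs" "last bs \<in> set bs" using ab by auto
  have pe: "path_edges as \<subseteq> E" "path_edges bs \<subseteq> E"
    using ce ab by (auto simp: cycle_edges_append)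
  have dist: "distinct vs" "distinct us"
    using distinct_extend d sub by (auto simp: vs_def us_def)
  have ind: "induced_edges E (set vs) = path_edges vs" "induced_edges E (set us) = path_edges us"
    using induced_edges_extend[OF ab(1) d(1) sub(1) pe(1) as]
      induced_edges_extend[OF ab(2) d(2) sub(2) pe(2) bs]
    by (simp_all add: vs_def us_def)
  have subV: "set vs \<subseteq> V" "set us \<subseteq> V"
    using T_subset sub R by (auto simp: vs_def us_def set_extend)
  have disj: "set vs \<inter> set us = {}"
  proof -
    have "set (T w) \<inter> set (T w') = {}" if "w \<in> set as" "w' \<in> set bs" for w w'
      using disjoint_T[of w w'] that d by auto
    then show ?thesis
      using h T_disjoint_R sub d unfolding vs_def us_def set_rev set_extend by blast
  qed
  have un: "set vs \<union> set us = V"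
  proof
    show "V \<subseteq> set vs \<union> set us"
    proof
      fix x assume "x \<in> V"
      show "x \<in> set vs \<union> set us"
      proof (cases "x \<in> R")
        case True
        then show ?thesis using ab(4) by (auto simp: vs_def us_def set_extend)
      next
        case False
        then obtain w where w: "x \<in> set (T w)" using Union_T \<open>x \<in> V\<close> by blast
        have "w \<in> {hd as, last as, hd bs, last bs}"
        proof (rule ccontr)
          assume "w \<notin> {hd as, last as, hd bs, last bs}"
          then have "T w = []" by (rule T)
          with w show False by simp
        qed
        with w show ?thesis by (auto simp: vs_def us_def set_extend)
      qed
    qed
  qed (use subV in auto)
  have Tus: "set (T w) \<inter> set us = {}" if w: "w \<in> set as" for w
  proof -
    have "w \<noteq> hd bs" "w \<noteq> last bs" using w h d by auto
    then show ?thesis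
      using disjoint_T[of w "hd bs"] disjoint_T[of w "last bs"] T_disjoint_R[of w] sub
      unfolding us_def set_rev set_extend by blast
  qed
  have Tvs: "set (T w) \<inter> set vs = {}" if w: "w \<in> set bs" for w
  proof -
    have "w \<noteq> hd as" "w \<noteq> last as" using w h d by auto
    then show ?thesis
      using disjoint_T[of w "hd as"] disjoint_T[of w "last as"] T_disjoint_R[of w] sub
      unfolding vs_def set_extend by blast
  qed
  \<comment> \<open>An edge at a tail stays within the tail or ends at its attachment vertex, and
    both belong to the same prolonged path.\<close>
  have between: "x \<in> set as \<and> z \<in> set bs" if x: "x \<in> set vs" and z: "z \<in> set us" and e: "{x, z} \<in> E" for x z
  proof -
    have xT: "x \<notin> set (T w)" if w: "w \<in> set as" for w
    proof
      assume "x \<in> set (T w)"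
      then have "{x, z} \<in> path_edges (T w) \<or> {x, z} = {last (T w), w}"
        using edge_tail_cases[OF e] by auto
      then have "z \<in> set (T w) \<or> z = w"
        using path_edges_subset[of "{x, z}" "T w"] \<open>x \<in> set (T w)\<close> T_disjoint_R[of w] w sub
        by (auto simp: doubleton_eq_iff)
      moreover have "z \<notin> set as" using z disj by (auto simp: vs_def set_extend)
      moreover have "z \<notin> set (T w)" using z Tus[OF w] by blast
      ultimately show False using w by auto
    qed
    have zT: "z \<notin> set (T w)" if w: "w \<in> set bs" for w
    proof
      assume "z \<in> set (T w)"
      then have "{x, z} \<in> path_edges (T w) \<or> {x, z} = {last (T w), w}"
        using edge_tail_cases[OF e] by auto
      then have "x \<in> set (T w) \<or> x = w"
        using path_edges_subset[of "{x, z}" "T w"] \<open>z \<in> set (T w)\<close> T_disjoint_R[of w] w sub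
        by (auto simp: doubleton_eq_iff)
      moreover have "x \<notin> set bs" using x disj by (auto simp: us_def set_extend)
      moreover have "x \<notin> set (T w)" using x Tvs[OF w] by blast
      ultimately show False using w by auto
    qed
    show ?thesis using x z xT h zT by (auto simp: vs_def us_def set_extend)
  qed
  have cross: False
    if "i < x" "x < length vs" "y < j" "j < length us" "{vs ! i, us ! j} \<in> E" "{vs ! x, us ! y} \<in> E"
    for i x j y
  proof -
    have il: "i < length vs" "x < length vs" using that by simp_all
    have in_ab: "vs ! i \<in> set as" "us ! j \<in> set bs" "vs ! x \<in> set as" "us ! y \<in> set bs"
      using between[of "vs ! i" "us ! j"] between[of "vs ! x" "us ! y"] that by auto
    obtain i' where i': "i = length (T (hd as)) + i'" "i' < length as" "vs ! i = as ! i'"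
      using extend_nth[OF d(1) sub(1), of i] in_ab il by (auto simp: vs_def)
    obtain x' where x': "x = length (T (hd as)) + x'" "x' < length as" "vs ! x = as ! x'"
      using extend_nth[OF d(1) sub(1), of x] in_ab il by (auto simp: vs_def)
    \<comment> \<open>Positions on the reversed list \<open>us\<close> are turned back into
      positions on \<open>extend bs\<close>, which inverts their order.\<close>
    define J where "J = length us - Suc j"
    define Y where "Y = length us - Suc y"
    have JY: "us ! j = extend bs ! J" "us ! y = extend bs ! Y" "J < Y" "Y < length (extend bs)"
      using that by (auto simp: us_def J_def Y_def rev_nth)
    have Jl: "J < length (extend bs)" using JY by simp
    obtain j' where j': "J = length (T (hd bs)) + j'" "j' < length bs" "extend bs ! J = bs ! j'"
      using extend_nth[OF d(2) sub(2), of J] in_ab JY Jl by auto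
    obtain y' where y': "Y = length (T (hd bs)) + y'" "y' < length bs" "extend bs ! Y = bs ! y'"
      using extend_nth[OF d(2) sub(2), of Y] in_ab JY by auto
    show False using nc[of i' x' j' y'] that i' x' j' y' JY by auto
  qed
  have "card V = length vs + length us"
    using dist disj un by (metis card_Un_disjoint distinct_card List.finite_set)
  moreover have "vs \<noteq> []" "us \<noteq> []" using ab by (auto simp: vs_def us_def extend_def)
  ultimately show ?thesis
    unfolding two_parallel_paths_def induced_path_def is_path_graph_def
    using dist ind subV disj cross
    by (intro disjI1 exI[of _ vs] exI[of _ us]) (metis (no_types, lifting))
qed

end

section \<open>Choosing the two edges of the outer-cycle to remove\<close>

lemma cover_by_two_cycle_edges:
  assumes cs: "distinct cs" "3 \<le> length cs" and Y: "Y \<subseteq> set cs" "card Y \<le> 4"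
    and F: "F \<subseteq> cycle_edges cs" "\<And>e. e \<in> F \<Longrightarrow> e \<subseteq> Y"
    and iso: "3 \<le> card Y \<Longrightarrow>
      \<exists>H\<in>{graph_K2_K1, graph_2K2, graph_P 3, graph_P 4, graph_C 3, graph_C 4}. graph_iso (Y, F) H"
  shows "\<exists>f\<in>cycle_edges cs. \<exists>g\<in>cycle_edges cs. f \<noteq> g \<and> Y \<subseteq> f \<union> g"
proof -
  have fin: "finite Y" using Y finite_subset by auto
  \<comment> \<open>An edge may leave one vertex uncovered: each vertex lies on two edges of the
    cycle, so a second edge through it can be chosen.\<close>
  have one: ?thesis if f: "f \<in> cycle_edges cs" "Y \<subseteq> f \<union> {x}" "x \<in> set cs" for f x
  proof -
    obtain g where "g \<in> cycle_edges cs" "x \<in> g" "g \<noteq> f"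
      by (rule cycle_edge_at_vertex[OF cs f(3)])
    then show ?thesis using f by blast
  qed
  have ne: "hd cs \<in> set cs" using cs by (cases cs) auto
  consider "card Y = 0" | "card Y = 1" | "card Y = 2" | "card Y = 3" | "card Y = 4" using Y(2) by linarith
  then show ?thesis
  proof cases
    case 1
    obtain f where "f \<in> cycle_edges cs" by (rule cycle_edge_at_vertex[OF cs ne])
    then show ?thesis using one[of f "hd cs"] ne 1 fin by auto
  next
    case 2
    then obtain a where a: "Y = {a}" by (auto simp: card_1_singleton_iff)
    obtain f where "f \<in> cycle_edges cs" by (rule cycle_edge_at_vertex[OF cs ne])
    then show ?thesis using one[of f a] a Y by auto
  next
    case 3
    then obtain a b where ab: "Y = {a, b}" by (auto simp: card_2_iff)
    then obtain f where "f \<in> cycle_edges cs" "a \<in> f"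
      using cycle_edge_at_vertex[OF cs, of a] Y by auto
    then show ?thesis using one[of f b] ab Y by auto
  next
    case 4
    have "3 \<le> card Y" using 4 by simp
    from iso[OF this] obtain H
      where H: "H \<in> {graph_K2_K1, graph_2K2, graph_P 3, graph_P 4, graph_C 3, graph_C 4}"
        "graph_iso (Y, F) H"
      by (rule bexE)
    obtain h where h: "bij_betw h Y (fst H)" "snd H = (`) h ` F"
      using H(2) by (auto simp: graph_iso_def)
    have "card (fst H) = 3" using bij_betw_same_card[OF h(1)] 4 by simp
    \<comment> \<open>Each graph of the list on three vertices has an edge, which covers all but one
      of them.\<close>
    then have "{0, 1} \<in> snd H"
      using H(1)
      by (auto simp: graph_K2_K1_def graph_2K2_def graph_P_3 graph_P_4 graph_C_3 graph_C_4)
    then obtain e where e: "e \<in> F" using h(2) by auto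
    have "card e = 2"
    proof -
      have "e \<in> cycle_edges cs" using e F by auto
      then obtain n where "e = {last (rotate n cs), hd (rotate n cs)}" by (rule cycle_edge_rotate)
      moreover have "last (rotate n cs) \<noteq> hd (rotate n cs)"
      proof -
        have "distinct (rotate n cs)" "3 \<le> length (rotate n cs)" using cs by simp_all
        then show ?thesis by (cases "rotate n cs") auto
      qed
      ultimately show ?thesis by simp
    qed
    then have "card (Y - e) = 1"
      using card_Diff_subset[of e Y] F(2)[OF e] fin 4 finite_subset by fastforce
    then obtain x where "Y - e = {x}" by (auto simp: card_1_singleton_iff)
    then have "Y \<subseteq> e \<union> {x}" "x \<in> set cs" using Y by auto
    then show ?thesis using one[of e x] e F by auto
  next
    case 5
    have "3 \<le> card Y" using 5 by simp
    from iso[OF this] obtain H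
      where H: "H \<in> {graph_K2_K1, graph_2K2, graph_P 3, graph_P 4, graph_C 3, graph_C 4}"
        "graph_iso (Y, F) H"
      by (rule bexE)
    obtain h where h: "bij_betw h Y (fst H)" "snd H = (`) h ` F"
      using H(2) by (auto simp: graph_iso_def)
    have "card (fst H) = 4" using bij_betw_same_card[OF h(1)] 5 by simp
    \<comment> \<open>Each graph of the list on four vertices has these two edges as a perfect
      matching.\<close>
    then have "fst H = {0, 1, 2, 3} \<and> {0, 1} \<in> snd H \<and> {2, 3} \<in> snd H"
      using H(1)
      by (auto simp: graph_K2_K1_def graph_2K2_def graph_P_3 graph_P_4 graph_C_3 graph_C_4)
    then have H4: "fst H = {0, 1, 2, 3}" "{0, 1} \<in> snd H" "{2, 3} \<in> snd H" by auto
    then obtain e f where ef: "e \<in> F" "h ` e = {0, 1}" "f \<in> F" "h ` f = {2, 3}"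
      using h(2) by (auto simp: image_iff)
    have "Y \<subseteq> e \<union> f"
    proof
      fix y assume y: "y \<in> Y"
      then have "h y \<in> {0, 1, 2, 3}" using bij_betw_apply[OF h(1) y] H4(1) by metis
      then have "h y \<in> h ` e \<or> h y \<in> h ` f" unfolding ef by blast
      moreover have "inj_on h Y" using h(1) by (simp add: bij_betw_def)
      ultimately show "y \<in> e \<union> f"
        using inj_on_image_mem_iff[OF _ y F(2)[OF ef(1)]] inj_on_image_mem_iff[OF _ y F(2)[OF ef(3)]]
        by blast
    qed
    moreover have "e \<noteq> f"
    proof
      assume "e = f"
      then have "(0 :: nat) \<in> {2, 3}" using ef(2,4) by (metis insertI1)
      then show False by simp
    qed
    moreover have "e \<in> cycle_edges cs" "f \<in> cycle_edges cs" using ef(1,3) F(1) by blast+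
    ultimately show ?thesis by (intro bexI[of _ e] bexI[of _ f] conjI)
  qed
qed

text \<open>Of the two edges of the end cycle at a vertex at most one is its only interior edge, and
  the other is on the outer-cycle. This settles all cases but that of two vertices in
  \<open>Z\<close>, which are consecutive by \<open>consec\<close>.\<close>

lemma end_cycle_contains_edge:
  assumes C: "C \<in> end_cycles V E cs" "C \<subseteq> set cs" and Z: "Z \<subseteq> C" "card Z \<le> 2"
    and consec: "\<And>a b. a \<in> Z \<Longrightarrow> b \<in> Z \<Longrightarrow> a \<noteq> b \<Longrightarrow> {a, b} \<in> cycle_edges cs"
  shows "\<exists>f\<in>cycle_edges cs. f \<subseteq> C \<and> Z \<subseteq> f"
proof -
  have fin: "finite Z" using Z C finite_subset[of _ "set cs"] by blast
  obtain zs where zs: "cycle_in C (induced_edges E C) zs" "set zs = C" "induced_edges E C = cycle_edges zs"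
    using C(1) by (auto simp: end_cycles_def induced_cycle_def is_cycle_graph_def hamiltonian_cycle_def)
  have one: ?thesis if a: "a \<in> C" "Z \<subseteq> {a}" for a
  proof -
    obtain y z where yz: "y \<noteq> z" "y \<noteq> a" "z \<noteq> a" "{a, y} \<in> cycle_edges zs" "{a, z} \<in> cycle_edges zs"
      by (rule cycle_neighbours[of zs a]) (use zs a in \<open>auto simp: cycle_in_def\<close>)
    have "card (interior_edges E cs \<inter> cycle_edges zs) = 1"
      using C(1) zs(3) by (simp add: end_cycles_def num_interior_def)
    then obtain d where d: "interior_edges E cs \<inter> cycle_edges zs = {d}"
      by (auto simp: card_1_singleton_iff)
    have "{a, y} \<notin> interior_edges E cs \<or> {a, z} \<notin> interior_edges E cs"
    proof (rule ccontr)
      assume "\<not> ?thesis"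
      then have "{a, y} \<in> {d}" "{a, z} \<in> {d}" using yz(4,5) unfolding d[symmetric] by simp_all
      then show False using yz(1-3) by (auto simp: doubleton_eq_iff)
    qed
    then obtain w where w: "{a, w} \<in> cycle_edges zs" "{a, w} \<notin> interior_edges E cs" using yz by blast
    have "{a, w} \<in> induced_edges E C" using w zs by simp
    then have "{a, w} \<in> cycle_edges cs" "{a, w} \<subseteq> C"
      using w(2) C(2) by (auto simp: interior_edges_def induced_edges_def)
    then show ?thesis using a by blast
  qed
  show ?thesis
  proof (cases "card Z = 2")
    case True
    then obtain a b where ab: "Z = {a, b}" "a \<noteq> b" by (auto simp: card_2_iff)
    then show ?thesis using consec[of a b] Z(1) by blast
  next
    case False
    then consider "card Z = 0" | "card Z = 1" using Z(2) by linarith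
    then show ?thesis
    proof cases
      case 1
      have "hd zs \<in> C" using zs by (cases zs) (auto simp: cycle_in_def)
      then show ?thesis using one 1 fin by auto
    next
      case 2
      then obtain a where "Z = {a}" by (auto simp: card_1_singleton_iff)
      then show ?thesis using one[of a] Z by auto
    qed
  qed
qed

context outerplane_graph
begin

lemma two_parallel_paths_if_pendant_paths:
  assumes oc: "outer_cycle V E pos crv cs" and R: "R = core V E pos crv"
    and ends: "\<not> is_cycle_graph R (induced_edges E R) \<Longrightarrow> card (end_cycles V E cs) = 2"
    and pp: "pendant_paths V E R cs"
  shows "two_parallel_paths V E"
proof -
  have ham: "hamiltonian_cycle R (induced_edges E R) cs"
    using oc by (simp add: outer_cycle_def Let_def R)
  have RV: "R \<subseteq> V" by (auto simp: R core_def)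
  have cs: "distinct cs" "3 \<le> length cs" "set cs = R" "cycle_edges cs \<subseteq> E"
    using ham by (auto simp: hamiltonian_cycle_def cycle_in_def induced_edges_def)
  have cyc: "cycle_in V E cs" using cs RV by (simp add: cycle_in_def)
  have fin: "finite (induced_edges E R)" using finite_E by (simp add: induced_edges_def)
  have cyc_iff: "is_cycle_graph R (induced_edges E R) \<longleftrightarrow> induced_edges E R = cycle_edges cs"
    by (rule is_cycle_graph_iff[OF fin ham])
  obtain k P y where k: "k \<le> 4"
    and P: "disjoint_union_of_paths (V - R) (induced_edges E (V - R)) k P"
      "\<forall>i<k. P i \<noteq> [] \<and> joined_at E R (P i) (y i)" "inj_on y {..<k}"
    and nc: "\<not> is_cycle_graph R (induced_edges E R) \<longrightarrow>
      (\<forall>i<k. \<exists>S\<in>end_cycles V E cs. y i \<in> S) \<and>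
      (\<exists>\<phi>. (\<forall>i<k. \<phi> (y i) \<in> end_cycles V E cs \<and> y i \<in> \<phi> (y i)) \<and>
        (\<forall>C\<in>end_cycles V E cs. card {v \<in> y ` {..<k}. \<phi> v = C} \<le> 2) \<and>
        (\<forall>i<k. \<forall>j<k. i \<noteq> j \<and> \<phi> (y i) = \<phi> (y j) \<longrightarrow> {y i, y j} \<in> cycle_edges cs))"
    and c: "is_cycle_graph R (induced_edges E R) \<and> k \<ge> 3 \<longrightarrow>
      (\<exists>H\<in>{graph_K2_K1, graph_2K2, graph_P 3, graph_P 4, graph_C 3, graph_C 4}.
        graph_iso (y ` {..<k}, induced_edges E (y ` {..<k})) H)"
    using pp unfolding pendant_paths_def by (elim exE conjE) (rule that)
  define Y where "Y = y ` {..<k}"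
  have YR: "Y \<subseteq> R" using P(2) by (auto simp: Y_def joined_at_def)
  have cardY: "card Y = k" using P(3) by (simp add: Y_def card_image)
  \<comment> \<open>Whether or not there are chords, two edges of the outer-cycle are sought whose
    ends cover \<open>Y\<close> and whose removal leaves two paths without chords.\<close>
  have "\<exists>n as bs. rotate n cs = as @ bs \<and> as \<noteq> [] \<and> bs \<noteq> [] \<and> Y \<subseteq> {hd as, last as, hd bs, last bs} \<and>
      (\<forall>i j. i < j \<and> j < length as \<and> {as ! i, as ! j} \<in> E \<longrightarrow> j = Suc i) \<and>
      (\<forall>i j. i < j \<and> j < length bs \<and> {bs ! i, bs ! j} \<in> E \<longrightarrow> j = Suc i)"
  proof (cases "is_cycle_graph R (induced_edges E R)")
    case True
    then have eq: "induced_edges E R = cycle_edges cs" using cyc_iff by simp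
    have "\<exists>f\<in>cycle_edges cs. \<exists>g\<in>cycle_edges cs. f \<noteq> g \<and> Y \<subseteq> f \<union> g"
    proof (rule cover_by_two_cycle_edges[OF cs(1,2)])
      show "induced_edges E Y \<subseteq> cycle_edges cs" using YR eq by (auto simp: induced_edges_def)
      show "\<exists>H\<in>{graph_K2_K1, graph_2K2, graph_P 3, graph_P 4, graph_C 3, graph_C 4}.
          graph_iso (Y, induced_edges E Y) H" if "3 \<le> card Y"
        using c True that cardY by (simp add: Y_def)
    qed (use YR cs cardY k in \<open>auto simp: induced_edges_def\<close>)
    then obtain f g where fg: "f \<in> cycle_edges cs" "g \<in> cycle_edges cs" "f \<noteq> g" "Y \<subseteq> f \<union> g" by blast
    obtain n as bs where ab: "rotate n cs = as @ bs" "as \<noteq> []" "bs \<noteq> []"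
      "f = {last bs, hd as}" "g = {last as, hd bs}"
      by (rule two_cycle_edges_rotate[OF fg(1-3)])
    have d: "distinct (as @ bs)" "distinct (bs @ as)"
      using cs(1) ab(1) by (metis distinct_rotate, metis distinct_rotate distinct_append Int_commute)
    have ce: "cycle_edges (as @ bs) = cycle_edges cs" by (metis ab(1) cycle_edges_rotate)
    then have ce': "cycle_edges (bs @ as) = cycle_edges cs" using cycle_edges_append_commute by metis
    have sR: "set (as @ bs) = R" by (metis ab(1) cs(3) set_rotate)
    have chordless: "j = Suc i"
      if "distinct (us @ ws)" "cycle_edges (us @ ws) = cycle_edges cs" "set us \<subseteq> R" "ws \<noteq> []"
        "i < j" "j < length us" "{us ! i, us ! j} \<in> E" for us ws :: "'a list" and i j
    proof -
      have "us ! i \<in> R" "us ! j \<in> R" using that nth_mem[of _ us] by auto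
      then have "{us ! i, us ! j} \<in> induced_edges E R" using that(7) by (simp add: induced_edges_def)
      then have "{us ! i, us ! j} \<in> cycle_edges (us @ ws)" using eq that(2) by simp
      then have "{(us @ ws) ! i, (us @ ws) ! j} \<in> cycle_edges (us @ ws)"
        using that by (simp add: nth_append)
      moreover have "j \<noteq> length (us @ ws) - 1" using that(4,6) by (cases ws) auto
      ultimately show ?thesis
        using cycle_edges_nth_iff[OF that(1), of i j] that(5,6) by auto
    qed
    show ?thesis
      using ab fg(4) chordless[OF d(1) ce] chordless[OF d(2) ce'] sR
      by (intro exI[of _ n] exI[of _ as] exI[of _ bs]) auto
  next
    case False
    then obtain \<phi> where \<phi>: "\<forall>i<k. \<phi> (y i) \<in> end_cycles V E cs \<and> y i \<in> \<phi> (y i)"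
      "\<forall>C\<in>end_cycles V E cs. card {v \<in> Y. \<phi> v = C} \<le> 2"
      "\<forall>i<k. \<forall>j<k. i \<noteq> j \<and> \<phi> (y i) = \<phi> (y j) \<longrightarrow> {y i, y j} \<in> cycle_edges cs"
      using conjunct2[OF mp[OF nc False], folded Y_def] by (elim exE conjE) (rule that)
    obtain S1 S2 where S: "end_cycles V E cs = {S1, S2}" "S1 \<noteq> S2"
      using ends[OF False] by (auto simp: card_2_iff)
    have sub: "C \<subseteq> set cs" if "C \<in> end_cycles V E cs" for C
      using that induced_cycle_subset_core[of C] by (auto simp: end_cycles_def cs R)
    have edge: "\<exists>f\<in>cycle_edges cs. f \<subseteq> C \<and> {v \<in> Y. \<phi> v = C} \<subseteq> f" if C: "C \<in> end_cycles V E cs" for C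
    proof (rule end_cycle_contains_edge[OF C sub[OF C]])
      show "{v \<in> Y. \<phi> v = C} \<subseteq> C" using \<phi>(1) by (auto simp: Y_def)
      show "card {v \<in> Y. \<phi> v = C} \<le> 2" using \<phi>(2) C by blast
      show "{a, b} \<in> cycle_edges cs" if "a \<in> {v \<in> Y. \<phi> v = C}" "b \<in> {v \<in> Y. \<phi> v = C}" "a \<noteq> b" for a b
        using that \<phi>(3) unfolding Y_def by auto
    qed
    have S12: "S1 \<in> end_cycles V E cs" "S2 \<in> end_cycles V E cs" using S(1) by simp_all
    obtain f where f: "f \<in> cycle_edges cs" "f \<subseteq> S1" "{v \<in> Y. \<phi> v = S1} \<subseteq> f"
      using edge[OF S12(1)] by (elim bexE conjE) (rule that)
    obtain g where g: "g \<in> cycle_edges cs" "g \<subseteq> S2" "{v \<in> Y. \<phi> v = S2} \<subseteq> g"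
      using edge[OF S12(2)] by (elim bexE conjE) (rule that)
    have Yfg: "Y \<subseteq> f \<union> g"
    proof
      fix v assume v: "v \<in> Y"
      then have "\<phi> v = S1 \<or> \<phi> v = S2" using \<phi>(1) S(1) unfolding Y_def by blast
      then show "v \<in> f \<union> g" using v f(3) g(3) by auto
    qed
    \<comment> \<open>The list may be any rotation of the outer-cycle, so the closing edge can be
      placed at will. The end cycle found below the chord is \<open>S1\<close> or \<open>S2\<close>,
      and it brings \<open>f\<close> or \<open>g\<close> with it.\<close>
    have below: "f \<subseteq> (!) cs' ` {i..j} \<or> g \<subseteq> (!) cs' ` {i..j}"
      if cs': "cycle_edges cs' = cycle_edges cs" "set cs' = set cs" "distinct cs'" "length cs' = length cs"
        and ij: "i < j" "j < length cs'" "{cs' ! i, cs' ! j} \<in> E" "{cs' ! i, cs' ! j} \<notin> cycle_edges cs'"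
      for cs' i j
    proof -
      have "cycle_in V E cs'" using cyc cs' by (simp add: cycle_in_def)
      then obtain C where "C \<in> end_cycles V E cs'" "C \<subseteq> (!) cs' ` {i..j}"
        using end_cycle_below_chord[OF simple _ ij] by blast
      then have "C = S1 \<or> C = S2" "C \<subseteq> (!) cs' ` {i..j}"
        using end_cycles_cong[of cs' cs V E] cs' S by auto
      then show ?thesis using f g by blast
    qed
    \<comment> \<open>If \<open>f = g\<close>, rotate this edge into the closing position. The index
      interval of any chord would then contain both the first and the last position, so the chord
      would be \<open>f\<close> itself.\<close>
    have fg: "f \<noteq> g"
    proof
      assume "f = g"
      obtain n where n: "f = {last (rotate n cs), hd (rotate n cs)}" by (rule cycle_edge_rotate[OF f(1)])
      define cs' where "cs' = rotate n cs"
      have d: "distinct cs'" "cs' \<noteq> []" using cs by (auto simp: cs'_def)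
      obtain e where e: "e \<in> E" "e \<subseteq> R" "e \<notin> cycle_edges cs"
        using False cyc_iff ham
        by (auto simp: induced_edges_def hamiltonian_cycle_def cycle_in_def)
      obtain x z where xz: "e = {x, z}" "x \<noteq> z" using edge_card[OF e(1)] by (auto simp: card_2_iff)
      then have "x \<in> set cs'" "z \<in> set cs'" using e cs by (auto simp: cs'_def)
      then obtain i j where ij: "i < length cs'" "j < length cs'" "cs' ! i = x" "cs' ! j = z"
        by (auto simp: in_set_conv_nth)
      have False if "i < j" "j < length cs'" "e = {cs' ! i, cs' ! j}" for i j
      proof -
        have "f \<subseteq> (!) cs' ` {i..j}"
          using below[of cs' i j] that e \<open>f = g\<close> d by (auto simp: cs'_def)
        then have "last cs' \<in> (!) cs' ` {i..j}" "hd cs' \<in> (!) cs' ` {i..j}"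
          using n by (auto simp: cs'_def)
        then obtain a b where "a \<in> {i..j}" "cs' ! (length cs' - 1) = cs' ! a"
          "b \<in> {i..j}" "cs' ! 0 = cs' ! b"
          using d by (auto simp: last_conv_nth hd_conv_nth)
        then have "a = length cs' - 1" "b = 0" "a \<in> {i..j}" "b \<in> {i..j}"
          using d that by (auto simp: nth_eq_iff_index_eq)
        then have "i = 0" "j = length cs' - 1" using that by auto
        then show False
          using cycle_edges_nth_iff[OF d(1) that(1,2)] that e(3) by (simp add: cs'_def)
      qed
      moreover have "i < j \<or> j < i" using ij xz by (metis nat_neq_iff)
      ultimately show False using ij xz by (metis insert_commute)
    qed
    obtain n as bs where ab: "rotate n cs = as @ bs" "as \<noteq> []" "bs \<noteq> []"
      "f = {last bs, hd as}" "g = {last as, hd bs}"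
      by (rule two_cycle_edges_rotate[OF f(1) g(1) fg])
    have d: "distinct (as @ bs)" using cs(1) ab(1) by (metis distinct_rotate)
    have ce: "cycle_edges (as @ bs) = cycle_edges cs" by (metis ab(1) cycle_edges_rotate)
    have ss: "set (as @ bs) = set cs" by (metis ab(1) set_rotate)
    have ll: "length (as @ bs) = length cs" by (metis ab(1) length_rotate)
    \<comment> \<open>A chord within one part has an end cycle within that part, and hence
      \<open>f\<close> or \<open>g\<close>; but both of these join the two parts.\<close>
    have chordless: "j = Suc i"
      if us: "distinct (us @ ws)" "cycle_edges (us @ ws) = cycle_edges cs" "set (us @ ws) = set cs"
        "length (us @ ws) = length cs" "ws \<noteq> []" "\<not> f \<subseteq> set us" "\<not> g \<subseteq> set us"
        and ij: "i < j" "j < length us" "{us ! i, us ! j} \<in> E" for us ws :: "'a list" and i j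
    proof (rule ccontr)
      assume "j \<noteq> Suc i"
      moreover have "j \<noteq> length (us @ ws) - 1" using us(5) ij(2) by (cases ws) auto
      ultimately have "{(us @ ws) ! i, (us @ ws) ! j} \<notin> cycle_edges (us @ ws)"
        using cycle_edges_nth_iff[OF us(1), of i j] ij(1,2) by auto
      then have "f \<subseteq> (!) (us @ ws) ` {i..j} \<or> g \<subseteq> (!) (us @ ws) ` {i..j}"
        using below[OF us(2,3,1,4), of i j] ij by (simp add: nth_append)
      moreover have "(!) (us @ ws) ` {i..j} \<subseteq> set us" using ij by (auto simp: nth_append)
      ultimately show False using us(6,7) by blast
    qed
    have "\<not> f \<subseteq> set as" "\<not> g \<subseteq> set as" "\<not> f \<subseteq> set bs" "\<not> g \<subseteq> set bs"
      using d ab by (auto simp: disjoint_iff)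
    moreover have "distinct (bs @ as)" "cycle_edges (bs @ as) = cycle_edges cs"
      "set (bs @ as) = set cs" "length (bs @ as) = length cs"
      using d ce ss ll by (auto simp: cycle_edges_append_commute[of bs as])
    ultimately have "\<forall>i j. i < j \<and> j < length as \<and> {as ! i, as ! j} \<in> E \<longrightarrow> j = Suc i"
      "\<forall>i j. i < j \<and> j < length bs \<and> {bs ! i, bs ! j} \<in> E \<longrightarrow> j = Suc i"
      using chordless[OF d ce ss ll ab(3)] chordless[OF _ _ _ _ ab(2), of bs] by blast+
    then show ?thesis
      using ab Yfg by (intro exI[of _ n] exI[of _ as] exI[of _ bs]) auto
  qed
  then obtain n as bs where ab: "rotate n cs = as @ bs" "as \<noteq> []" "bs \<noteq> []"
    "Y \<subseteq> {hd as, last as, hd bs, last bs}"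
    "\<forall>i j. i < j \<and> j < length as \<and> {as ! i, as ! j} \<in> E \<longrightarrow> j = Suc i"
    "\<forall>i j. i < j \<and> j < length bs \<and> {bs ! i, bs ! j} \<in> E \<longrightarrow> j = Suc i"
    by (elim exE conjE) (rule that)
  obtain T where T: "\<forall>w. w \<notin> y ` {..<k} \<longrightarrow> T w = []" "\<forall>w. distinct (T w)"
    "\<forall>w w'. w \<noteq> w' \<longrightarrow> set (T w) \<inter> set (T w') = {}" "(\<Union>w. set (T w)) = V - R"
    "(\<Union>w. path_edges (T w)) = induced_edges E (V - R)"
    "\<forall>w. T w \<noteq> [] \<longrightarrow> {e \<in> E. e \<inter> set (T w) \<noteq> {} \<and> e \<inter> R \<noteq> {}} = {{last (T w), w}}"
    by (rule pendant_path_function[OF P])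
  interpret tailed_core V E R T
  proof
    show "simple_graph V E" "R \<subseteq> V" using simple RV by auto
    show "distinct (T w)" for w using T(2) by blast
    show "set (T w) \<inter> set (T w') = {}" if "w \<noteq> w'" for w w' using T(3) that by blast
    show "(\<Union>w. set (T w)) = V - R" "(\<Union>w. path_edges (T w)) = induced_edges E (V - R)" by fact+
    show "{e \<in> E. e \<inter> set (T w) \<noteq> {} \<and> e \<inter> R \<noteq> {}} = {{last (T w), w}}" if "T w \<noteq> []" for w
      using T(6)[rule_format, OF that] .
  qed
  have cyc': "cycle_in V E (as @ bs)" using cyc ab(1) cycle_in_rotate by metis
  show ?thesis
  proof (rule two_parallel_paths_extend[OF ab(2,3)])
    show "distinct (as @ bs)" "cycle_edges (as @ bs) \<subseteq> E" using cyc' by (auto simp: cycle_in_def)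
    show "set (as @ bs) = R" by (metis ab(1) cs(3) set_rotate)
    show "T w = []" if "w \<notin> {hd as, last as, hd bs, last bs}" for w
      using T(1) ab(4) that unfolding Y_def by blast
    \<comment> \<open>On \<open>as @ bs\<close> the four positions satisfy
      \<open>i < x < length as + j < length as + z\<close>, so the two edges interleave.\<close>
    show False if "i < x" "x < length as" "j < z" "z < length bs" "{as ! i, bs ! j} \<in> E" "{as ! x, bs ! z} \<in> E"
      for i x j z
      using chords_noncrossing_nth[OF cyc', of i x "length as + j" "length as + z"] that
      by (simp add: nth_append)
  qed (use ab(5,6) in blast)+
qed

end

section \<open>From the definition of two parallel paths to ladders, and the equivalence\<close>

lemma ladder_of_paths:
  assumes simple: "simple_graph V E"
    and vs: "induced_path V E vs" and us: "induced_path V E us" and disj: "set vs \<inter> set us = {}"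
    and card: "length vs + length us = card V"
    and nc: "\<forall>i<length vs. \<forall>j<length us. {vs ! i, us ! j} \<in> E \<longrightarrow>
      (\<forall>x<length vs. \<forall>y<length us. x > i \<and> y < j \<or> x < i \<and> y > j \<longrightarrow> {vs ! x, us ! y} \<notin> E)"
  shows "ladder V E ((!) vs) ((!) us) (length vs) (length us)"
proof -
  have d: "distinct vs" "distinct us" using vs us by (auto simp: induced_path_def is_path_graph_def)
  have edges: "{ws ! i, ws ! j} \<in> E \<longleftrightarrow> j = Suc i"
    if "induced_path V E ws" "i < j" "j < length ws" for ws i j
  proof -
    have "{ws ! i, ws ! j} \<in> E \<longleftrightarrow> {ws ! i, ws ! j} \<in> induced_edges E (set ws)"
      using that by (simp add: induced_edges_def)
    also have "\<dots> \<longleftrightarrow> {ws ! i, ws ! j} \<in> path_edges ws"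
      using that by (simp add: induced_path_def is_path_graph_def)
    also have "\<dots> \<longleftrightarrow> j = Suc i"
      using that by (intro path_edges_nth_iff) (auto simp: induced_path_def is_path_graph_def)
    finally show ?thesis .
  qed
  \<comment> \<open>The condition on the lengths forces the two disjoint paths to cover
    \<open>V\<close>.\<close>
  have "card (set vs \<union> set us) = card V"
    using d disj card by (simp add: card_Un_disjoint distinct_card)
  then have V: "V = set vs \<union> set us"
    using card_subset_eq[of V "set vs \<union> set us"] simple vs us
    by (auto simp: simple_graph_def induced_path_def)
  have img: "(!) ws ` {..<length ws} = set ws" for ws :: "'a list"
    by (auto simp: set_conv_nth)
  show ?thesis
  proof
    show "V = (!) vs ` {..<length vs} \<union> (!) us ` {..<length us}" using V img by simp
    show "(!) vs ` {..<length vs} \<inter> (!) us ` {..<length us} = {}" using disj img by simp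
    show "j \<le> y" if "i < length vs" "j < length us" "x < length vs" "y < length us"
      "{vs ! i, us ! j} \<in> E" "{vs ! x, us ! y} \<in> E" "i < x" for i j x y
    proof (rule ccontr)
      assume "\<not> j \<le> y"
      then show False using nc[rule_format, OF that(1,2,5,3,4)] that(6,7) by simp
    qed
  qed (use simple d edges[OF vs] edges[OF us] in \<open>auto simp: inj_on_def nth_eq_iff_index_eq\<close>)
qed

text \<open>The last vertex of the path that lies on the cycle needs two neighbours there, but only
  its predecessor is available. This disposes of the convention that a single path counts as two
  parallel paths.\<close>

lemma path_graph_no_cycle:
  assumes "is_path_graph V E vs" "cycle_in V E zs"
  shows False
proof -
  define I where "I = {i. i < length vs \<and> vs ! i \<in> set zs}"
  have zs: "distinct zs" "3 \<le> length zs" "set zs \<subseteq> V" "cycle_edges zs \<subseteq> E"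
    using assms(2) by (auto simp: cycle_in_def)
  have vs: "distinct vs" "set vs = V" "E = path_edges vs" using assms(1) by (auto simp: is_path_graph_def)
  have "hd zs \<in> set vs" "hd zs \<in> set zs" using zs vs by (cases zs; auto)+
  then obtain i where "i < length vs" "vs ! i = hd zs" by (auto simp: in_set_conv_nth)
  then have "i \<in> I" using \<open>hd zs \<in> set zs\<close> by (simp add: I_def)
  then have "I \<noteq> {}" by auto
  moreover have "finite I" by (simp add: I_def)
  ultimately have I: "Max I \<in> I" "\<And>k. k \<in> I \<Longrightarrow> k \<le> Max I" by auto
  define m where "m = Max I"
  have m: "m < length vs" "vs ! m \<in> set zs" using I(1) by (auto simp: I_def m_def)
  obtain y z where yz: "y \<noteq> z" "y \<noteq> vs ! m" "z \<noteq> vs ! m" "{vs ! m, y} \<in> cycle_edges zs"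
    "{vs ! m, z} \<in> cycle_edges zs"
    by (rule cycle_neighbours[OF zs(1,2) m(2)])
  have "w = vs ! (m - 1)" if w: "w \<noteq> vs ! m" "{vs ! m, w} \<in> cycle_edges zs" for w
  proof -
    have "{vs ! m, w} \<in> path_edges vs" using w zs vs by auto
    then obtain i where i: "Suc i < length vs" "{vs ! m, w} = {vs ! i, vs ! Suc i}"
      by (auto simp: path_edges_def)
    have "w \<in> set zs" using cycle_edges_subset[OF w(2)] by simp
    consider "vs ! m = vs ! i" "w = vs ! Suc i" | "vs ! m = vs ! Suc i" "w = vs ! i"
      using i(2) by (auto simp: doubleton_eq_iff)
    then show ?thesis
    proof cases
      case 1
      then have "m = i" using vs(1) m i by (simp add: nth_eq_iff_index_eq)
      moreover have "Suc i \<in> I" using 1 i \<open>w \<in> set zs\<close> by (simp add: I_def)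
      ultimately show ?thesis using I(2)[of "Suc i"] by (simp add: m_def)
    next
      case 2
      then have "m = Suc i" using vs(1) m i by (simp add: nth_eq_iff_index_eq)
      then show ?thesis using 2 by simp
    qed
  qed
  then show False using yz by metis
qed

theorem theorem4p11:
  fixes V :: "'a set" and E :: "'a set set"
    and pos :: "'a \<Rightarrow> complex" and crv :: "'a set \<Rightarrow> real \<Rightarrow> complex"
  assumes "simple_graph V E"
    and "connected_graph V E"
    and "\<exists>cs. cycle_in V E cs"
    and fixed_embedding: "outerplanar V E \<Longrightarrow> outerplanar_embedding V E pos crv"
  shows "two_parallel_paths V E \<longleftrightarrow>
    outerplanar V E \<and>
    (let R = core V E pos crv; ER = induced_edges E R in
      R \<noteq> {} \<and>
      (\<exists>cs.
        outer_cycle V E pos crv cs \<and>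
        (\<forall>S. induced_cycle V E S \<longrightarrow> num_interior E cs S \<le> 2) \<and>
        (\<not> is_cycle_graph R ER \<longrightarrow> card (end_cycles V E cs) = 2) \<and>
        (alpha_graph V E pos crv \<or>
         (\<exists>k\<le>4. \<exists>(P :: nat \<Rightarrow> 'a list) (y :: nat \<Rightarrow> 'a).
            disjoint_union_of_paths (V - R) (induced_edges E (V - R)) k P \<and>
            (\<forall>i<k. P i \<noteq> [] \<and> joined_at E R (P i) (y i)) \<and>
            inj_on y {..<k} \<and>
            (\<not> is_cycle_graph R ER \<longrightarrow>
               (\<forall>i<k. \<exists>S\<in>end_cycles V E cs. y i \<in> S) \<and>
               (\<exists>\<phi> :: 'a \<Rightarrow> 'a set.
                  (\<forall>i<k. \<phi> (y i) \<in> end_cycles V E cs \<and> y i \<in> \<phi> (y i)) \<and>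
                  (\<forall>C\<in>end_cycles V E cs. card {v \<in> y ` {..<k}. \<phi> v = C} \<le> 2) \<and>
                  (\<forall>i<k. \<forall>j<k. i \<noteq> j \<and> \<phi> (y i) = \<phi> (y j) \<longrightarrow>
                     {y i, y j} \<in> cycle_edges cs))) \<and>
            (is_cycle_graph R ER \<and> k \<ge> 3 \<longrightarrow>
               (\<exists>H\<in>{graph_K2_K1, graph_2K2, graph_P 3, graph_P 4, graph_C 3, graph_C 4}.
                  graph_iso (y ` {..<k}, induced_edges E (y ` {..<k})) H))))))"
  unfolding Let_def pendant_paths_def[symmetric]
proof
  let ?R = "core V E pos crv"
  have plane: "outerplane_graph V E pos crv" if "outerplanar V E"
    using fixed_embedding[OF that] assms(1)
    by unfold_locales (auto simp: outerplanar_embedding_def)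
  {
    assume tpp: "two_parallel_paths V E"
    obtain zs where zs: "cycle_in V E zs" using assms(3) by blast
    have "\<nexists>vs. is_path_graph V E vs" using path_graph_no_cycle zs by blast
    then obtain vs us where "ladder V E ((!) vs) ((!) us) (length vs) (length us)"
      using tpp ladder_of_paths[OF assms(1)] unfolding two_parallel_paths_def by blast
    then interpret ladder V E "(!) vs" "(!) us" "length vs" "length us" .
    \<comment> \<open>The vertex that carries two pendant paths may lie on either path; exchanging
      them reduces the second case to the first.\<close>
    interpret swapped: ladder V E "(!) us" "(!) vs" "length us" "length vs" by (rule swap)
    interpret outerplane_graph V E pos crv by (rule plane[OF outerplanar])
    obtain s t where st: "spans s t" by (rule spans_exists[OF zs])
    have st': "s \<in> cross" "t \<in> cross" "rk s < rk t" using st by (auto simp: spans_def)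
    have R: "?R = block s t" by (rule core_eq_block[OF st outerplane_graph_axioms])
    have ham: "hamiltonian_cycle ?R (induced_edges E ?R) (block_list s t)"
      unfolding R by (rule hamiltonian_block_list[OF st'])
    have "outer_cycle V E pos crv (block_list s t)" by (rule outer_cycleI[OF ham])
    moreover have "card (end_cycles V E (block_list s t)) = 2"
      if nc: "\<not> is_cycle_graph ?R (induced_edges E ?R)"
    proof -
      have "finite (induced_edges E ?R)" using finite_E by (simp add: induced_edges_def)
      then have "induced_edges E ?R \<noteq> cycle_edges (block_list s t)"
        using nc is_cycle_graph_iff[OF _ ham] by blast
      then obtain h where h: "h \<in> cross" "rk s < rk h" "rk h < rk t"
        unfolding R induced_edges_block[OF st'] by blast
      obtain s' t' where "block s s' \<noteq> block t' t"
        "end_cycles V E (block_list s t) = {block s s', block t' t}"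
        by (rule end_cycles_block_list[OF st h(1)]) (use h in auto)
      then show ?thesis by simp
    qed
    moreover have "alpha_graph V E pos crv \<or> pendant_paths V E ?R (block_list s t)"
    proof -
      consider "fst s = fst t \<and> 0 < fst s \<and> Suc (fst t) < length vs"
        | "snd s = snd t \<and> 0 < snd s \<and> Suc (snd t) < length us"
        | "\<not> (fst s = fst t \<and> 0 < fst s \<and> Suc (fst t) < length vs)"
          "\<not> (snd s = snd t \<and> 0 < snd s \<and> Suc (snd t) < length us)"
        by blast
      then show ?thesis
      proof cases
        case 1
        then show ?thesis using alpha_graphI[OF st outerplane_graph_axioms tpp] by blast
      next
        case 2
        then show ?thesis
          using swapped.alpha_graphI[OF swap_spans[OF st] outerplane_graph_axioms tpp] by simp
      next
        case 3
        then show ?thesis unfolding R using pendant_paths_ladder[OF st] by blast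
      qed
    qed
    moreover have "?R \<noteq> {}"
      using ham by (auto simp: hamiltonian_cycle_def cycle_in_def)
    ultimately show "outerplanar V E \<and> ?R \<noteq> {} \<and>
      (\<exists>cs. outer_cycle V E pos crv cs \<and>
        (\<forall>S. induced_cycle V E S \<longrightarrow> num_interior E cs S \<le> 2) \<and>
        (\<not> is_cycle_graph ?R (induced_edges E ?R) \<longrightarrow> card (end_cycles V E cs) = 2) \<and>
        (alpha_graph V E pos crv \<or> pendant_paths V E ?R cs))"
      using outerplanar num_interior_le_2[OF st] by blast
  next
    assume "outerplanar V E \<and> ?R \<noteq> {} \<and>
      (\<exists>cs. outer_cycle V E pos crv cs \<and>
        (\<forall>S. induced_cycle V E S \<longrightarrow> num_interior E cs S \<le> 2) \<and>
        (\<not> is_cycle_graph ?R (induced_edges E ?R) \<longrightarrow> card (end_cycles V E cs) = 2) \<and>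
        (alpha_graph V E pos crv \<or> pendant_paths V E ?R cs))"
    then obtain cs where cs: "outerplanar V E" "outer_cycle V E pos crv cs"
      "\<not> is_cycle_graph ?R (induced_edges E ?R) \<Longrightarrow> card (end_cycles V E cs) = 2"
      "alpha_graph V E pos crv \<or> pendant_paths V E ?R cs"
      by blast
    interpret outerplane_graph V E pos crv by (rule plane[OF cs(1)])
    \<comment> \<open>An \<alpha>-graph is a graph of two parallel paths by definition, so only the
      other alternative needs an argument.\<close>
    show "two_parallel_paths V E"
      using cs(4) two_parallel_paths_if_pendant_paths[OF cs(2) refl cs(3)]
      by (auto simp: alpha_graph_def)
  }
qed

end
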